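(* Let $n\geq 2$ and let $0<s<\frac{1}{2}$. There exists a complete Riemannian $n$-manifold $(M,g)$ such that $\int_M w^s<\infty$ and $$\lambda_0(M)>\frac{(n-1)^2}{4},$$ where $w(x) = \left\{\inf_{v\in T_xM,\,|v|=1}\{\mathrm{Ric}(v,v)+(n-1)\}\right\}_{-}$ for $x\in M$.
   Context: For a real number $a$, $\{a\}_- = \max\{-a,0\}\ge 0$ denotes its negative part; thus $w\geq 0$ measures how far the Ricci curvature of $M$ falls below $-(n-1)$. Integrals are with respect to the Riemannian volume measure. The bottom of the spectrum of the Laplacian on a complete Riemannian manifold $M$ is $$\lambda_0(M) = \inf_{\phi}\frac{\int_M|\nabla \phi|^2}{\int_M\phi^2},$$ where the infimum is over all smooth compactly supported functions $\phi$ on $M$, not identically zero. *)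

theory Defs
  imports "HOL-Analysis.Analysis"
begin

section \<open>Smooth maps between open subsets of Euclidean spaces\<close>

text \<open>The set \<open>S\<close> is open in all uses below. \<open>Ck_on k S f\<close> says that all iterated
  directional derivatives of order at most \<open>k\<close> exist and are continuous on \<open>S\<close>.\<close>

primrec Ck_on :: "nat \<Rightarrow> 'e::euclidean_space set \<Rightarrow> ('e \<Rightarrow> 'f::euclidean_space) \<Rightarrow> bool" where
  "Ck_on 0 S f \<longleftrightarrow> continuous_on S f"
| "Ck_on (Suc k) S f \<longleftrightarrow>
     (\<forall>x\<in>S. f differentiable (at x)) \<and>
     (\<forall>v. Ck_on k S (\<lambda>x. frechet_derivative f (at x) v))"

definition smooth_on :: "'e::euclidean_space set \<Rightarrow> ('e \<Rightarrow> 'f::euclidean_space) \<Rightarrow> bool" where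
  "smooth_on S f \<longleftrightarrow> (\<forall>k. Ck_on k S f)"

definition partial_deriv :: "'n \<Rightarrow> (real^'n \<Rightarrow> real) \<Rightarrow> real^'n \<Rightarrow> real" where
  "partial_deriv i f x = frechet_derivative f (at x) (axis i 1)"


section \<open>Riemannian manifolds\<close>

text \<open>A chart is its domain together with a coordinate map, whose values outside the domain are
  irrelevant. A tangent vector at \<open>p\<close> is represented by the family of its coordinate vectors, one
  for each chart of the atlas around \<open>p\<close> (and \<open>0\<close> for all other charts), related by the
  derivatives of the transition maps.\<close>

type_synonym ('a, 'n) chart = "'a set \<times> ('a \<Rightarrow> real^'n)"
type_synonym ('a, 'n) tvec = "('a, 'n) chart \<Rightarrow> real^'n"

record ('a, 'n) riemannian =
  mtop :: "'a topology"
  charts :: "('a, 'n) chart set"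
  gmetric :: "'a \<Rightarrow> ('a, 'n) tvec \<Rightarrow> ('a, 'n) tvec \<Rightarrow> real"

abbreviation pts :: "('a, 'n::finite) riemannian \<Rightarrow> 'a set" where
  "pts M \<equiv> topspace (mtop M)"

abbreviation cdom :: "('a, 'n::finite) chart \<Rightarrow> 'a set" where
  "cdom c \<equiv> fst c"

abbreviation cmap :: "('a, 'n::finite) chart \<Rightarrow> 'a \<Rightarrow> real^'n" where
  "cmap c \<equiv> snd c"

abbreviation crange :: "('a, 'n::finite) chart \<Rightarrow> (real^'n) set" where
  "crange c \<equiv> cmap c ` cdom c"

abbreviation cinv :: "('a, 'n::finite) chart \<Rightarrow> real^'n \<Rightarrow> 'a" where
  "cinv c \<equiv> inv_into (cdom c) (cmap c)"

definition is_chart :: "'a topology \<Rightarrow> ('a, 'n::finite) chart \<Rightarrow> bool" where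
  "is_chart X c \<longleftrightarrow> openin X (cdom c) \<and> open (crange c) \<and>
     homeomorphic_map (subtopology X (cdom c)) (top_of_set (crange c)) (cmap c)"

definition transition ::
    "('a, 'n::finite) chart \<Rightarrow> ('a, 'n) chart \<Rightarrow> real^'n \<Rightarrow> real^'n" where
  "transition c d = cmap d \<circ> cinv c"

text \<open>Manifolds are nonempty, connected, Hausdorff and second countable; the atlas need not be
  maximal.\<close>

definition smooth_manifold :: "('a, 'n::finite) riemannian \<Rightarrow> bool" where
  "smooth_manifold M \<longleftrightarrow>
     pts M \<noteq> {} \<and> connected_space (mtop M) \<and> Hausdorff_space (mtop M) \<and>
     second_countable (mtop M) \<and>
     (\<forall>c\<in>charts M. is_chart (mtop M) c) \<and>
     (\<Union>c\<in>charts M. cdom c) = pts M \<and>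
     (\<forall>c\<in>charts M. \<forall>d\<in>charts M.
        smooth_on (cmap c ` (cdom c \<inter> cdom d)) (transition c d))"

definition charts_at :: "('a, 'n::finite) riemannian \<Rightarrow> 'a \<Rightarrow> ('a, 'n) chart set" where
  "charts_at M p = {c \<in> charts M. p \<in> cdom c}"

definition chart_at :: "('a, 'n::finite) riemannian \<Rightarrow> 'a \<Rightarrow> ('a, 'n) chart" where
  "chart_at M p = (SOME c. c \<in> charts_at M p)"

definition tangent_space :: "('a, 'n::finite) riemannian \<Rightarrow> 'a \<Rightarrow> ('a, 'n) tvec set" where
  "tangent_space M p =
     {v. (\<forall>c. c \<notin> charts_at M p \<longrightarrow> v c = 0) \<and>
         (\<forall>c\<in>charts_at M p. \<forall>d\<in>charts_at M p.
            v d = frechet_derivative (transition c d) (at (cmap c p)) (v c))}"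

text \<open>The coordinate vector field \<open>\<partial>\<^sub>i\<close> of the chart \<open>c\<close>, at the point \<open>p\<close>.\<close>

definition coord_vec ::
    "('a, 'n::finite) riemannian \<Rightarrow> ('a, 'n) chart \<Rightarrow> 'a \<Rightarrow> 'n \<Rightarrow> ('a, 'n) tvec" where
  "coord_vec M c p i =
     (\<lambda>d. if d \<in> charts_at M p
          then frechet_derivative (transition c d) (at (cmap c p)) (axis i 1) else 0)"

definition metric_coeff ::
    "('a, 'n::finite) riemannian \<Rightarrow> ('a, 'n) chart \<Rightarrow> real^'n \<Rightarrow> real^'n^'n" where
  "metric_coeff M c x =
     (\<chi> i j. gmetric M (cinv c x) (coord_vec M c (cinv c x) i) (coord_vec M c (cinv c x) j))"

definition riemannian_manifold :: "('a, 'n::finite) riemannian \<Rightarrow> bool" where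
  "riemannian_manifold M \<longleftrightarrow> smooth_manifold M \<and>
     (\<forall>p\<in>pts M.
        (\<forall>u\<in>tangent_space M p. \<forall>v\<in>tangent_space M p. gmetric M p u v = gmetric M p v u) \<and>
        (\<forall>u\<in>tangent_space M p. \<forall>v\<in>tangent_space M p. \<forall>w\<in>tangent_space M p. \<forall>a b.
           gmetric M p (\<lambda>c. a *\<^sub>R u c + b *\<^sub>R v c) w = a * gmetric M p u w + b * gmetric M p v w) \<and>
        (\<forall>v\<in>tangent_space M p. v \<noteq> (\<lambda>c. 0) \<longrightarrow> gmetric M p v v > 0)) \<and>
     (\<forall>c\<in>charts M. smooth_on (crange c) (metric_coeff M c))"

definition tnorm :: "('a, 'n::finite) riemannian \<Rightarrow> 'a \<Rightarrow> ('a, 'n) tvec \<Rightarrow> real" where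
  "tnorm M p v = sqrt (gmetric M p v v)"


section \<open>Ricci curvature\<close>

text \<open>\<open>christoffel M c k i j\<close> is \<open>\<Gamma>\<^sup>k\<^sub>i\<^sub>j\<close> in the chart \<open>c\<close>.\<close>

definition christoffel ::
    "('a, 'n::finite) riemannian \<Rightarrow> ('a, 'n) chart \<Rightarrow> 'n \<Rightarrow> 'n \<Rightarrow> 'n \<Rightarrow> real^'n \<Rightarrow> real" where
  "christoffel M c k i j x =
     (\<Sum>l\<in>UNIV. matrix_inv (metric_coeff M c x) $ k $ l *
        (partial_deriv i (\<lambda>y. metric_coeff M c y $ j $ l) x
         + partial_deriv j (\<lambda>y. metric_coeff M c y $ i $ l) x
         - partial_deriv l (\<lambda>y. metric_coeff M c y $ i $ j) x)) / 2"

text \<open>\<open>riemann_coeff M c l k i j\<close> is the coefficient of \<open>\<partial>\<^sub>l\<close> in \<open>R(\<partial>\<^sub>i, \<partial>\<^sub>j) \<partial>\<^sub>k\<close>, where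
  \<open>R(X,Y) = [\<nabla>\<^sub>X, \<nabla>\<^sub>Y] - \<nabla>\<^bsub>[X,Y]\<^esub>\<close>; the Ricci form \<open>Ric(Y,Z)\<close> is the trace of \<open>X \<mapsto> R(X,Y)Z\<close>,
  which is positive on round spheres.\<close>

definition riemann_coeff ::
    "('a, 'n::finite) riemannian \<Rightarrow> ('a, 'n) chart \<Rightarrow> 'n \<Rightarrow> 'n \<Rightarrow> 'n \<Rightarrow> 'n \<Rightarrow> real^'n \<Rightarrow> real" where
  "riemann_coeff M c l k i j x =
     partial_deriv i (christoffel M c l j k) x - partial_deriv j (christoffel M c l i k) x
     + (\<Sum>m\<in>UNIV. christoffel M c l i m x * christoffel M c m j k x
                - christoffel M c l j m x * christoffel M c m i k x)"

definition ricci_coeff ::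
    "('a, 'n::finite) riemannian \<Rightarrow> ('a, 'n) chart \<Rightarrow> 'n \<Rightarrow> 'n \<Rightarrow> real^'n \<Rightarrow> real" where
  "ricci_coeff M c j k x = (\<Sum>i\<in>UNIV. riemann_coeff M c i k i j x)"

definition ricci ::
    "('a, 'n::finite) riemannian \<Rightarrow> 'a \<Rightarrow> ('a, 'n) tvec \<Rightarrow> ('a, 'n) tvec \<Rightarrow> real" where
  "ricci M p u v = (let c = chart_at M p in
     \<Sum>j\<in>UNIV. \<Sum>k\<in>UNIV. ricci_coeff M c j k (cmap c p) * u c $ j * v c $ k)"

definition neg_part :: "real \<Rightarrow> real" where
  "neg_part a = max (- a) 0"

definition ricci_defect :: "('a, 'n::finite) riemannian \<Rightarrow> 'a \<Rightarrow> real" where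
  "ricci_defect M p =
     neg_part (INF v\<in>{v \<in> tangent_space M p. tnorm M p v = 1}.
       ricci M p v v + (real CARD('n) - 1))"


section \<open>Riemannian distance and completeness\<close>

definition C1_curve_on ::
    "('a, 'n::finite) riemannian \<Rightarrow> real \<Rightarrow> real \<Rightarrow> (real \<Rightarrow> 'a) \<Rightarrow> bool" where
  "C1_curve_on M a b \<gamma> \<longleftrightarrow>
     (\<forall>t\<in>{a..b}. \<forall>c\<in>charts_at M (\<gamma> t).
        (cmap c \<circ> \<gamma>) differentiable (at t within {a..b}) \<and>
        continuous (at t within {a..b})
          (\<lambda>u. vector_derivative (cmap c \<circ> \<gamma>) (at u within {a..b})))"

definition piecewise_C1_curve :: "('a, 'n::finite) riemannian \<Rightarrow> (real \<Rightarrow> 'a) \<Rightarrow> bool" where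
  "piecewise_C1_curve M \<gamma> \<longleftrightarrow>
     continuous_map (top_of_set {0..1}) (mtop M) \<gamma> \<and>
     (\<exists>m (\<tau> :: nat \<Rightarrow> real). \<tau> 0 = 0 \<and> \<tau> m = 1 \<and>
        (\<forall>i<m. \<tau> i < \<tau> (Suc i) \<and> C1_curve_on M (\<tau> i) (\<tau> (Suc i)) \<gamma>))"

definition velocity ::
    "('a, 'n::finite) riemannian \<Rightarrow> (real \<Rightarrow> 'a) \<Rightarrow> real \<Rightarrow> ('a, 'n) tvec" where
  "velocity M \<gamma> t =
     (\<lambda>c. if c \<in> charts_at M (\<gamma> t) then vector_derivative (cmap c \<circ> \<gamma>) (at t) else 0)"

definition curve_length :: "('a, 'n::finite) riemannian \<Rightarrow> (real \<Rightarrow> 'a) \<Rightarrow> real" where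
  "curve_length M \<gamma> = integral {0..1} (\<lambda>t. tnorm M (\<gamma> t) (velocity M \<gamma> t))"

definition riemannian_dist :: "('a, 'n::finite) riemannian \<Rightarrow> 'a \<Rightarrow> 'a \<Rightarrow> real" where
  "riemannian_dist M p q =
     (INF \<gamma>\<in>{\<gamma>. piecewise_C1_curve M \<gamma> \<and> \<gamma> 0 = p \<and> \<gamma> 1 = q}. curve_length M \<gamma>)"

definition complete_riemannian_manifold :: "('a, 'n::finite) riemannian \<Rightarrow> bool" where
  "complete_riemannian_manifold M \<longleftrightarrow>
     riemannian_manifold M \<and> Metric_space.mcomplete (pts M) (riemannian_dist M)"


section \<open>Riemannian volume measure\<close>

text \<open>The unique Borel measure on the manifold given by \<open>sqrt (det g)\<close> times Lebesgue measure in
  every chart.\<close>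

definition riemannian_volume :: "('a, 'n::finite) riemannian \<Rightarrow> 'a measure" where
  "riemannian_volume M = (THE \<mu>.
     space \<mu> = pts M \<and>
     sets \<mu> = sigma_sets (pts M) {U. openin (mtop M) U} \<and>
     (\<forall>c\<in>charts M. \<forall>A\<in>sets \<mu>. A \<subseteq> cdom c \<longrightarrow>
        emeasure \<mu> A =
          (\<integral>\<^sup>+ x \<in> cmap c ` A. ennreal (sqrt (det (metric_coeff M c x))) \<partial>lborel)))"


section \<open>Bottom of the spectrum\<close>

definition smooth_fun :: "('a, 'n::finite) riemannian \<Rightarrow> ('a \<Rightarrow> real) \<Rightarrow> bool" where
  "smooth_fun M f \<longleftrightarrow> (\<forall>c\<in>charts M. smooth_on (crange c) (f \<circ> cinv c))"

definition compact_support :: "('a, 'n::finite) riemannian \<Rightarrow> ('a \<Rightarrow> real) \<Rightarrow> bool" where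
  "compact_support M f \<longleftrightarrow>
     compactin (mtop M) (mtop M closure_of {p \<in> pts M. f p \<noteq> 0})"

definition differential ::
    "('a, 'n::finite) riemannian \<Rightarrow> ('a \<Rightarrow> real) \<Rightarrow> 'a \<Rightarrow> ('a, 'n) tvec \<Rightarrow> real" where
  "differential M f p v = (let c = chart_at M p in
     frechet_derivative (f \<circ> cinv c) (at (cmap c p)) (v c))"

definition gradient ::
    "('a, 'n::finite) riemannian \<Rightarrow> ('a \<Rightarrow> real) \<Rightarrow> 'a \<Rightarrow> ('a, 'n) tvec" where
  "gradient M f p = (THE u. u \<in> tangent_space M p \<and>
     (\<forall>v\<in>tangent_space M p. gmetric M p u v = differential M f p v))"

definition test_functions :: "('a, 'n::finite) riemannian \<Rightarrow> ('a \<Rightarrow> real) set" where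
  "test_functions M =
     {f. smooth_fun M f \<and> compact_support M f \<and> (\<exists>p\<in>pts M. f p \<noteq> 0)}"

definition spectrum_bottom :: "('a, 'n::finite) riemannian \<Rightarrow> real" where
  "spectrum_bottom M = (INF f\<in>test_functions M.
     (\<integral>p. (tnorm M p (gradient M f p))\<^sup>2 \<partial>riemannian_volume M) /
     (\<integral>p. (f p)\<^sup>2 \<partial>riemannian_volume M))"

end

theory Submission imports Defs
begin

text \<open>
  The manifold is the unit ball of \<open>\<real>\<^sup>n\<close> with a metric \<open>P(q)\<^sup>-\<^sup>2 |dx|\<^sup>2\<close>, where \<open>q = |x|\<^sup>2\<close> and \<open>P\<close> decreases
  to \<open>0\<close> at \<open>q = 1\<close>. Everything is governed by \<open>Q = - P'\<close>; hyperbolic space is the case \<open>Q = 1/2\<close>.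

  Spectrum. The vector field \<open>X = 2 P x / (1 + q)\<close>, which is \<open>tanh r \<partial>\<^sub>r\<close> in hyperbolic space, has norm at
  most \<open>1\<close>, and its divergence is at least \<open>(n - 1) b\<close> as soon as \<open>Q \<ge> b/2\<close>. Integrating
  \<open>0 \<le> |\<nabla>f + \<kappa> f X|\<^sup>2\<close> by parts, with \<open>\<kappa> = (n - 1) b / 2\<close>, gives \<open>\<lambda>\<^sub>0 \<ge> ((n - 1) b / 2)\<^sup>2\<close>
  (\<open>spectrum_bottom_ge\<close>). So it is enough to keep \<open>2 Q\<close> above a constant \<open>b > 1\<close>.

  Curvature. For a unit vector at angle \<open>\<theta>\<close> to the radial direction,
  \<open>Ric + (n - 1) = - (1 + (n - 2) cos\<^sup>2 \<theta>) 4 q P Q' - (n - 1) E\<close> with \<open>E = 4 (Q P + q Q\<^sup>2) - 1\<close>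
  (\<open>ricci_M\<close>). If \<open>2 Q \<ge> b > 1\<close>, then \<open>E\<close> is positive near the boundary, and the bound
  \<open>Ric \<ge> - (n - 1)\<close> forces \<open>Q\<close> to decrease at a definite rate in the variable \<open>- ln (1 - q)\<close>, which
  far out is comparable to the distance from the centre. As \<open>Q\<close> must not fall below \<open>b/2\<close>, it has to
  jump up again and again. The proof takes for \<open>Q\<close> a smooth sawtooth in the phase \<open>t = - \<nu> ln (1 - q)\<close>: its slope is \<open>-1\<close>
  plus a Poisson kernel of width \<open>\<epsilon> = (1 - q)\<^sup>N\<close> concentrated at the zeros of \<open>sin t\<close>
  (\<open>has_real_derivative_saw\<close>). The slope \<open>-1\<close>, magnified by a large \<open>\<nu>\<close>, pays for \<open>E\<close>.

  Integrability. On the outer part of the ball only the Poisson kernel contributes to the defect, so that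
  \<open>w \<le> C \<epsilon> / sin\<^sup>2 t\<close> there. The singularity \<open>|sin t|\<^sup>-\<^sup>2\<^sup>s\<close> of the \<open>s\<close>-th power is integrable over a period
  because \<open>s < 1/2\<close>, and for \<open>N s \<ge> n\<close> the factor \<open>\<epsilon>\<^sup>s\<close> compensates the growth of the volume
  (\<open>integrable_defect\<close>). On the inner part, where \<open>q < 1/2\<close>, the defect is bounded.

  Completeness holds because \<open>P(q) \<le> a (1 - q)\<close> puts the boundary at infinite distance
  (\<open>complete_M\<close>).
\<close>

section \<open>Closure properties of smooth functions\<close>

lemma Ck_on_cong:
  fixes f g :: "'e::euclidean_space \<Rightarrow> 'f::euclidean_space"
  assumes "open S" and "\<And>x. x \<in> S \<Longrightarrow> f x = g x"
  shows "Ck_on k S f \<longleftrightarrow> Ck_on k S g"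
  using assms(2)
proof (induction k arbitrary: f g)
  case 0
  then show ?case by (auto cong: continuous_on_cong)
next
  case (Suc k)
  have ev: "\<forall>\<^sub>F y in nhds x. f y = g y" if "x \<in> S" for x
    using eventually_nhds_in_open[OF \<open>open S\<close> that] by eventually_elim (auto simp: Suc.prems)
  have der: "(f has_derivative D) (at x) \<longleftrightarrow> (g has_derivative D) (at x)" if "x \<in> S" for x D
    using has_derivative_transform_within_open[OF _ \<open>open S\<close> that, of f D UNIV g]
      has_derivative_transform_within_open[OF _ \<open>open S\<close> that, of g D UNIV f] Suc.prems
    by auto
  then have d: "f differentiable (at x) \<longleftrightarrow> g differentiable (at x)" if "x \<in> S" for x
    using that by (simp add: differentiable_def)
  have fr: "frechet_derivative f (at x) = frechet_derivative g (at x)" if "x \<in> S" for x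
    using that der by (simp add: frechet_derivative_def)
  have "Ck_on k S (\<lambda>x. frechet_derivative f (at x) v) \<longleftrightarrow> Ck_on k S (\<lambda>x. frechet_derivative g (at x) v)" for v
    by (rule Suc.IH) (simp add: fr)
  then show ?case by (simp add: d)
qed

lemma Ck_on_SucI:
  fixes f :: "'e::euclidean_space \<Rightarrow> 'f::euclidean_space"
  assumes "open S" and "\<And>x. x \<in> S \<Longrightarrow> (f has_derivative D x) (at x)" and "\<And>v. Ck_on k S (\<lambda>x. D x v)"
  shows "Ck_on (Suc k) S f"
proof -
  have fr: "frechet_derivative f (at x) = D x" if "x \<in> S" for x
    using assms(2)[OF that] by (metis frechet_derivative_at)
  have "Ck_on k S (\<lambda>x. frechet_derivative f (at x) v) \<longleftrightarrow> Ck_on k S (\<lambda>x. D x v)" for v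
    by (rule Ck_on_cong[OF \<open>open S\<close>]) (simp add: fr)
  then show ?thesis using assms(2,3) by (auto simp: differentiable_def)
qed

lemma Ck_on_SucD:
  assumes "Ck_on (Suc k) S f" shows "Ck_on k S f"
  using assms
proof (induction k arbitrary: f)
  case 0
  then have "f differentiable (at x)" if "x \<in> S" for x using that by simp
  then show ?case
    by (simp add: differentiable_imp_continuous_within continuous_at_imp_continuous_on)
next
  case (Suc k)
  note * = Suc.prems[unfolded Ck_on.simps(2)[of "Suc k"]]
  show ?case unfolding Ck_on.simps(2)[of k]
  proof (intro conjI allI)
    show "\<forall>x\<in>S. f differentiable at x" using * by (rule conjunct1)
    show "Ck_on k S (\<lambda>x. frechet_derivative f (at x) v)" for v
      by (rule Suc.IH) (rule *[THEN conjunct2, THEN spec])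
  qed
qed

lemma Ck_on_has_derivative:
  "Ck_on (Suc k) S f \<Longrightarrow> x \<in> S \<Longrightarrow> (f has_derivative frechet_derivative f (at x)) (at x)"
  by (simp add: frechet_derivative_works)

lemma Ck_on_frechet: "Ck_on (Suc k) S f \<Longrightarrow> Ck_on k S (\<lambda>x. frechet_derivative f (at x) v)"
  by simp

lemma Ck_on_const: "open S \<Longrightarrow> Ck_on k S (\<lambda>x. c)"
proof (induction k arbitrary: c)
  case (Suc k)
  show ?case
    by (rule Ck_on_SucI[where D = "\<lambda>x v. 0"]) (use Suc in auto)
qed simp

lemma Ck_on_bounded_linear: "open S \<Longrightarrow> bounded_linear f \<Longrightarrow> Ck_on k S f"
proof (cases k)
  case (Suc j)
  assume "open S" "bounded_linear f"
  then show ?thesis unfolding Suc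
    by (intro Ck_on_SucI[where D = "\<lambda>x. f"]) (auto intro: Ck_on_const bounded_linear_imp_has_derivative)
qed (auto intro: linear_continuous_on)

lemma Ck_on_compose_linear:
  assumes "open S" "bounded_linear h" "Ck_on k S f" shows "Ck_on k S (\<lambda>x. h (f x))"
  using assms(3)
proof (induction k arbitrary: f)
  case 0
  then show ?case using bounded_linear.continuous_on[OF assms(2), of S f] by simp
next
  case (Suc k)
  show ?case
    by (rule Ck_on_SucI[OF assms(1) bounded_linear.has_derivative[OF assms(2) Ck_on_has_derivative[OF Suc.prems]]])
       (use Suc in auto)
qed

lemma Ck_on_add:
  assumes "open S" "Ck_on k S f" "Ck_on k S g" shows "Ck_on k S (\<lambda>x. f x + g x)"
  using assms(2,3)
proof (induction k arbitrary: f g)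
  case 0 then show ?case by (simp add: continuous_on_add)
next
  case (Suc k)
  show ?case
    by (rule Ck_on_SucI[OF assms(1) has_derivative_add[OF Ck_on_has_derivative[OF Suc.prems(1)] Ck_on_has_derivative[OF Suc.prems(2)]]])
       (use Suc in auto)
qed

lemma Ck_on_mult:
  fixes f g :: "'e::euclidean_space \<Rightarrow> real"
  assumes "open S" "Ck_on k S f" "Ck_on k S g" shows "Ck_on k S (\<lambda>x. f x * g x)"
  using assms(2,3)
proof (induction k arbitrary: f g)
  case 0 then show ?case by (simp add: continuous_on_mult)
next
  case (Suc k)
  show ?case
    by (rule Ck_on_SucI[OF assms(1) has_derivative_mult[OF Ck_on_has_derivative[OF Suc.prems(1)] Ck_on_has_derivative[OF Suc.prems(2)]]])
       (use Suc Ck_on_SucD[OF Suc.prems(1)] Ck_on_SucD[OF Suc.prems(2)] in \<open>auto intro!: Ck_on_add assms(1)\<close>)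
qed

lemma Ck_on_compose:
  fixes f :: "'e::euclidean_space \<Rightarrow> real" and h :: "real \<Rightarrow> real"
  assumes "open S" "open T" "f ` S \<subseteq> T" "Ck_on k T h" "Ck_on k S f"
  shows "Ck_on k S (\<lambda>x. h (f x))"
  using assms(4,5)
proof (induction k arbitrary: h)
  case 0 then show ?case using assms(3) by (auto intro: continuous_on_compose2)
next
  case (Suc k)
  have h: "(h has_derivative (\<lambda>t. t * frechet_derivative h (at y) 1)) (at y)" if "y \<in> T" for y
  proof -
    have D: "(h has_derivative frechet_derivative h (at y)) (at y)"
      using Ck_on_has_derivative[OF Suc.prems(1) that] .
    then have "frechet_derivative h (at y) t = t * frechet_derivative h (at y) 1" for t
      using linear_scale[OF has_derivative_linear[OF D], of t 1] by simp
    then have "frechet_derivative h (at y) = (\<lambda>t. t * frechet_derivative h (at y) 1)" by blast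
    then show ?thesis using D by simp
  qed
  have "((\<lambda>x. h (f x)) has_derivative (\<lambda>v. frechet_derivative f (at x) v * frechet_derivative h (at (f x)) 1)) (at x)" if "x \<in> S" for x
    using has_derivative_compose[OF Ck_on_has_derivative[OF Suc.prems(2) that] h] assms(3) that by auto
  then show ?case
  proof (rule Ck_on_SucI[OF assms(1)])
    show "Ck_on k S (\<lambda>x. frechet_derivative f (at x) v * frechet_derivative h (at (f x)) 1)" for v
      using Suc.IH[OF Ck_on_frechet[OF Suc.prems(1)] Ck_on_SucD[OF Suc.prems(2)]] Suc.prems(2)
      by (intro Ck_on_mult assms(1)) auto
  qed
qed

lemma smooth_on_cong: "open S \<Longrightarrow> (\<And>x. x \<in> S \<Longrightarrow> f x = g x) \<Longrightarrow> smooth_on S f \<longleftrightarrow> smooth_on S g"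
  unfolding smooth_on_def using Ck_on_cong by blast

lemma smooth_on_const: "open S \<Longrightarrow> smooth_on S (\<lambda>x. c)"
  by (simp add: smooth_on_def Ck_on_const)

lemma smooth_on_linear: "open S \<Longrightarrow> bounded_linear f \<Longrightarrow> smooth_on S f"
  by (simp add: smooth_on_def Ck_on_bounded_linear)

lemma smooth_on_compose_linear:
  "open S \<Longrightarrow> bounded_linear h \<Longrightarrow> smooth_on S f \<Longrightarrow> smooth_on S (\<lambda>x. h (f x))"
  by (simp add: smooth_on_def Ck_on_compose_linear)

lemma smooth_on_add: "open S \<Longrightarrow> smooth_on S f \<Longrightarrow> smooth_on S g \<Longrightarrow> smooth_on S (\<lambda>x. f x + g x)"
  by (simp add: smooth_on_def Ck_on_add)

lemma smooth_on_mult: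
  fixes f g :: "'e::euclidean_space \<Rightarrow> real"
  shows "open S \<Longrightarrow> smooth_on S f \<Longrightarrow> smooth_on S g \<Longrightarrow> smooth_on S (\<lambda>x. f x * g x)"
  by (simp add: smooth_on_def Ck_on_mult)

lemma smooth_on_power:
  fixes f :: "'e::euclidean_space \<Rightarrow> real"
  shows "open S \<Longrightarrow> smooth_on S f \<Longrightarrow> smooth_on S (\<lambda>x. f x ^ j)"
  by (induction j) (simp_all add: smooth_on_const smooth_on_mult)

lemma smooth_on_compose:
  fixes f :: "'e::euclidean_space \<Rightarrow> real" and h :: "real \<Rightarrow> real"
  shows "open S \<Longrightarrow> open T \<Longrightarrow> f ` S \<subseteq> T \<Longrightarrow> smooth_on T h \<Longrightarrow> smooth_on S f \<Longrightarrow> smooth_on S (\<lambda>x. h (f x))"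
  unfolding smooth_on_def using Ck_on_compose by blast

lemma Ck_on_real_SucI:
  fixes f :: "real \<Rightarrow> real"
  assumes "open T" and "\<And>t. t \<in> T \<Longrightarrow> (f has_real_derivative f' t) (at t)" and "Ck_on k T f'"
  shows "Ck_on (Suc k) T f"
proof (rule Ck_on_SucI[OF assms(1)])
  show "(f has_derivative (*) (f' t)) (at t)" if "t \<in> T" for t
    using assms(2)[OF that] by (simp add: has_field_derivative_def)
  show "Ck_on k T (\<lambda>t. f' t * v)" for v
    by (intro Ck_on_mult assms Ck_on_const)
qed

text \<open>Reduces the smoothness of \<open>ln\<close>, of \<open>arctan\<close> and of the profile \<open>P\<close>, which is defined by an
  integral, to that of their derivatives.\<close>

lemma smooth_on_real_deriv:
  fixes f :: "real \<Rightarrow> real"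
  assumes "open T" and "\<And>t. t \<in> T \<Longrightarrow> (f has_real_derivative f' t) (at t)" and "smooth_on T f'"
  shows "smooth_on T f"
  unfolding smooth_on_def
proof
  fix k show "Ck_on k T f"
    using Ck_on_real_SucI[OF assms(1,2)] assms(3) Ck_on_SucD[of k T f]
    by (auto simp: smooth_on_def)
qed

lemma smooth_on_sin_cos: "open T \<Longrightarrow> smooth_on T (sin :: real \<Rightarrow> real)" "open T \<Longrightarrow> smooth_on T (cos :: real \<Rightarrow> real)"
proof -
  have "Ck_on k T sin \<and> Ck_on k T (cos :: real \<Rightarrow> real)" if "open T" for k
  proof (induction k)
    case 0 show ?case by (auto intro: continuous_intros)
  next
    case (Suc k)
    have "Ck_on (Suc k) T sin"
      by (rule Ck_on_real_SucI[OF that DERIV_sin]) (use Suc in blast)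
    moreover have "Ck_on k T (\<lambda>x. (-1) * sin x :: real)"
      using Suc that by (intro Ck_on_mult Ck_on_const) auto
    then have "Ck_on (Suc k) T (cos :: real \<Rightarrow> real)"
      by (intro Ck_on_real_SucI[OF that DERIV_cos]) simp
    ultimately show ?case by blast
  qed
  then show "open T \<Longrightarrow> smooth_on T (sin :: real \<Rightarrow> real)" "open T \<Longrightarrow> smooth_on T (cos :: real \<Rightarrow> real)"
    by (auto simp: smooth_on_def)
qed

lemma smooth_on_inverse_real:
  assumes "open T" "0 \<notin> T" shows "smooth_on T (inverse :: real \<Rightarrow> real)"
  unfolding smooth_on_def
proof
  fix k show "Ck_on k T (inverse :: real \<Rightarrow> real)"
  proof (induction k)
    case 0 show ?case using assms by (auto intro!: continuous_intros)
  next
    case (Suc k)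
    show ?case
    proof (rule Ck_on_real_SucI[OF assms(1)])
      show "(inverse has_real_derivative (-1) * (inverse t * inverse t)) (at t)" if "t \<in> T" for t
        using DERIV_inverse[of t UNIV] that assms(2) by (auto simp: numeral_2_eq_2)
      show "Ck_on k T (\<lambda>t. (-1) * (inverse t * inverse t) :: real)"
        by (intro Ck_on_mult Ck_on_const assms Suc)
    qed
  qed
qed

lemma smooth_on_inverse:
  fixes f :: "'e::euclidean_space \<Rightarrow> real"
  assumes "open S" "smooth_on S f" "\<And>x. x \<in> S \<Longrightarrow> f x \<noteq> 0"
  shows "smooth_on S (\<lambda>x. inverse (f x))"
  by (rule smooth_on_compose[where T = "-{0}"]) (use assms in \<open>auto intro: smooth_on_inverse_real\<close>)

lemma smooth_on_ln: "smooth_on {0<..} (ln :: real \<Rightarrow> real)"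
  by (rule smooth_on_real_deriv[where f' = inverse])
     (auto intro: DERIV_ln smooth_on_inverse_real)

lemma smooth_on_id: "open S \<Longrightarrow> smooth_on S (\<lambda>x. x)"
  by (intro smooth_on_linear bounded_linear_ident)

lemma smooth_on_arctan: "smooth_on UNIV arctan"
proof (rule smooth_on_real_deriv)
  show "(arctan has_real_derivative inverse (1 + t\<^sup>2)) (at t)" for t by (rule DERIV_arctan)
  show "smooth_on UNIV (\<lambda>t::real. inverse (1 + t\<^sup>2))"
    by (intro smooth_on_inverse smooth_on_add smooth_on_power smooth_on_id smooth_on_const)
       (auto simp: add_nonneg_eq_0_iff)
qed simp

lemma smooth_on_norm_squared: "open S \<Longrightarrow> smooth_on S (\<lambda>x::'e::euclidean_space. x \<bullet> x)"
  unfolding smooth_on_def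
proof
  fix k assume S: "open S"
  show "Ck_on k S (\<lambda>x::'e. x \<bullet> x)"
  proof (rule Ck_on_SucD, rule Ck_on_SucI[OF S])
    show "((\<lambda>x::'e. x \<bullet> x) has_derivative (\<lambda>v. 2 * (x \<bullet> v))) (at x)" for x
      by (auto intro!: derivative_eq_intros simp: inner_commute)
    show "Ck_on k S (\<lambda>x::'e. 2 * (x \<bullet> v))" for v
      by (intro Ck_on_bounded_linear S bounded_linear_intros)
         
  qed
qed

section \<open>A smooth function that vanishes on a half-line\<close>

text \<open>The functions \<open>t\<^sup>-\<^sup>j exp (- 1/t)\<close>, extended by zero. The derivative of each is a linear combination of
  two others, so that one induction shows all of them to be smooth at once.\<close>

definition bump_deriv :: "nat \<Rightarrow> real \<Rightarrow> real" where
  "bump_deriv j t = (if t \<le> 0 then 0 else inverse t ^ j * exp (- inverse t))"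

lemma bump_deriv_tendsto_0: "(bump_deriv j \<longlongrightarrow> 0) (at_right 0)"
proof -
  have "((\<lambda>y. y ^ j / exp y) \<longlongrightarrow> (0::real)) at_top" by (rule tendsto_power_div_exp_0)
  then have "((\<lambda>t. inverse t ^ j / exp (inverse t)) \<longlongrightarrow> (0::real)) (at_right 0)"
    by (rule filterlim_compose[OF _ filterlim_inverse_at_top_right])
  moreover have "\<forall>\<^sub>F t in at_right 0. inverse t ^ j / exp (inverse t) = bump_deriv j t"
    by (auto simp: eventually_at_right_field bump_deriv_def exp_minus field_simps intro!: exI[of _ 1])
  ultimately show ?thesis by (rule Lim_transform_eventually)
qed

lemma has_real_derivative_bump:
  "(bump_deriv j has_real_derivative (- real j) * bump_deriv (Suc j) t + bump_deriv (j + 2) t) (at t)"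
proof -
  consider "t < 0" | "t > 0" | "t = 0" by linarith
  then show ?thesis
  proof cases
    case 1
    have "((\<lambda>_. 0) has_real_derivative 0) (at t)" by simp
    then have "(bump_deriv j has_real_derivative 0) (at t)"
      by (rule has_field_derivative_transform_within_open[where S = "{..<0}"]) (use 1 in \<open>auto simp: bump_deriv_def\<close>)
    then show ?thesis using 1 by (simp add: bump_deriv_def)
  next
    case 2
    have "((\<lambda>y. y ^ j * exp (- y)) has_real_derivative (real j * y ^ (j - 1) - y ^ j) * exp (- y)) (at y)" for y :: real
      by (auto intro!: derivative_eq_intros simp: algebra_simps)
    from DERIV_chain2[OF this DERIV_inverse[of t]] 2
    have "((\<lambda>t. inverse t ^ j * exp (- inverse t)) has_real_derivative
        (real j * inverse t ^ (j - 1) - inverse t ^ j) * exp (- inverse t) * (- (inverse t ^ Suc (Suc 0)))) (at t)"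
      by simp
    also have "(real j * inverse t ^ (j - 1) - inverse t ^ j) * exp (- inverse t) * (- (inverse t ^ Suc (Suc 0)))
        = (- real j) * bump_deriv (Suc j) t + bump_deriv (j + 2) t"
      using 2 by (cases j) (simp_all add: bump_deriv_def algebra_simps)
    finally have "((\<lambda>t. inverse t ^ j * exp (- inverse t)) has_real_derivative
        (- real j) * bump_deriv (Suc j) t + bump_deriv (j + 2) t) (at t)" .
    then show ?thesis
      by (rule has_field_derivative_transform_within_open[where S = "{0<..}"]) (use 2 in \<open>auto simp: bump_deriv_def\<close>)
  next
    case 3
    have "((\<lambda>h. (bump_deriv j (0 + h) - bump_deriv j 0) / h) \<longlongrightarrow> 0) (at 0)"
    proof (subst filterlim_at_split, intro conjI)
      show "((\<lambda>h. (bump_deriv j (0 + h) - bump_deriv j 0) / h) \<longlongrightarrow> 0) (at_left 0)"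
        by (rule Lim_transform_eventually[OF tendsto_const])
           (auto simp: eventually_at_left_field bump_deriv_def intro!: exI[of _ "-1"])
      show "((\<lambda>h. (bump_deriv j (0 + h) - bump_deriv j 0) / h) \<longlongrightarrow> 0) (at_right 0)"
        by (rule Lim_transform_eventually[OF bump_deriv_tendsto_0[of "Suc j"]])
           (auto simp: eventually_at_right_field bump_deriv_def field_simps intro!: exI[of _ 1])
    qed
    then have "(bump_deriv j has_real_derivative 0) (at 0)" by (simp add: DERIV_def)
    then show ?thesis using 3 by (simp add: bump_deriv_def)
  qed
qed

lemma smooth_on_bump: "smooth_on UNIV (bump_deriv j)"
  unfolding smooth_on_def
proof
  fix k show "Ck_on k UNIV (bump_deriv j)"
  proof (induction k arbitrary: j)
    case 0 show ?case
      using DERIV_isCont[OF has_real_derivative_bump] by (simp add: continuous_at_imp_continuous_on)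
  next
    case (Suc k)
    show ?case
      by (rule Ck_on_real_SucI[OF open_UNIV has_real_derivative_bump])
         (intro Ck_on_add Ck_on_mult Ck_on_const Suc open_UNIV)
  qed
qed

section \<open>Rotationally symmetric conformal metrics on the unit ball\<close>

lemma matrix_inv_mat: "(k::real) \<noteq> 0 \<Longrightarrow> matrix_inv (mat k :: real^'n^'n) = mat (inverse k)"
proof -
  assume k: "k \<noteq> 0"
  have m: "mat a ** mat b = (mat (a * b) :: real^'n^'n)" for a b :: real
    by (auto simp: matrix_matrix_mult_def mat_def vec_eq_iff if_distrib[of "\<lambda>x. x * _"] cong: if_cong)
  have "mat k ** mat (inverse k) = (mat 1 :: real^'n^'n) \<and> mat (inverse k) ** mat k = (mat 1 :: real^'n^'n)"
    using k by (simp add: m)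
  then have "mat k ** matrix_inv (mat k) = (mat 1 :: real^'n^'n)"
    unfolding matrix_inv_def by (rule someI2) blast
  then have "mat (inverse k) ** (mat k ** matrix_inv (mat k)) = (mat (inverse k) :: real^'n^'n)" by simp
  then show ?thesis using k by (simp add: matrix_mul_assoc m)
qed

text \<open>The point set is all of \<open>\<real>\<^sup>n\<close>, which a homeomorphism \<open>\<Phi>\<close> carries onto the unit ball; the metric lives on
  the ball. As \<open>\<Phi>\<close> is the only chart, the smooth structure is that of the ball. With the ball itself as
  point set, the distance between points outside it would be an infimum over the empty set, while a
  metric in the sense of \<open>Metric_space\<close> is nonnegative on the whole type.\<close>

definition ball_manifold :: "(real \<Rightarrow> real) \<Rightarrow> (real^'n \<Rightarrow> real^'n) \<Rightarrow> (real^'n, 'n::finite) riemannian" where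
  "ball_manifold P \<Phi> = \<lparr>mtop = euclidean, charts = {(UNIV, \<Phi>)},
     gmetric = \<lambda>p u v. (u (UNIV, \<Phi>) \<bullet> v (UNIV, \<Phi>)) / (P (\<Phi> p \<bullet> \<Phi> p))\<^sup>2\<rparr>"

lemma partial_deriv_eqI:
  assumes "open S" "x \<in> S" "\<And>y. y \<in> S \<Longrightarrow> f y = g y" "(g has_derivative D) (at x)"
  shows "partial_deriv i f x = D (axis i 1)"
proof -
  have "(f has_derivative D) (at x)"
    by (rule has_derivative_transform_within_open[OF assms(4,1,2)]) (simp add: assms(3))
  then show ?thesis unfolding partial_deriv_def by (metis frechet_derivative_at)
qed

definition kron :: "'n \<Rightarrow> 'n \<Rightarrow> real" where "kron i j = (if i = j then 1 else 0)"

lemma kron_commute: "kron i j = kron j i" and kron_refl [simp]: "kron i i = 1"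
  by (auto simp: kron_def)

lemma sum_kron:
  fixes f :: "'n::finite \<Rightarrow> real"
  shows "(\<Sum>i\<in>UNIV. kron i j * f i) = f j" "(\<Sum>i\<in>UNIV. kron j i * f i) = f j"
    "(\<Sum>i\<in>UNIV. f i * kron i j) = f j" "(\<Sum>i\<in>UNIV. f i * kron j i) = f j"
    "(\<Sum>i\<in>UNIV. kron i j) = 1" "(\<Sum>i\<in>UNIV. kron j i) = 1"
  by (simp_all add: kron_def if_distrib[of "\<lambda>x. x * _"] if_distrib[of "\<lambda>x. _ * x"] cong: if_cong)

text \<open>\<open>P\<close> and \<open>Q = - P'\<close> are functions of \<open>q = |x|\<^sup>2\<close>. They are given on a half-line and not only for
  \<open>0 \<le> q < 1\<close>, so that \<open>P(|x|\<^sup>2)\<close> is smooth at the origin too.\<close>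

locale ball_model =
  fixes P Q Q' :: "real \<Rightarrow> real" and \<Phi> \<Psi> :: "real^'n::finite \<Rightarrow> real^'n"
  assumes homeo: "homeomorphism UNIV (ball 0 1) \<Phi> \<Psi>"
    and P_pos: "\<And>q. q < 1 \<Longrightarrow> 0 < P q"
    and smooth_P: "smooth_on {..<1} P"
    and P_deriv: "\<And>q. q < 1 \<Longrightarrow> (P has_real_derivative - Q q) (at q)"
    and Q_deriv: "\<And>q. q < 1 \<Longrightarrow> (Q has_real_derivative Q' q) (at q)"
begin

abbreviation B :: "(real^'n) set" where "B \<equiv> ball 0 1"
abbreviation c :: "(real^'n, 'n) chart" where "c \<equiv> (UNIV, \<Phi>)"
abbreviation M :: "(real^'n, 'n) riemannian" where "M \<equiv> ball_manifold P \<Phi>"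

lemma mtop_M [simp]: "mtop M = euclidean" and charts_M [simp]: "charts M = {c}"
  by (simp_all add: ball_manifold_def)

lemma gmetric_M: "gmetric M p u v = (u c \<bullet> v c) / (P (\<Phi> p \<bullet> \<Phi> p))\<^sup>2"
  by (simp add: ball_manifold_def)

lemma range_Phi: "range \<Phi> = B" and Phi_in [simp]: "\<Phi> p \<in> B" and Psi_Phi [simp]: "\<Psi> (\<Phi> p) = p"
  and Phi_Psi [simp]: "x \<in> B \<Longrightarrow> \<Phi> (\<Psi> x) = x"
  and cont_Phi: "continuous_on UNIV \<Phi>" and cont_Psi: "continuous_on B \<Psi>"
  using homeo by (auto simp: homeomorphism_def)

lemma inj_Phi: "inj \<Phi>" by (metis Psi_Phi injI)

lemma inner_less_1: "x \<in> B \<Longrightarrow> x \<bullet> x < 1"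
  by (simp add: dot_square_norm power_less_one_iff)

lemma P_inner_pos: "x \<in> B \<Longrightarrow> 0 < P (x \<bullet> x)"
  by (simp add: P_pos inner_less_1)

lemma cinv_c: "x \<in> B \<Longrightarrow> cinv c x = \<Psi> x"
  using inj_Phi by (metis Phi_Psi UNIV_I fst_conv inv_into_f_f snd_conv)

lemma transition_c: "x \<in> B \<Longrightarrow> transition c c x = x"
  by (simp add: transition_def f_inv_into_f range_Phi)

lemma transition_c_deriv: "x \<in> B \<Longrightarrow> frechet_derivative (transition c c) (at x) = (\<lambda>v. v)"
proof -
  assume x: "x \<in> B"
  have "(transition c c has_derivative (\<lambda>v. v)) (at x)"
    by (rule has_derivative_transform_within_open[OF has_derivative_ident open_ball x])
       (simp add: transition_c)
  then show ?thesis by (metis frechet_derivative_at)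
qed

lemma norm_Phi [simp]: "norm (\<Phi> p) < 1"
  using Phi_in[of p] by simp

lemma P_Phi_pos [simp]: "0 < P (\<Phi> p \<bullet> \<Phi> p)"
  using P_inner_pos[OF Phi_in] .

lemma charts_at_M [simp]: "charts_at M p = {c}"
  by (auto simp: charts_at_def)

lemma chart_at_M [simp]: "chart_at M p = c"
  by (simp add: chart_at_def)

lemma tangent_space_M: "tangent_space M p = {v. \<forall>d. d \<noteq> c \<longrightarrow> v d = 0}"
  by (auto simp: tangent_space_def transition_c_deriv[OF Phi_in])

definition tvec_of :: "real^'n \<Rightarrow> (real^'n, 'n) tvec" where "tvec_of v = (\<lambda>d. if d = c then v else 0)"

lemma tvec_of_c [simp]: "tvec_of v c = v" by (simp add: tvec_of_def)

lemma tvec_of_in_tangent_space [simp]: "tvec_of v \<in> tangent_space M p"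
  by (simp add: tangent_space_M tvec_of_def)

lemma tangent_space_tvec_of: "u \<in> tangent_space M p \<Longrightarrow> u = tvec_of (u c)"
  by (auto simp: tangent_space_M tvec_of_def)

lemma coord_vec_M: "coord_vec M c p i = tvec_of (axis i 1)"
proof
  fix d show "coord_vec M c p i d = tvec_of (axis i 1) d"
    by (cases "d = c") (simp_all add: coord_vec_def tvec_of_def transition_c_deriv[OF Phi_in])
qed

lemma metric_coeff_M: "x \<in> B \<Longrightarrow> metric_coeff M c x = mat (inverse ((P (x \<bullet> x))\<^sup>2))"
  by (auto simp: metric_coeff_def coord_vec_M gmetric_M cinv_c[simplified] mat_def vec_eq_iff inner_axis_axis
       divide_inverse)

lemma smooth_on_comp_norm: fixes h :: "real \<Rightarrow> real" shows "smooth_on {..<1} h \<Longrightarrow> smooth_on B (\<lambda>x. h (x \<bullet> x))"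
  by (rule smooth_on_compose[where T = "{..<1}" and f = "\<lambda>x::real^'n. x \<bullet> x"])
     (auto intro: smooth_on_norm_squared inner_less_1)

lemma smooth_metric: "smooth_on B (metric_coeff M c)"
proof -
  have lin: "bounded_linear (\<lambda>k. mat k :: real^'n^'n)"
    by (rule linear_conv_bounded_linear[THEN iffD1], rule linearI) (auto simp: mat_def vec_eq_iff)
  have "smooth_on B (\<lambda>x. (P (x \<bullet> x))\<^sup>2)"
    by (rule smooth_on_power[OF _ smooth_on_comp_norm[OF smooth_P]]) simp
  from smooth_on_inverse[OF _ this] have "smooth_on B (\<lambda>x. inverse ((P (x \<bullet> x))\<^sup>2))"
    using P_inner_pos by force
  from smooth_on_compose_linear[OF _ lin this] have "smooth_on B (\<lambda>x. mat (inverse ((P (x \<bullet> x))\<^sup>2)) :: real^'n^'n)"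
    by simp
  then show ?thesis
    by (rule smooth_on_cong[THEN iffD2, rotated -1]) (auto simp: metric_coeff_M)
qed

lemma smooth_manifold_M: "smooth_manifold M"
proof -
  have "homeomorphic_map euclidean (top_of_set B) \<Phi>"
    unfolding homeomorphic_map_maps homeomorphic_maps_def
    by (rule exI[of _ \<Psi>]) (auto simp: cont_Phi cont_Psi continuous_map_in_subtopology range_Phi)
  moreover have "smooth_on B (transition c c)"
    by (rule smooth_on_cong[THEN iffD2, OF _ _ smooth_on_id]) (auto simp: transition_c)
  moreover have "connected_space (euclidean :: (real^'n) topology)"
    by (metis connected_UNIV connectedin_topspace connectedin_iff_connected topspace_euclidean)
  moreover have "second_countable (euclidean :: (real^'n) topology)"
  proof -
    obtain \<B> :: "(real^'n) set set" where "countable \<B>" "topological_basis \<B>"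
      using ex_countable_basis by blast
    then show ?thesis unfolding second_countable_def
      by (metis open_openin topological_basisE topological_basis_open)
  qed
  ultimately show ?thesis
    by (auto simp: smooth_manifold_def is_chart_def range_Phi)
qed

lemma gmetric_pos: "v \<noteq> 0 \<Longrightarrow> 0 < (v \<bullet> v) / (P (\<Phi> p \<bullet> \<Phi> p))\<^sup>2"
  by (intro divide_pos_pos zero_less_power) auto

lemma riemannian_manifold_M: "riemannian_manifold M"
  unfolding riemannian_manifold_def
proof (intro conjI ballI allI impI)
  fix p u assume "u \<in> tangent_space M p" "u \<noteq> (\<lambda>_. 0)"
  then have "u c \<noteq> 0" by (metis tangent_space_tvec_of tvec_of_def)
  then show "0 < gmetric M p u u" using gmetric_pos by (simp add: gmetric_M)
qed (auto simp: smooth_manifold_M gmetric_M inner_commute inner_left_distrib inner_right_distrib add_divide_distrib range_Phi smooth_metric)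

lemma tnorm_M: "tnorm M p u = norm (u c) / P (\<Phi> p \<bullet> \<Phi> p)"
  using P_Phi_pos[of p] less_imp_le[OF P_Phi_pos[of p]]
  by (simp add: tnorm_def gmetric_M real_sqrt_divide norm_eq_sqrt_inner)

section \<open>Ricci curvature of a rotationally symmetric conformal metric\<close>

text \<open>The metric is \<open>e\<^sup>2\<^sup>u |dx|\<^sup>2\<close> with \<open>u = - ln P(|x|\<^sup>2)\<close>, and the Euclidean gradient of \<open>u\<close> is \<open>psi(|x|\<^sup>2) x\<close>.\<close>

definition psi :: "real \<Rightarrow> real" where "psi q = 2 * Q q / P q"
definition psi' :: "real \<Rightarrow> real" where "psi' q = 2 * Q' q / P q + 2 * (Q q)\<^sup>2 / (P q)\<^sup>2"

lemma psi_deriv: "q < 1 \<Longrightarrow> (psi has_real_derivative psi' q) (at q)"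
proof -
  assume q: "q < 1"
  have "(psi has_real_derivative (2 * Q' q * P q - 2 * Q q * (- Q q)) / (P q * P q)) (at q)"
    unfolding psi_def[abs_def]
    by (rule DERIV_divide[OF DERIV_cmult[OF Q_deriv[OF q]] P_deriv[OF q]]) (use P_pos[OF q] in simp)
  moreover have "(2 * Q' q * P q - 2 * Q q * (- Q q)) / (P q * P q) = psi' q"
    using P_pos[OF q] by (simp add: psi'_def add_divide_distrib power2_eq_square)
  ultimately show ?thesis by simp
qed

lemma comp_norm_deriv:
  assumes "x \<in> B" "\<And>q. q < 1 \<Longrightarrow> (h has_real_derivative h' q) (at q)"
  shows "((\<lambda>x. h (x \<bullet> x)) has_derivative (\<lambda>v. 2 * h' (x \<bullet> x) * (x \<bullet> v))) (at x)"
proof -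
  have "((\<lambda>x::real^'n. x \<bullet> x) has_derivative (\<lambda>v. 2 * (x \<bullet> v))) (at x)"
    by (auto intro!: derivative_eq_intros simp: inner_commute)
  from DERIV_compose_FDERIV[OF assms(2)[OF inner_less_1[OF assms(1)]] this]
  show ?thesis by (simp add: mult_ac)
qed

lemma partial_deriv_metric:
  assumes x: "x \<in> B"
  shows "partial_deriv i (\<lambda>y. metric_coeff M c y $ j $ l) x
    = kron j l * (4 * Q (x \<bullet> x) / (P (x \<bullet> x))^3 * x $ i)"
proof -
  have h: "((\<lambda>q. kron j l * inverse ((P q)\<^sup>2)) has_real_derivative kron j l * (2 * Q q / (P q)^3)) (at q)" if "q < 1" for q
    using P_pos[OF that] 
    by (auto intro!: derivative_eq_intros P_deriv[OF that] simp: field_simps power2_eq_square power3_eq_cube)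
  have "partial_deriv i (\<lambda>y. metric_coeff M c y $ j $ l) x
    = 2 * (kron j l * (2 * Q (x \<bullet> x) / (P (x \<bullet> x))^3)) * (x \<bullet> axis i 1)"
    by (rule partial_deriv_eqI[OF open_ball x _ comp_norm_deriv[OF x h]]) (auto simp: metric_coeff_M mat_def kron_def)
  then show ?thesis by (simp add: inner_axis)
qed

text \<open>The formula for a conformal metric: \<open>\<Gamma>\<^sup>k\<^sub>i\<^sub>j = \<delta>\<^sub>k\<^sub>j u\<^sub>i + \<delta>\<^sub>k\<^sub>i u\<^sub>j - \<delta>\<^sub>i\<^sub>j u\<^sub>k\<close>.\<close>

lemma christoffel_M:
  assumes x: "x \<in> B"
  shows "christoffel M c k i j x = psi (x \<bullet> x) * (kron k j * x $ i + kron k i * x $ j - kron i j * x $ k)"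
proof -
  define p where "p = P (x \<bullet> x)"
  have p: "p > 0" using P_inner_pos[OF x] by (simp add: p_def)
  define r where "r = 4 * Q (x \<bullet> x) / p^3"
  have inv: "matrix_inv (metric_coeff M c x) $ k $ l = kron k l * p\<^sup>2" for l
    using p by (simp add: metric_coeff_M[OF x] matrix_inv_mat flip: p_def) (simp add: mat_def kron_def)
  have "christoffel M c k i j x = (\<Sum>l\<in>UNIV. kron k l * p\<^sup>2 *
        (kron j l * (r * x $ i) + kron i l * (r * x $ j) - kron i j * (r * x $ l))) / 2"
    unfolding christoffel_def partial_deriv_metric[OF x] inv p_def r_def ..
  also have "\<dots> = p\<^sup>2 * (kron j k * (r * x $ i) + kron i k * (r * x $ j) - kron i j * (r * x $ k)) / 2"
    by (simp only: mult.assoc sum_kron)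
  also have "\<dots> = (p\<^sup>2 * r / 2) * (kron k j * x $ i + kron k i * x $ j - kron i j * x $ k)"
    by (simp add: kron_commute[of k j] kron_commute[of k i] algebra_simps add_divide_distrib diff_divide_distrib)
  also have "p\<^sup>2 * r / 2 = psi (x \<bullet> x)"
    using p unfolding r_def psi_def by (simp add: p_def power2_eq_square power3_eq_cube)
  finally show ?thesis .
qed

lemma partial_deriv_christoffel:
  assumes x: "x \<in> B"
  shows "partial_deriv l (christoffel M c k i j) x =
      2 * psi' (x \<bullet> x) * x $ l * (kron k j * x $ i + kron k i * x $ j - kron i j * x $ k)
    + psi (x \<bullet> x) * (kron k j * kron l i + kron k i * kron l j - kron i j * kron l k)"
proof -
  have lin: "((\<lambda>x. kron k j * x $ i + kron k i * x $ j - kron i j * x $ k) has_derivative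
    (\<lambda>v. kron k j * v $ i + kron k i * v $ j - kron i j * v $ k)) (at x)"
    by (intro has_derivative_add has_derivative_diff has_derivative_mult_right
        bounded_linear_imp_has_derivative bounded_linear_vec_nth)
  have "partial_deriv l (christoffel M c k i j) x =
      psi (x \<bullet> x) * (kron k j * axis l 1 $ i + kron k i * axis l 1 $ j - kron i j * axis l 1 $ k) +
      2 * psi' (x \<bullet> x) * (x \<bullet> axis l 1) * (kron k j * x $ i + kron k i * x $ j - kron i j * x $ k)"
    by (rule partial_deriv_eqI[OF open_ball x christoffel_M has_derivative_mult[OF comp_norm_deriv[OF x psi_deriv] lin]])
  moreover have "axis l 1 $ a = kron l a" for a by (simp add: axis_def kron_def)
  moreover have "x \<bullet> axis l 1 = x $ l" by (simp add: inner_axis)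
  ultimately show ?thesis by simp
qed

lemma contract_kron:
  fixes f y :: "'n \<Rightarrow> real"
  shows "(\<Sum>m\<in>UNIV. (kron i m * a + b * y m - kron j m * d) * f m) = a * f i + b * (\<Sum>m\<in>UNIV. y m * f m) - d * f j"
  by (simp add: ring_distribs sum.distrib sum_subtractf mult.assoc sum_kron sum_distrib_left mult.left_commute[of a] mult.left_commute[of d])

text \<open>The Christoffel symbols are linear in \<open>x\<close> up to the factor \<open>psi(|x|\<^sup>2)\<close>, so each of the four sums in
  the Ricci tensor is a contraction of Kronecker symbols with \<open>x\<close>.\<close>

lemma ricci_coeff_M:
  assumes x: "x \<in> B"
  defines "q \<equiv> x \<bullet> x"
  shows "ricci_coeff M c j k x =
    - (real CARD('n) - 2) * (2 * psi' q - (psi q)\<^sup>2) * (x $ j * x $ k)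
    - (2 * q * psi' q + (2 * real CARD('n) - 2) * psi q + (real CARD('n) - 2) * q * (psi q)\<^sup>2) * kron j k"
proof -
  have xx: "(\<Sum>m\<in>UNIV. x $ m * x $ m) = q" by (simp add: q_def inner_vec_def)
  define n where "n = real CARD('n)"
  have n: "(\<Sum>i\<in>(UNIV :: 'n set). a) = n * a" for a by (simp add: n_def)
  define A A' where "A = psi q" and "A' = psi' q"
  note chr = christoffel_M[OF x, folded q_def, folded A_def] and dchr = partial_deriv_christoffel[OF x, folded q_def, folded A_def A'_def]
  have S1: "(\<Sum>i\<in>UNIV. partial_deriv i (christoffel M c i j k) x) =
     2 * A' * (2 * (x $ j * x $ k) - kron j k * q) + A * (2 - n) * kron j k"
  proof -
    have "(\<Sum>i\<in>UNIV. partial_deriv i (christoffel M c i j k) x)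
      = (\<Sum>i\<in>UNIV. 2 * A' * (kron i k * (x $ i * x $ j) + kron i j * (x $ i * x $ k) - kron j k * (x $ i * x $ i))
          + A * (kron i k * kron i j + kron i j * kron i k - kron j k))"
      unfolding dchr by (simp add: algebra_simps)
    also have "\<dots> = 2 * A' * (x $ k * x $ j + x $ j * x $ k - kron j k * q) + A * (kron k j + kron j k - n * kron j k)"
      by (simp only: sum.distrib sum_subtractf sum_kron n flip: sum_distrib_left xx)
    finally show ?thesis by (simp add: kron_commute[of k j] algebra_simps)
  qed
  have tr: "christoffel M c i i k y = psi (y \<bullet> y) * y $ k" if "y \<in> B" for i k y
    using christoffel_M[OF that, of i i k] by (simp add: kron_commute algebra_simps)
  have S2: "(\<Sum>i\<in>UNIV. partial_deriv j (christoffel M c i i k) x) = n * (2 * A' * (x $ j * x $ k) + A * kron j k)"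
    unfolding dchr n[symmetric] by (intro sum.cong) (simp_all add: kron_commute algebra_simps)
  have S3: "(\<Sum>i\<in>UNIV. \<Sum>m\<in>UNIV. christoffel M c i i m x * christoffel M c m j k x) = n * (A\<^sup>2 * (2 * (x $ j * x $ k) - kron j k * q))"
  proof -
    have "(\<Sum>m\<in>UNIV. christoffel M c i i m x * christoffel M c m j k x) = A\<^sup>2 * (2 * (x $ j * x $ k) - kron j k * q)" for i
    proof -
      have "(\<Sum>m\<in>UNIV. christoffel M c i i m x * christoffel M c m j k x)
        = (\<Sum>m\<in>UNIV. A\<^sup>2 * (kron m k * (x $ m * x $ j) + kron m j * (x $ m * x $ k) - kron j k * (x $ m * x $ m)))"
        unfolding tr[OF x] chr q_def[symmetric] A_def[symmetric] by (simp add: algebra_simps power2_eq_square)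
      also have "\<dots> = A\<^sup>2 * (x $ k * x $ j + x $ j * x $ k - kron j k * q)"
        by (simp only: sum.distrib sum_subtractf sum_kron flip: sum_distrib_left xx)
      finally show ?thesis by (simp add: algebra_simps)
    qed
    then show ?thesis by (simp only: n)
  qed
  have S4: "(\<Sum>i\<in>UNIV. \<Sum>m\<in>UNIV. christoffel M c i j m x * christoffel M c m i k x)
     = A\<^sup>2 * ((n + 2) * (x $ j * x $ k) - 2 * kron j k * q)"
  proof -
    have inner: "(\<Sum>m\<in>UNIV. christoffel M c i j m x * christoffel M c m i k x)
       = A\<^sup>2 * (x $ j * x $ k + kron i j * (2 * (x $ i * x $ k) - kron i k * q)
           - (kron j k * (x $ i * x $ i) + kron j i * (x $ i * x $ k) - kron i k * (x $ i * x $ j)))" for i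
    proof -
      define G where "G m = kron m k * x $ i + kron m i * x $ k - kron i k * x $ m" for m
      have "(\<Sum>m\<in>UNIV. christoffel M c i j m x * christoffel M c m i k x)
        = (\<Sum>m\<in>UNIV. A\<^sup>2 * ((kron i m * x $ j + kron i j * x $ m - kron j m * x $ i) * G m))"
        unfolding chr G_def by (simp add: algebra_simps power2_eq_square)
      also have "\<dots> = A\<^sup>2 * (x $ j * G i + kron i j * (\<Sum>m\<in>UNIV. x $ m * G m) - x $ i * G j)"
        by (simp only: contract_kron flip: sum_distrib_left)
      also have "(\<Sum>m\<in>UNIV. x $ m * G m)
         = (\<Sum>m\<in>UNIV. kron m k * (x $ m * x $ i) + kron m i * (x $ m * x $ k) - kron i k * (x $ m * x $ m))"
        unfolding G_def by (simp add: algebra_simps)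
      also have "\<dots> = x $ k * x $ i + x $ i * x $ k - kron i k * q"
        by (simp only: sum.distrib sum_subtractf sum_kron flip: sum_distrib_left xx)
      finally show ?thesis unfolding G_def by (simp add: algebra_simps)
    qed
    have "(\<Sum>i\<in>UNIV. \<Sum>m\<in>UNIV. christoffel M c i j m x * christoffel M c m i k x)
      = A\<^sup>2 * (n * (x $ j * x $ k) + (2 * (x $ j * x $ k) - kron j k * q)
           - (kron j k * q + x $ j * x $ k - x $ k * x $ j))"
      unfolding inner xx[symmetric]
      by (simp only: sum.distrib sum_subtractf sum_kron n flip: sum_distrib_left) (simp add: algebra_simps)
    then show ?thesis by (simp add: algebra_simps)
  qed
  have "ricci_coeff M c j k x = (\<Sum>i\<in>UNIV. partial_deriv i (christoffel M c i j k) x)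
      - (\<Sum>i\<in>UNIV. partial_deriv j (christoffel M c i i k) x)
      + ((\<Sum>i\<in>UNIV. \<Sum>m\<in>UNIV. christoffel M c i i m x * christoffel M c m j k x)
         - (\<Sum>i\<in>UNIV. \<Sum>m\<in>UNIV. christoffel M c i j m x * christoffel M c m i k x))"
    unfolding ricci_coeff_def riemann_coeff_def by (simp only: sum.distrib sum_subtractf)
  then show ?thesis unfolding S1 S2 S3 S4 A_def[symmetric] A'_def[symmetric] n_def[symmetric]
    by (simp add: algebra_simps)
qed

text \<open>Since \<open>2 psi' - psi\<^sup>2 = 4 Q' / P\<close>, the derivative \<open>Q'\<close> enters with the same sign in every direction: where
  \<open>Q\<close> decreases, this raises the Ricci curvature in all directions at once.\<close>

lemma ricci_M:
  fixes p v
  defines "x \<equiv> \<Phi> p" and "q \<equiv> \<Phi> p \<bullet> \<Phi> p"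
  shows "ricci M p (tvec_of v) (tvec_of v) =
    - (real CARD('n) - 2) * (4 * Q' q / P q) * (x \<bullet> v)\<^sup>2
    - (4 * q * P q * Q' q + 4 * (real CARD('n) - 1) * (Q q * P q + q * (Q q)\<^sup>2)) * ((v \<bullet> v) / (P q)\<^sup>2)"
proof -
  define n where "n = real CARD('n)"
  have Pq: "P q > 0" by (simp add: q_def)
  define a where "a = - (n - 2) * (2 * psi' q - (psi q)\<^sup>2)"
  define b where "b = 2 * q * psi' q + (2 * n - 2) * psi q + (n - 2) * q * (psi q)\<^sup>2"
  have "ricci M p (tvec_of v) (tvec_of v) = (\<Sum>j\<in>UNIV. \<Sum>k\<in>UNIV. (a * (x $ j * x $ k) - b * kron j k) * v $ j * v $ k)"
    unfolding ricci_def Let_def chart_at_M snd_conv ricci_coeff_M[OF Phi_in] tvec_of_c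
    by (simp only: a_def b_def n_def x_def q_def)
  also have "\<dots> = (\<Sum>j\<in>UNIV. \<Sum>k\<in>UNIV. a * ((x $ j * v $ j) * (x $ k * v $ k)) - b * (kron j k * (v $ j * v $ k)))"
    by (simp add: algebra_simps)
  also have "\<dots> = a * ((\<Sum>j\<in>UNIV. x $ j * v $ j) * (\<Sum>k\<in>UNIV. x $ k * v $ k)) - b * (\<Sum>j\<in>UNIV. v $ j * v $ j)"
    by (simp only: sum_subtractf sum_kron sum_product flip: sum_distrib_left)
  also have "\<dots> = a * (x \<bullet> v)\<^sup>2 - b * (v \<bullet> v)"
    by (simp add: inner_vec_def power2_eq_square)
  also have "a = - (n - 2) * (4 * Q' q / P q)"
    using Pq by (simp add: a_def psi_def psi'_def power_divide)
  also have "b = (4 * q * P q * Q' q + 4 * (n - 1) * (Q q * P q + q * (Q q)\<^sup>2)) / (P q)\<^sup>2"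
    using Pq by (simp add: b_def psi_def psi'_def field_simps power2_eq_square)
  finally show ?thesis by (simp add: n_def)
qed

end

section \<open>Integration by parts for compactly supported functions\<close>

text \<open>Near a point outside \<open>K\<close> the extended function vanishes identically, so it is smooth across the boundary of
  \<open>S\<close>, which \<open>K\<close> does not reach.\<close>

lemma Ck_on_extend_zero:
  fixes g :: "'e::euclidean_space \<Rightarrow> real"
  assumes "open S" "compact K" "K \<subseteq> S" "Ck_on k S g" "\<And>x. x \<in> S - K \<Longrightarrow> g x = 0"
  shows "Ck_on k UNIV (\<lambda>x. if x \<in> S then g x else 0)"
  using assms(4,5)
proof (induction k arbitrary: g)
  case 0
  have cK: "closed K" using assms(2) by (rule compact_imp_closed)
  have "continuous_on (S \<union> - K) (\<lambda>x. if x \<in> S then g x else 0)"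
  proof (rule continuous_on_open_Un)
    show "continuous_on S (\<lambda>x. if x \<in> S then g x else 0)"
      using 0(1) by (simp cong: continuous_on_cong)
    have "continuous_on (- K) (\<lambda>x. 0 :: real)" by simp
    then show "continuous_on (- K) (\<lambda>x. if x \<in> S then g x else 0)"
      by (rule continuous_on_eq) (use 0(2) in auto)
  qed (use assms(1) cK in auto)
  moreover have "S \<union> - K = UNIV" using assms(3) by auto
  ultimately show ?case by simp
next
  case (Suc k)
  have oK: "open (- K)" using assms(2) by (simp add: compact_imp_closed open_Compl)
  define D where "D x v = (if x \<in> S then frechet_derivative g (at x) v else 0)" for x v
  have zero: "frechet_derivative g (at x) v = 0" if "x \<in> S - K" for x v
  proof -
    have "(g has_derivative (\<lambda>_. 0)) (at x)"
      by (rule has_derivative_transform_within_open[OF has_derivative_const[of 0] open_Int[OF assms(1) oK]])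
         (use that Suc.prems(2) in auto)
    then show ?thesis by (metis frechet_derivative_at)
  qed
  show ?case
  proof (rule Ck_on_SucI[where D = D])
    fix x
    show "((\<lambda>x. if x \<in> S then g x else 0) has_derivative D x) (at x)"
    proof (cases "x \<in> S")
      case True
      then have "D x = frechet_derivative g (at x)" by (auto simp: D_def)
      then show ?thesis
        using has_derivative_transform_within_open[OF Ck_on_has_derivative[OF Suc.prems(1) True] assms(1) True] by auto
    next
      case False
      then have "D x = (\<lambda>_. 0)" by (auto simp: D_def)
      moreover have "((\<lambda>x. if x \<in> S then g x else 0) has_derivative (\<lambda>_. 0)) (at x)"
        by (rule has_derivative_transform_within_open[OF has_derivative_const[of 0] oK])
           (use False Suc.prems(2) assms(3) in auto)
      ultimately show ?thesis by simp
    qed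
  next
    show "Ck_on k UNIV (\<lambda>x. D x v)" for v
      unfolding D_def by (rule Suc.IH[OF Ck_on_frechet[OF Suc.prems(1)]]) (use zero in auto)
  qed simp
qed

lemma integrable_compact_support:
  fixes g :: "'e::euclidean_space \<Rightarrow> real"
  assumes "compact K" "continuous_on UNIV g" "\<And>x. x \<notin> K \<Longrightarrow> g x = 0"
  shows "integrable lborel g"
proof -
  have "integrable lborel (\<lambda>x. indicator K x *\<^sub>R g x)"
    by (rule borel_integrable_compact[OF assms(1) continuous_on_subset[OF assms(2)]]) simp
  moreover have "(\<lambda>x. indicator K x *\<^sub>R g x) = g"
    using assms(3) by (auto simp: indicator_def fun_eq_iff)
  ultimately show ?thesis by simp
qed

text \<open>All difference quotients of \<open>g\<close> in direction \<open>v\<close> integrate to \<open>0\<close> by translation invariance. They are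
  bounded by a Lipschitz constant and supported in one ball, so dominated convergence applies.\<close>

lemma integral_directional_derivative_zero:
  fixes g :: "'e::euclidean_space \<Rightarrow> real"
  assumes K: "compact K" and g: "Ck_on 1 UNIV g" and supp: "\<And>x. x \<notin> K \<Longrightarrow> g x = 0"
  shows "integrable lborel (\<lambda>x. frechet_derivative g (at x) v)"
    and "(\<integral>x. frechet_derivative g (at x) v \<partial>lborel) = 0"
proof -
  have der: "(g has_derivative frechet_derivative g (at x)) (at x)" for x
    using Ck_on_has_derivative[of 0 UNIV g x] g by simp
  have cont': "continuous_on UNIV (\<lambda>x. frechet_derivative g (at x) v)" for v
    using g by simp
  have cont: "continuous_on UNIV g"
    using Ck_on_SucD[of 0 UNIV g] g by simp
  have supp': "frechet_derivative g (at x) v = 0" if "x \<notin> K" for x v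
  proof -
    have "(g has_derivative (\<lambda>_. 0)) (at x)"
      by (rule has_derivative_transform_within_open[OF has_derivative_const[of 0] open_Compl[OF compact_imp_closed[OF K]]])
         (use that supp in auto)
    then show ?thesis by (metis frechet_derivative_at)
  qed
  show int: "integrable lborel (\<lambda>x. frechet_derivative g (at x) v)"
    by (rule integrable_compact_support[OF K cont' supp'])
  have gint: "integrable lborel g" by (rule integrable_compact_support[OF K cont supp])
  obtain R where R: "K \<subseteq> cball 0 R"
    using compact_imp_bounded[OF K] unfolding bounded_iff by (auto simp: subset_iff)
  define K' where "K' = cball (0::'e) (R + norm v)"
  have "bounded ((\<lambda>x. frechet_derivative g (at x) v) ` K)"
    by (intro compact_imp_bounded compact_continuous_image[OF continuous_on_subset[OF cont'] K]) simp
  then obtain L where L: "\<And>x. x \<in> K \<Longrightarrow> \<bar>frechet_derivative g (at x) v\<bar> \<le> L" and "L > 0"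
    by (auto simp: bounded_pos)
  have L': "\<bar>frechet_derivative g (at x) v\<bar> \<le> L" for x
    using L[of x] supp'[of x v] \<open>L > 0\<close> by (cases "x \<in> K") auto
  have lip: "\<bar>g (x + t *\<^sub>R v) - g x\<bar> \<le> L * t" if t: "t > 0" for x t
  proof -
    have d: "((\<lambda>s. g (x + s *\<^sub>R v)) has_real_derivative frechet_derivative g (at (x + s *\<^sub>R v)) v) (at s)" for s
    proof -
      have "((\<lambda>s. x + s *\<^sub>R v) has_derivative (\<lambda>h. h *\<^sub>R v)) (at s)"
        by (auto intro!: derivative_eq_intros)
      from has_derivative_compose[OF this der]
      have "((\<lambda>s. g (x + s *\<^sub>R v)) has_derivative (\<lambda>h. frechet_derivative g (at (x + s *\<^sub>R v)) (h *\<^sub>R v))) (at s)" .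
      then show ?thesis
        unfolding has_field_derivative_def
        by (simp add: linear_scale[OF has_derivative_linear[OF der]] mult_commute_abs)
    qed
    obtain z where "g (x + t *\<^sub>R v) - g (x + 0 *\<^sub>R v) = (t - 0) * frechet_derivative g (at (x + z *\<^sub>R v)) v"
      using MVT2[of 0 t "\<lambda>s. g (x + s *\<^sub>R v)" "\<lambda>s. frechet_derivative g (at (x + s *\<^sub>R v)) v", OF t d] by blast
    then show ?thesis using L'[of "x + z *\<^sub>R v"] t by (simp add: abs_mult mult.commute)
  qed
  define r where "r k = inverse (real (Suc k))" for k
  have r: "0 < r k" "r k \<le> 1" for k by (auto simp: r_def field_simps)
  define T where "T k x = (g (x + r k *\<^sub>R v) - g x) / r k" for k x
  have "(\<lambda>k. \<integral>x. T k x \<partial>lborel) \<longlonglongrightarrow> (\<integral>x. frechet_derivative g (at x) v \<partial>lborel)"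
  proof (rule integral_dominated_convergence[where w = "\<lambda>x. indicator K' x *\<^sub>R L"])
    show "(\<lambda>x. frechet_derivative g (at x) v) \<in> borel_measurable lborel" using int by auto
    show "T k \<in> borel_measurable lborel" for k
    proof -
      have "continuous_on UNIV (T k)" unfolding T_def
        by (intro continuous_intros continuous_on_compose2[OF cont]) (use r(1)[of k] in auto)
      then show ?thesis by (simp add: borel_measurable_continuous_onI)
    qed
    show "integrable lborel (\<lambda>x. indicator K' x *\<^sub>R L)"
      unfolding K'_def by (rule borel_integrable_compact) auto
    show "AE x in lborel. (\<lambda>k. T k x) \<longlonglongrightarrow> frechet_derivative g (at x) v"
    proof (rule AE_I2)
      fix x
      have "((\<lambda>s. x + s *\<^sub>R v) has_derivative (\<lambda>h. h *\<^sub>R v)) (at 0)"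
        by (auto intro!: derivative_eq_intros)
      from has_derivative_compose[OF this, of g "frechet_derivative g (at x)"] der[of x]
      have "((\<lambda>s. g (x + s *\<^sub>R v)) has_real_derivative frechet_derivative g (at x) v) (at 0)"
        unfolding has_field_derivative_def
        by (simp add: linear_scale[OF has_derivative_linear[OF der]] mult_commute_abs)
      then have "((\<lambda>h. (g (x + h *\<^sub>R v) - g x) / h) \<longlongrightarrow> frechet_derivative g (at x) v) (at 0)"
        by (simp add: DERIV_def)
      moreover have "filterlim r (at 0) sequentially"
        unfolding filterlim_at r_def using LIMSEQ_inverse_real_of_nat by auto
      ultimately show "(\<lambda>k. T k x) \<longlonglongrightarrow> frechet_derivative g (at x) v"
        unfolding T_def by (rule filterlim_compose)
    qed
    show "AE x in lborel. norm (T k x) \<le> indicator K' x *\<^sub>R L" for k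
    proof (rule AE_I2)
      fix x
      define t where "t = r k"
      have t: "t > 0" "t \<le> 1" by (auto simp: t_def r)
      show "norm (T k x) \<le> indicator K' x *\<^sub>R L"
      proof (cases "x \<in> K'")
        case True
        then show ?thesis using lip[OF t(1), of x] t(1) by (simp add: T_def field_simps flip: t_def)
      next
        case False
        then have *: "norm x > R + norm v" by (simp add: K'_def)
        have "norm (t *\<^sub>R v) \<le> norm v" using t by (simp add: mult_left_le_one_le)
        then have "norm (x + t *\<^sub>R v) > R" using * norm_diff_ineq[of x "t *\<^sub>R v"] by linarith
        moreover have "norm x > R" using * norm_ge_zero[of v] by linarith
        ultimately have "x + t *\<^sub>R v \<notin> K" "x \<notin> K" using R by auto
        then show ?thesis using False supp by (simp add: T_def flip: t_def)
      qed
    qed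
  qed
  moreover have "(\<integral>x. T k x \<partial>lborel) = 0" for k
  proof -
    define w where "w = r k *\<^sub>R v"
    have sh: "integrable lborel (\<lambda>x. g (w + x))" "(\<integral>x. g (w + x) \<partial>lborel) = (\<integral>x. g x \<partial>lborel)"
      using gint integrable_distr_eq[of "(+) w" lborel borel g] integral_distr[of "(+) w" lborel borel g]
      by (simp_all add: lborel_distr_plus)
    then show ?thesis using gint unfolding T_def by (simp add: add.commute[of _ w] flip: w_def)
  qed
  ultimately show "(\<integral>x. frechet_derivative g (at x) v \<partial>lborel) = 0"
    by (simp add: LIMSEQ_const_iff)
qed

section \<open>Volume measure in the chart\<close>

context ball_model
begin

text \<open>The density \<open>P\<^sup>-\<^sup>n\<close> of the Riemannian measure with respect to Lebesgue measure.\<close>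

definition dens :: "real^'n \<Rightarrow> real" where
  "dens x = (if x \<in> B then inverse (P (x \<bullet> x)) ^ CARD('n) else 0)"

definition inv_chart :: "real^'n \<Rightarrow> real^'n" where
  "inv_chart x = (if x \<in> B then \<Psi> x else 0)"

lemma dens_nonneg: "0 \<le> dens x"
  using P_inner_pos[of x] by (auto simp: dens_def)

lemma continuous_P: "continuous_on {..<1} P"
  using smooth_P by (auto simp: smooth_on_def dest: spec[of _ 0])

lemma continuous_P_inner: "continuous_on B (\<lambda>x. P (x \<bullet> x))"
  by (rule continuous_on_compose2[OF continuous_P]) (auto intro!: continuous_intros inner_less_1)

lemma continuous_dens: "continuous_on B dens"
proof -
  have "continuous_on B (\<lambda>x. inverse (P (x \<bullet> x)) ^ CARD('n))"
    by (intro continuous_intros continuous_P_inner) (metis P_inner_pos less_irrefl)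
  then show ?thesis by (rule continuous_on_eq) (simp add: dens_def)
qed

lemma dens_measurable [measurable]: "dens \<in> borel_measurable borel"
proof -
  have "(\<lambda>x. if x \<in> B then dens x else 0) \<in> borel_measurable borel"
    by (rule borel_measurable_continuous_on_if) (auto intro: continuous_dens)
  moreover have "(\<lambda>x. if x \<in> B then dens x else 0) = dens" by (auto simp: dens_def)
  ultimately show ?thesis by simp
qed

lemma inv_chart_measurable [measurable]: "inv_chart \<in> borel_measurable borel"
  unfolding inv_chart_def[abs_def]
  by (rule borel_measurable_continuous_on_if) (auto intro: cont_Psi)

lemma sqrt_det_metric: "x \<in> B \<Longrightarrow> sqrt (det (metric_coeff M c x)) = dens x"
proof -
  assume x: "x \<in> B"
  have "det (mat k :: real^'n^'n) = k ^ CARD('n)" for k :: real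
    by (subst det_diagonal) (auto simp: mat_def)
  moreover have "sqrt (inverse ((P (x \<bullet> x))\<^sup>2) ^ CARD('n)) = inverse (P (x \<bullet> x)) ^ CARD('n)"
    using P_inner_pos[OF x] by (simp add: real_sqrt_power real_sqrt_inverse)
  ultimately show ?thesis using x by (simp only: metric_coeff_M dens_def if_True)
qed

definition vol :: "(real^'n) measure" where
  "vol = distr (density lborel (\<lambda>x. ennreal (dens x))) borel inv_chart"

lemma emeasure_vol:
  assumes "A \<in> sets borel"
  shows "emeasure vol A = (\<integral>\<^sup>+ x \<in> \<Phi> ` A. ennreal (sqrt (det (metric_coeff M c x))) \<partial>lborel)"
proof -
  have "emeasure vol A = (\<integral>\<^sup>+ x. ennreal (dens x) * indicator (inv_chart -` A) x \<partial>lborel)"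
    using assms measurable_sets[OF inv_chart_measurable assms]
    by (simp add: vol_def emeasure_distr emeasure_density)
  also have "\<dots> = (\<integral>\<^sup>+ x \<in> \<Phi> ` A. ennreal (sqrt (det (metric_coeff M c x))) \<partial>lborel)"
  proof (rule nn_integral_cong)
    fix x
    show "ennreal (dens x) * indicator (inv_chart -` A) x
       = ennreal (sqrt (det (metric_coeff M c x))) * indicator (\<Phi> ` A) x"
    proof (cases "x \<in> B")
      case True
      have "inv_chart x \<in> A \<longleftrightarrow> x \<in> \<Phi> ` A"
        using True by (metis Phi_Psi Psi_Phi image_iff inv_chart_def)
      then show ?thesis by (simp only: sqrt_det_metric[OF True]) (simp add: indicator_def)
    next
      case False
      then have "x \<notin> \<Phi> ` A" using Phi_in by blast
      then show ?thesis using False by (simp add: dens_def)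
    qed
  qed
  finally show ?thesis .
qed

text \<open>The only chart covers the whole manifold, so the values that the volume measure must take in it
  determine the measure on every Borel set.\<close>

lemma riemannian_volume_M: "riemannian_volume M = vol"
  unfolding riemannian_volume_def
proof (rule the_equality)
  have sb: "sigma_sets (pts M) {U. openin (mtop M) U} = sets (borel :: (real^'n) measure)"
    by (simp add: borel_def)
  have sv: "sets vol = sets borel" "space vol = UNIV" by (simp_all add: vol_def)
  show "space vol = pts M \<and> sets vol = sigma_sets (pts M) {U. openin (mtop M) U} \<and>
     (\<forall>c\<in>charts M. \<forall>A\<in>sets vol. A \<subseteq> cdom c \<longrightarrow>
        emeasure vol A = (\<integral>\<^sup>+ x \<in> cmap c ` A. ennreal (sqrt (det (metric_coeff M c x))) \<partial>lborel))"
    unfolding sb by (simp add: emeasure_vol sv)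
  fix \<mu> :: "(real^'n) measure"
  assume *: "space \<mu> = pts M \<and> sets \<mu> = sigma_sets (pts M) {U. openin (mtop M) U} \<and>
     (\<forall>c\<in>charts M. \<forall>A\<in>sets \<mu>. A \<subseteq> cdom c \<longrightarrow>
        emeasure \<mu> A = (\<integral>\<^sup>+ x \<in> cmap c ` A. ennreal (sqrt (det (metric_coeff M c x))) \<partial>lborel))"
  then have sets: "sets \<mu> = sets borel" unfolding sb by simp
  show "\<mu> = vol"
  proof (rule measure_eqI)
    show "sets \<mu> = sets vol" by (simp add: sets vol_def)
    fix A assume A: "A \<in> sets \<mu>"
    then show "emeasure \<mu> A = emeasure vol A"
      using * emeasure_vol[of A] sets by simp
  qed
qed

lemma nn_integral_vol:
  assumes [measurable]: "g \<in> borel_measurable borel"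
  shows "(\<integral>\<^sup>+ p. g p \<partial>vol) = (\<integral>\<^sup>+ x. ennreal (dens x) * g (inv_chart x) \<partial>lborel)"
  by (simp add: vol_def nn_integral_distr nn_integral_density)

lemma integral_vol:
  fixes g :: "real^'n \<Rightarrow> real"
  assumes [measurable]: "g \<in> borel_measurable borel"
  shows "(\<integral> p. g p \<partial>vol) = (\<integral> x. dens x * g (inv_chart x) \<partial>lborel)"
  by (simp add: vol_def integral_distr integral_density dens_nonneg)

end

section \<open>Lower bound for the bottom of the spectrum\<close>

lemma integral_pos_of_continuous:
  fixes g :: "'e::euclidean_space \<Rightarrow> real"
  assumes "continuous_on UNIV g" "integrable lborel g" "\<And>x. 0 \<le> g x" "0 < g x0"
  shows "0 < (\<integral>x. g x \<partial>lborel)"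
proof (rule ccontr)
  assume "\<not> ?thesis"
  then have "(\<integral>x. g x \<partial>lborel) = 0"
    using integral_nonneg_AE[of g lborel] assms(3) by (metis AE_I2 less_eq_real_def)
  then have "AE x in lborel. g x = 0"
    using integral_nonneg_eq_0_iff_AE[OF assms(2)] assms(3) by simp
  then have "AE x in lebesgue. x \<notin> {x. g x \<noteq> 0}"
    by (simp add: AE_completion)
  then have "negligible {x. g x \<noteq> 0}"
    by (simp add: negligible_iff_null_sets AE_iff_null_sets[symmetric] null_sets_def
         AE_iff_null_sets completion.AE_iff_null_sets)
  moreover have "open {x. g x \<noteq> 0}"
    using assms(1) by (intro open_Collect_neq) (auto intro: continuous_intros)
  ultimately show False using assms(4) open_not_negligible by fastforce
qed

definition coord_grad :: "(real^'n \<Rightarrow> real) \<Rightarrow> real^'n \<Rightarrow> real^'n" where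
  "coord_grad f x = (\<chi> i. frechet_derivative f (at x) (axis i 1))"

lemma frechet_coord_grad:
  fixes f :: "real^'n \<Rightarrow> real"
  assumes "f differentiable (at x)"
  shows "frechet_derivative f (at x) v = coord_grad f x \<bullet> v"
proof -
  have lin: "linear (frechet_derivative f (at x))"
    using assms by (meson frechet_derivative_works has_derivative_linear)
  have "frechet_derivative f (at x) v = frechet_derivative f (at x) (\<Sum>i\<in>UNIV. (v $ i) *\<^sub>R axis i 1)"
    using basis_expansion[of v] by (simp add: scalar_mult_eq_scaleR)
  also have "\<dots> = (\<Sum>i\<in>UNIV. v $ i * frechet_derivative f (at x) (axis i 1))"
    by (simp add: linear_sum[OF lin] linear_scale[OF lin])
  finally show ?thesis by (simp add: coord_grad_def inner_vec_def mult.commute)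
qed

context ball_model
begin

lemma tnorm_gradient:
  assumes f: "smooth_fun M f"
  defines "h \<equiv> f \<circ> cinv c"
  shows "(tnorm M p (gradient M f p))\<^sup>2 = (P (\<Phi> p \<bullet> \<Phi> p))\<^sup>2 * (coord_grad h (\<Phi> p) \<bullet> coord_grad h (\<Phi> p))"
proof -
  define r where "r = P (\<Phi> p \<bullet> \<Phi> p)"
  have r: "r > 0" by (simp add: r_def)
  have "smooth_on B h" using f by (simp add: smooth_fun_def range_Phi h_def)
  then have "Ck_on (Suc 0) B h" unfolding smooth_on_def by blast
  then have diff: "h differentiable (at (\<Phi> p))" using Phi_in by (auto simp del: mem_ball)
  have dfl: "differential M f p v = coord_grad h (\<Phi> p) \<bullet> v c" for v
    using frechet_coord_grad[OF diff] by (simp add: differential_def h_def)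
  have "gradient M f p = tvec_of (r\<^sup>2 *\<^sub>R coord_grad h (\<Phi> p))"
    unfolding gradient_def
  proof (rule the_equality)
    show "tvec_of (r\<^sup>2 *\<^sub>R coord_grad h (\<Phi> p)) \<in> tangent_space M p \<and>
      (\<forall>v\<in>tangent_space M p. gmetric M p (tvec_of (r\<^sup>2 *\<^sub>R coord_grad h (\<Phi> p))) v = differential M f p v)"
      using r by (simp add: gmetric_M dfl flip: r_def)
    fix u assume u: "u \<in> tangent_space M p \<and> (\<forall>v\<in>tangent_space M p. gmetric M p u v = differential M f p v)"
    have "u c \<bullet> w = (r\<^sup>2 *\<^sub>R coord_grad h (\<Phi> p)) \<bullet> w" for w
    proof -
      have "gmetric M p u (tvec_of w) = differential M f p (tvec_of w)" using u by simp
      then show ?thesis using r by (simp add: gmetric_M dfl field_simps flip: r_def)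
    qed
    then have "u c = r\<^sup>2 *\<^sub>R coord_grad h (\<Phi> p)" by (metis vector_eq_rdot)
    then show "u = tvec_of (r\<^sup>2 *\<^sub>R coord_grad h (\<Phi> p))" using u tangent_space_tvec_of by metis
  qed
  then have "tnorm M p (gradient M f p) = r * norm (coord_grad h (\<Phi> p))"
    using r by (simp add: tnorm_M power2_eq_square flip: r_def)
  then show ?thesis by (simp add: power_mult_distrib dot_square_norm r_def)
qed

text \<open>The field \<open>X = 2 P x / (1 + q)\<close> multiplied by the density \<open>P\<^sup>-\<^sup>n\<close> is \<open>field_weight(|x|\<^sup>2) x\<close>.\<close>

definition field_weight :: "real \<Rightarrow> real" where
  "field_weight q = 2 * inverse (P q) ^ (CARD('n) - 1) * inverse (1 + q)"
definition field_weight' :: "real \<Rightarrow> real" where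
  "field_weight' q = 2 * ((real CARD('n) - 1) * Q q * inverse (P q) ^ CARD('n)) * inverse (1 + q)
     - 2 * inverse (P q) ^ (CARD('n) - 1) * (inverse (1 + q))\<^sup>2"

lemma smooth_P_inner: "smooth_on B (\<lambda>x. P (x \<bullet> x))"
  by (rule smooth_on_comp_norm[OF smooth_P])

lemma smooth_inverse_P_inner: "smooth_on B (\<lambda>x. inverse (P (x \<bullet> x)))"
  by (rule smooth_on_inverse[OF _ smooth_P_inner]) (use P_inner_pos in force)+

lemma smooth_field_weight: "smooth_on B (\<lambda>x. field_weight (x \<bullet> x))"
proof -
  have "smooth_on B (\<lambda>x. inverse (1 + x \<bullet> x))"
    by (rule smooth_on_inverse[OF _ smooth_on_add[OF _ smooth_on_const smooth_on_norm_squared]])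
       (auto simp: add_nonneg_eq_0_iff)
  then show ?thesis unfolding field_weight_def
    by (intro smooth_on_mult smooth_on_const smooth_on_power smooth_inverse_P_inner) auto
qed

lemma field_weight_deriv:
  assumes "0 \<le> q" "q < 1"
  shows "(field_weight has_real_derivative field_weight' q) (at q)"
proof -
  define n where "n = CARD('n) - 1"
  have n: "CARD('n) = Suc n" by (simp add: n_def)
  have p: "P q \<noteq> 0" using P_pos[OF assms(2)] by simp
  have q: "1 + q \<noteq> 0" using assms(1) by simp
  have inv: "((\<lambda>q. inverse (P q)) has_real_derivative Q q * (inverse (P q))\<^sup>2) (at q)"
    by (rule DERIV_cong[OF DERIV_inverse_fun[OF P_deriv[OF assms(2)] p]]) (simp add: numeral_2_eq_2)
  have pow: "((\<lambda>q. inverse (P q) ^ n) has_real_derivative real n * Q q * inverse (P q) ^ Suc n) (at q)"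
    by (rule DERIV_cong[OF DERIV_power[OF inv]], cases n) (auto simp: power2_eq_square)
  have "((+) 1 has_real_derivative 1) (at q)"
    by (auto intro!: derivative_eq_intros)
  from DERIV_inverse_fun[OF this q]
  have "((\<lambda>q. inverse (1 + q)) has_real_derivative - (1 * inverse ((1 + q) ^ Suc (Suc 0)))) (at q)" .
  then have inv1: "((\<lambda>q. inverse (1 + q)) has_real_derivative - (inverse (1 + q))\<^sup>2) (at q)"
    by (simp add: power2_eq_square)
  show ?thesis
    unfolding field_weight_def[abs_def] field_weight'_def n diff_Suc_1
    by (rule DERIV_cong[OF DERIV_mult[OF DERIV_cmult[OF pow] inv1]]) (simp add: algebra_simps)
qed

end

text \<open>Hyperbolic space, \<open>P(q) = (1 - q) / 2\<close>, satisfies these bounds with \<open>b = 1\<close>.\<close>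

locale ball_model_gap = ball_model P Q Q' \<Phi> \<Psi> for P Q Q' and \<Phi> \<Psi> :: "real^'n::finite \<Rightarrow> real^'n" +
  fixes b :: real
  assumes b_nonneg: "0 \<le> b" and P_ge: "\<And>q. 0 \<le> q \<Longrightarrow> q < 1 \<Longrightarrow> b / 2 * (1 - q) \<le> P q"
    and Q_ge: "\<And>q. 0 \<le> q \<Longrightarrow> q < 1 \<Longrightarrow> b / 2 \<le> Q q"
begin

text \<open>The right-hand side is the Euclidean divergence of \<open>field_weight(|x|\<^sup>2) x\<close>. Up to the factor
  \<open>2 P\<^sup>-\<^sup>n / (1 + q)\<close> it equals \<open>(n - 1) (P + 2 q Q) + P (1 - q) / (1 + q)\<close>, and the bounds on \<open>P\<close> and \<open>Q\<close>
  combine to \<open>P + 2 q Q \<ge> b (1 + q) / 2\<close>.\<close>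

lemma divergence_ge:
  assumes "x \<in> B"
  shows "(real CARD('n) - 1) * b * dens x
    \<le> 2 * field_weight' (x \<bullet> x) * (x \<bullet> x) + real CARD('n) * field_weight (x \<bullet> x)"
proof -
  define q n k where "q = x \<bullet> x" and "n = real CARD('n)" and "k = CARD('n) - 1"
  have nk: "CARD('n) = Suc k" "n = 1 + real k" by (simp_all add: k_def n_def)
  have q: "0 \<le> q" "q < 1" using inner_less_1[OF assms] by (simp_all add: q_def)
  define p i where "p = P q" and "i = inverse p"
  have p: "p > 0" using P_pos[OF q(2)] by (simp add: p_def)
  then have i: "i > 0" "i * p = 1" by (simp_all add: i_def)
  have w: "2 * field_weight' q * q + n * field_weight q
     = i ^ Suc k * (2 * inverse (1 + q) * (real k * (p + 2 * q * Q q) + p * (1 - 2 * q * inverse (1 + q))))"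
  proof -
    have fw: "field_weight q = i ^ Suc k * (2 * p * inverse (1 + q))"
      using i(2) unfolding field_weight_def k_def[symmetric] p_def[symmetric] i_def[symmetric]
      by (simp add: mult_ac)
    have fw': "field_weight' q = i ^ Suc k * (2 * real k * Q q * inverse (1 + q) - 2 * p * (inverse (1 + q))\<^sup>2)"
      using i(2) unfolding field_weight'_def nk(1) diff_Suc_1 p_def[symmetric] i_def[symmetric]
      by (simp add: algebra_simps)
    show ?thesis unfolding fw fw' nk(2) by (simp add: algebra_simps power2_eq_square)
  qed
  have "b * (1 + q) / 2 = b / 2 * (1 - q) + 2 * q * (b / 2)" by (simp add: field_simps)
  also have "\<dots> \<le> p + 2 * q * Q q"
    unfolding p_def using P_ge[OF q] mult_left_mono[OF Q_ge[OF q], of "2 * q"] q(1) by linarith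
  finally have main: "b * (1 + q) / 2 \<le> p + 2 * q * Q q" .
  have "2 * q * inverse (1 + q) \<le> 1" using q by (simp add: field_simps)
  then have "real k * (b * (1 + q) / 2) \<le> real k * (p + 2 * q * Q q) + p * (1 - 2 * q * inverse (1 + q))"
    using mult_left_mono[OF main, of "real k"] mult_nonneg_nonneg[of p "1 - 2 * q * inverse (1 + q)"] p by linarith
  then have "2 * inverse (1 + q) * (real k * (b * (1 + q) / 2))
     \<le> 2 * inverse (1 + q) * (real k * (p + 2 * q * Q q) + p * (1 - 2 * q * inverse (1 + q)))"
    using q by (intro mult_left_mono) auto
  moreover have "2 * inverse (1 + q) * (real k * (b * (1 + q) / 2)) = real k * b"
  proof -
    have "inverse (1 + q) * (1 + q) = 1" using q by (intro left_inverse) simp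
    moreover have "2 * inverse (1 + q) * (real k * (b * (1 + q) / 2)) = real k * b * (inverse (1 + q) * (1 + q))"
      by simp
    ultimately show ?thesis by (simp only: mult_1_right)
  qed
  ultimately have "real k * b \<le> 2 * inverse (1 + q) * (real k * (p + 2 * q * Q q) + p * (1 - 2 * q * inverse (1 + q)))"
    by (simp only:)
  from mult_left_mono[OF this, of "i ^ Suc k"] i(1)
  have "i ^ Suc k * (real k * b) \<le> 2 * field_weight' q * q + n * field_weight q" unfolding w by simp
  moreover have "dens x = i ^ Suc k" using assms unfolding dens_def nk(1) by (simp add: i_def p_def q_def)
  ultimately show ?thesis unfolding nk(2)[unfolded n_def] q_def[symmetric] by (simp add: mult_ac nk(2) n_def)
qed

text \<open>Integrates \<open>0 \<le> |\<nabla>h + \<kappa> h X|\<^sup>2\<close> with \<open>\<kappa> = (n - 1) b / 2\<close>. After integration by parts the mixed term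
  is \<open>- \<kappa> \<integral> h\<^sup>2 div X \<le> - 2 \<kappa>\<^sup>2 \<integral> h\<^sup>2\<close>, and \<open>|X| \<le> 1\<close> bounds the last term by \<open>\<kappa>\<^sup>2 \<integral> h\<^sup>2\<close>.\<close>

lemma spectral_gap_chart:
  fixes h :: "real^'n \<Rightarrow> real"
  assumes h: "Ck_on 1 B h" and K: "compact K" "K \<subseteq> B" and supp: "\<And>x. x \<in> B - K \<Longrightarrow> h x = 0"
  shows "((real CARD('n) - 1) * b / 2)\<^sup>2 * (\<integral>x. dens x * (h x)\<^sup>2 \<partial>lborel)
     \<le> (\<integral>x. dens x * ((P (x \<bullet> x))\<^sup>2 * (coord_grad h x \<bullet> coord_grad h x)) \<partial>lborel)"
    and "x0 \<in> B \<Longrightarrow> h x0 \<noteq> 0 \<Longrightarrow> 0 < (\<integral>x. dens x * (h x)\<^sup>2 \<partial>lborel)"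
proof -
  define n where "n = real CARD('n)"
  have diff: "h differentiable (at x)" if "x \<in> B" for x using h that by simp
  have hc: "continuous_on B h" using Ck_on_SucD[of 0 B h] h by simp
  have gc: "continuous_on B (coord_grad h)"
    unfolding coord_grad_def using h by (intro continuous_on_vec_lambda) simp
  have oBK: "open (B - K)" using K(1) by (simp add: open_Diff compact_imp_closed)
  have grd0: "coord_grad h x = 0" if "x \<in> B - K" for x
  proof -
    have "(h has_derivative (\<lambda>_. 0)) (at x)"
      by (rule has_derivative_transform_within_open[OF has_derivative_const[of 0] oBK that]) (simp add: supp)
    then have "frechet_derivative h (at x) = (\<lambda>_. 0)" by (metis frechet_derivative_at)
    then show ?thesis by (simp add: coord_grad_def vec_eq_iff)
  qed
  have ext0: "continuous_on UNIV (\<lambda>x. dens x * u x) \<and> integrable lborel (\<lambda>x. dens x * u x)"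
    if "continuous_on B u" "\<And>x. x \<in> B - K \<Longrightarrow> u x = 0" for u :: "real^'n \<Rightarrow> real"
  proof -
    have eq: "(\<lambda>x. if x \<in> B then dens x * u x else 0) = (\<lambda>x. dens x * u x)"
      by (auto simp: dens_def)
    have "Ck_on 0 UNIV (\<lambda>x. if x \<in> B then dens x * u x else 0)"
      by (rule Ck_on_extend_zero[OF _ K]) (auto intro!: continuous_intros continuous_dens that)
    then have c: "continuous_on UNIV (\<lambda>x. dens x * u x)" unfolding eq by simp
    moreover have "integrable lborel (\<lambda>x. dens x * u x)"
      by (rule integrable_compact_support[OF K(1) c]) (use that(2) in \<open>auto simp: dens_def\<close>)
    ultimately show ?thesis by blast
  qed
  have H: "continuous_on UNIV (\<lambda>x. dens x * (h x)\<^sup>2)" "integrable lborel (\<lambda>x. dens x * (h x)\<^sup>2)"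
    using ext0[of "\<lambda>x. (h x)\<^sup>2"] supp hc by (auto intro: continuous_intros)
  have G: "integrable lborel (\<lambda>x. dens x * ((P (x \<bullet> x))\<^sup>2 * (coord_grad h x \<bullet> coord_grad h x)))"
    by (rule ext0[THEN conjunct2]) (intro continuous_intros gc continuous_P_inner, simp add: grd0)
  show "0 < (\<integral>x. dens x * (h x)\<^sup>2 \<partial>lborel)" if "x0 \<in> B" "h x0 \<noteq> 0"
    by (rule integral_pos_of_continuous[OF H, of x0])
       (use that P_inner_pos[OF that(1)] dens_nonneg in \<open>auto simp: dens_def\<close>)
  define Y where "Y i x = (h x)\<^sup>2 * field_weight (x \<bullet> x) * x $ i" for i x
  define Y0 where "Y0 i x = (if x \<in> B then Y i x else 0)" for i x
  have Y0: "Ck_on 1 UNIV (Y0 i)" for i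
    unfolding Y0_def
  proof (rule Ck_on_extend_zero[OF _ K])
    have fw: "Ck_on 1 B (\<lambda>x. field_weight (x \<bullet> x))" using smooth_field_weight unfolding smooth_on_def by blast
    show "Ck_on 1 B (Y i)" unfolding Y_def power2_eq_square
      by (rule Ck_on_mult[OF open_ball Ck_on_mult[OF open_ball Ck_on_mult[OF open_ball h h] fw]
          Ck_on_bounded_linear[OF open_ball bounded_linear_vec_nth]])
  qed (auto simp: Y_def supp)
  define dY where "dY x = (\<Sum>i\<in>UNIV. frechet_derivative (Y0 i) (at x) (axis i 1))" for x
  have Y0K: "Y0 i x = 0" if "x \<notin> K" for i x using that supp[of x] by (auto simp: Y0_def Y_def)
  have dY: "integrable lborel dY" "(\<integral>x. dY x \<partial>lborel) = 0"
  proof -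
    note zero = integral_directional_derivative_zero[OF K(1) Y0 Y0K]
    show "integrable lborel dY"
      unfolding dY_def[abs_def] by (rule Bochner_Integration.integrable_sum) (rule zero(1))
    show "(\<integral>x. dY x \<partial>lborel) = 0"
      unfolding dY_def by (subst Bochner_Integration.integral_sum) (auto intro: zero(1) simp: zero(2))
  qed
  have dY_eq: "dY x = 2 * h x * field_weight (x \<bullet> x) * (coord_grad h x \<bullet> x)
      + (h x)\<^sup>2 * (2 * field_weight' (x \<bullet> x) * (x \<bullet> x) + n * field_weight (x \<bullet> x))" if x: "x \<in> B" for x
  proof -
    have q: "0 \<le> x \<bullet> x" "x \<bullet> x < 1" using inner_less_1[OF x] by simp_all
    have hd: "(h has_derivative (\<lambda>v. coord_grad h x \<bullet> v)) (at x)"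
    proof -
      have "frechet_derivative h (at x) = (\<lambda>v. coord_grad h x \<bullet> v)"
        by (rule ext) (rule frechet_coord_grad[OF diff[OF x]])
      then show ?thesis using diff[OF x] by (simp add: frechet_derivative_works)
    qed
    have nd: "((\<lambda>x::real^'n. x \<bullet> x) has_derivative (\<lambda>v. 2 * (x \<bullet> v))) (at x)"
      by (auto intro!: derivative_eq_intros simp: inner_commute)
    have wd: "((\<lambda>x. field_weight (x \<bullet> x)) has_derivative (\<lambda>v. 2 * field_weight' (x \<bullet> x) * (x \<bullet> v))) (at x)"
      using DERIV_compose_FDERIV[OF field_weight_deriv[OF q] nd] by (simp add: mult_ac)
    have Yd: "(Y i has_derivative (\<lambda>v. (h x)\<^sup>2 * field_weight (x \<bullet> x) * v $ i +
        ((h x)\<^sup>2 * (2 * field_weight' (x \<bullet> x) * (x \<bullet> v)) + 2 * h x * (coord_grad h x \<bullet> v) * field_weight (x \<bullet> x)) * x $ i)) (at x)" for i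
    proof -
      have "((\<lambda>x. (h x)\<^sup>2) has_derivative (\<lambda>v. 2 * h x * (coord_grad h x \<bullet> v))) (at x)"
        unfolding power2_eq_square by (rule has_derivative_eq_rhs[OF has_derivative_mult[OF hd hd]]) (auto simp: algebra_simps)
      from has_derivative_mult[OF has_derivative_mult[OF this wd]
          bounded_linear_imp_has_derivative[OF bounded_linear_vec_nth[of i]]]
      show ?thesis unfolding Y_def .
    qed
    have "(Y0 i has_derivative (\<lambda>v. (h x)\<^sup>2 * field_weight (x \<bullet> x) * v $ i +
        ((h x)\<^sup>2 * (2 * field_weight' (x \<bullet> x) * (x \<bullet> v)) + 2 * h x * (coord_grad h x \<bullet> v) * field_weight (x \<bullet> x)) * x $ i)) (at x)" for i
      by (rule has_derivative_transform_within_open[OF Yd open_ball x]) (simp add: Y0_def)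
    from frechet_derivative_at[OF this, symmetric]
    have "frechet_derivative (Y0 i) (at x) (axis i 1) = (h x)\<^sup>2 * field_weight (x \<bullet> x) +
        ((h x)\<^sup>2 * (2 * field_weight' (x \<bullet> x) * x $ i) + 2 * h x * (coord_grad h x $ i) * field_weight (x \<bullet> x)) * x $ i" for i
      by (simp add: inner_axis)
    then have "dY x = (\<Sum>i\<in>UNIV. (h x)\<^sup>2 * field_weight (x \<bullet> x)
        + (h x)\<^sup>2 * (2 * field_weight' (x \<bullet> x)) * (x $ i * x $ i)
        + 2 * h x * field_weight (x \<bullet> x) * (coord_grad h x $ i * x $ i))"
      unfolding dY_def by (simp add: algebra_simps)
    also have "\<dots> = n * ((h x)\<^sup>2 * field_weight (x \<bullet> x))
        + (h x)\<^sup>2 * (2 * field_weight' (x \<bullet> x)) * (x \<bullet> x)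
        + 2 * h x * field_weight (x \<bullet> x) * (coord_grad h x \<bullet> x)"
      by (simp add: sum.distrib inner_vec_def n_def flip: sum_distrib_left)
    finally show ?thesis by (simp add: algebra_simps)
  qed
  define \<kappa> where "\<kappa> = (n - 1) * b / 2"
  \<comment> \<open>the inequality \<open>0 \<le> |\<nabla>h + \<kappa> h X|\<^sup>2\<close>, multiplied by the density and combined with \<open>divergence_ge\<close>\<close>
  have pointwise: "\<kappa>\<^sup>2 * (dens x * (h x)\<^sup>2) - \<kappa> * dY x \<le> dens x * ((P (x \<bullet> x))\<^sup>2 * (coord_grad h x \<bullet> coord_grad h x))" for x
  proof (cases "x \<in> B")
    case False
    then have "x \<in> - K" using K(2) by auto
    then have "(Y0 i has_derivative (\<lambda>_. 0)) (at x)" for i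
      using has_derivative_transform_within_open[OF has_derivative_const[of 0] open_Compl[OF compact_imp_closed[OF K(1)]], of x "Y0 i" UNIV] Y0K
      by simp
    then have "frechet_derivative (Y0 i) (at x) = (\<lambda>_. 0)" for i by (metis frechet_derivative_at)
    then show ?thesis using False by (simp add: dY_def dens_def)
  next
    case True
    define q p G \<delta> where "q = x \<bullet> x" and "p = P q" and "G = coord_grad h x" and "\<delta> = dens x"
    have p: "p > 0" using P_inner_pos[OF True] by (simp add: p_def q_def)
    have \<delta>: "\<delta> \<ge> 0" by (simp add: \<delta>_def dens_nonneg)
    have \<kappa>: "\<kappa> \<ge> 0" using b_nonneg by (simp add: \<kappa>_def n_def)
    have w: "field_weight q = \<delta> * (p * (2 / (1 + q)))"
    proof -
      have "\<delta> = inverse p ^ (CARD('n) - 1) * inverse p"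
        using True power_Suc2[of "inverse p" "CARD('n) - 1"] by (simp add: \<delta>_def dens_def p_def q_def)
      then have dp: "\<delta> * p = inverse p ^ (CARD('n) - 1)" using p by simp
      have "field_weight q = 2 * (\<delta> * p) * inverse (1 + q)"
        unfolding dp by (simp add: field_weight_def p_def)
      then show ?thesis by (simp only: divide_inverse mult_ac)
    qed
    have "\<bar>2 / (1 + q) * (G \<bullet> x)\<bar> \<le> norm G"
    proof -
      have "0 \<le> (norm x - 1)\<^sup>2" by simp
      then have "2 * norm x \<le> 1 + q" by (simp add: q_def dot_square_norm power2_diff)
      then have "2 / (1 + q) * norm x \<le> 1" using inner_ge_zero[of x] by (simp add: q_def divide_le_eq add_pos_nonneg)
      then have "norm G * (2 / (1 + q) * norm x) \<le> norm G * 1" by (intro mult_left_mono) auto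
      moreover have "2 / (1 + q) * \<bar>G \<bullet> x\<bar> \<le> 2 / (1 + q) * (norm G * norm x)"
        by (intro mult_left_mono Cauchy_Schwarz_ineq2) (simp add: q_def)
      moreover have "\<bar>2 / (1 + q) * (G \<bullet> x)\<bar> = 2 / (1 + q) * \<bar>G \<bullet> x\<bar>"
        by (simp add: abs_mult q_def add_nonneg_nonneg)
      ultimately show ?thesis by (simp add: mult_ac)
    qed
    moreover define s where "s = 2 / (1 + q) * (G \<bullet> x)"
    ultimately have "\<bar>\<kappa> * h x * p\<bar> * \<bar>s\<bar> \<le> \<bar>\<kappa> * h x * p\<bar> * norm G"
      by (intro mult_left_mono) auto
    then have "\<bar>\<kappa> * h x * p * s\<bar> \<le> \<kappa> * \<bar>h x\<bar> * p * norm G"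
      using p \<kappa> by (simp add: abs_mult)
    then have "- (\<kappa> * \<bar>h x\<bar> * p * norm G) \<le> \<kappa> * h x * p * s" by linarith
    moreover have "0 \<le> (p * norm G - \<kappa> * \<bar>h x\<bar>)\<^sup>2" by simp
    ultimately have "0 \<le> p\<^sup>2 * (norm G)\<^sup>2 + 2 * (\<kappa> * h x * p * s) + \<kappa>\<^sup>2 * (h x)\<^sup>2"
      by (simp add: power2_diff power_mult_distrib algebra_simps)
    from mult_left_mono[OF this \<delta>]
    have 1: "0 \<le> \<delta> * (p\<^sup>2 * (norm G)\<^sup>2) + 2 * \<kappa> * (h x * field_weight q * (G \<bullet> x)) + \<kappa>\<^sup>2 * (\<delta> * (h x)\<^sup>2)"
      unfolding w s_def by (simp add: algebra_simps)
    have "(2 * \<kappa>) * \<delta> \<le> 2 * field_weight' q * q + n * field_weight q"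
      using divergence_ge[OF True] by (simp add: \<kappa>_def n_def q_def \<delta>_def)
    then have "\<kappa> * (h x)\<^sup>2 * ((2 * \<kappa>) * \<delta>) \<le> \<kappa> * (h x)\<^sup>2 * (2 * field_weight' q * q + n * field_weight q)"
      using \<kappa> by (intro mult_left_mono) auto
    then have 2: "2 * (\<kappa>\<^sup>2 * (\<delta> * (h x)\<^sup>2)) \<le> \<kappa> * ((h x)\<^sup>2 * (2 * field_weight' q * q + n * field_weight q))"
      by (simp add: power2_eq_square mult_ac)
    have "\<kappa> * dY x = 2 * \<kappa> * (h x * field_weight q * (G \<bullet> x)) + \<kappa> * ((h x)\<^sup>2 * (2 * field_weight' q * q + n * field_weight q))"
      unfolding dY_eq[OF True] q_def G_def by (simp add: algebra_simps)
    with 1 2 have "\<kappa>\<^sup>2 * (\<delta> * (h x)\<^sup>2) - \<kappa> * dY x \<le> \<delta> * (p\<^sup>2 * (norm G)\<^sup>2)" by linarith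
    then show ?thesis by (simp add: \<delta>_def p_def q_def G_def dot_square_norm)
  qed
  show "((real CARD('n) - 1) * b / 2)\<^sup>2 * (\<integral>x. dens x * (h x)\<^sup>2 \<partial>lborel)
     \<le> (\<integral>x. dens x * ((P (x \<bullet> x))\<^sup>2 * (coord_grad h x \<bullet> coord_grad h x)) \<partial>lborel)"
  proof -
    have "\<kappa>\<^sup>2 * (\<integral>x. dens x * (h x)\<^sup>2 \<partial>lborel) = (\<integral>x. \<kappa>\<^sup>2 * (dens x * (h x)\<^sup>2) - \<kappa> * dY x \<partial>lborel)"
      using H(2) dY by simp
    also have "\<dots> \<le> (\<integral>x. dens x * ((P (x \<bullet> x))\<^sup>2 * (coord_grad h x \<bullet> coord_grad h x)) \<partial>lborel)"
      by (rule integral_mono[OF _ G pointwise]) (use H(2) dY in auto)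
    finally show ?thesis by (simp add: \<kappa>_def n_def)
  qed
qed


lemma test_function_chart:
  assumes "f \<in> test_functions M"
  defines "h \<equiv> f \<circ> cinv c"
  obtains K x0 where "smooth_on B h" "compact K" "K \<subseteq> B" "\<And>x. x \<in> B - K \<Longrightarrow> h x = 0" "x0 \<in> B" "h x0 \<noteq> 0"
proof -
  have f: "smooth_fun M f" "compact (closure {p. f p \<noteq> 0})" "\<exists>p. f p \<noteq> 0"
    using assms(1) by (auto simp: test_functions_def compact_support_def compactin_euclidean_iff)
  have hf: "h x = f (\<Psi> x)" if "x \<in> B" for x using cinv_c[OF that] by (simp add: h_def)
  obtain p where p: "f p \<noteq> 0" using f(3) by blast
  show ?thesis
  proof (rule that)
    show "smooth_on B h" using f(1) by (simp add: smooth_fun_def range_Phi h_def)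
    show "compact (\<Phi> ` closure {p. f p \<noteq> 0})"
      by (intro compact_continuous_image f(2) continuous_on_subset[OF cont_Phi]) simp
    show "\<Phi> ` closure {p. f p \<noteq> 0} \<subseteq> B" using Phi_in by blast
    show "h x = 0" if "x \<in> B - \<Phi> ` closure {p. f p \<noteq> 0}" for x
    proof (rule ccontr)
      assume "h x \<noteq> 0"
      then have "\<Psi> x \<in> {p. f p \<noteq> 0}" using that hf by simp
      then have "\<Psi> x \<in> closure {p. f p \<noteq> 0}" by (rule subsetD[OF closure_subset])
      then show False using that Phi_Psi[of x] by (metis DiffD1 DiffD2 imageI)
    qed
    show "\<Phi> p \<in> B" by (rule Phi_in)
    show "h (\<Phi> p) \<noteq> 0" using p hf[OF Phi_in] by simp
  qed
qed

text \<open>Needed because the bottom of the spectrum is an infimum over the test functions, about which nothing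
  could be said if there were none.\<close>

lemma test_functions_nonempty: "test_functions M \<noteq> {}"
proof -
  define f where "f p = bump_deriv 0 (1/4 - \<Phi> p \<bullet> \<Phi> p)" for p
  have "smooth_on B (\<lambda>x. bump_deriv 0 (1/4 + (-1) * (x \<bullet> x)))"
    by (rule smooth_on_compose[OF open_ball open_UNIV subset_UNIV smooth_on_bump])
       (intro smooth_on_add smooth_on_mult smooth_on_const smooth_on_norm_squared open_ball)
  then have "smooth_on B (f \<circ> cinv c)"
    by (rule smooth_on_cong[THEN iffD2, rotated -1]) (auto simp: f_def cinv_c[simplified])
  then have "smooth_fun M f" by (simp add: smooth_fun_def range_Phi)
  moreover have "compact_support M f"
  proof -
    have "compact (\<Psi> ` cball 0 (1/2))"
      by (intro compact_continuous_image continuous_on_subset[OF cont_Psi]) auto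
    moreover have "{p. f p \<noteq> 0} \<subseteq> \<Psi> ` cball 0 (1/2)"
    proof
      fix p assume "p \<in> {p. f p \<noteq> 0}"
      then have "(norm (\<Phi> p))\<^sup>2 < (1/2)\<^sup>2"
        by (auto simp: f_def bump_deriv_def dot_square_norm power2_eq_square split: if_splits)
      then have "norm (\<Phi> p) < 1/2" by (rule power2_less_imp_less) simp
      then have "\<Phi> p \<in> cball 0 (1/2)" by simp
      then show "p \<in> \<Psi> ` cball 0 (1/2)" by (metis Psi_Phi imageI)
    qed
    ultimately have "compact (closure {p. f p \<noteq> 0})"
      by (meson compact_closure bounded_subset compact_imp_bounded)
    then show ?thesis by (simp add: compact_support_def compactin_euclidean_iff)
  qed
  moreover have "f (\<Psi> 0) \<noteq> 0" by (simp add: f_def bump_deriv_def)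
  ultimately show ?thesis by (auto simp: test_functions_def)
qed

lemma spectrum_bottom_ge: "((real CARD('n) - 1) * b / 2)\<^sup>2 \<le> spectrum_bottom M"
  unfolding spectrum_bottom_def
proof (rule cINF_greatest[OF test_functions_nonempty])
  fix f assume f: "f \<in> test_functions M"
  define h where "h = f \<circ> cinv c"
  obtain K x0 where hK: "smooth_on B h" "compact K" "K \<subseteq> B" "\<And>x. x \<in> B - K \<Longrightarrow> h x = 0"
    and x0: "x0 \<in> B" "h x0 \<noteq> 0"
    using test_function_chart[OF f, folded h_def] by blast
  have C1: "Ck_on 1 B h" using hK(1) unfolding smooth_on_def by blast
  note gap = spectral_gap_chart(1)[OF C1 hK(2-4)] spectral_gap_chart(2)[OF C1 hK(2-4) x0]
  have hc: "continuous_on B h" using Ck_on_SucD[of 0 B h] C1 by simp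
  have gc: "continuous_on B (coord_grad h)"
    unfolding coord_grad_def using C1 by (intro continuous_on_vec_lambda) simp
  have meas: "(\<lambda>p. u (\<Phi> p)) \<in> borel_measurable borel" if "continuous_on B u" for u :: "real^'n \<Rightarrow> real"
    by (rule borel_measurable_continuous_onI, rule continuous_on_compose2[OF that cont_Phi]) (use Phi_in in auto)
  have push: "(\<integral>p. u (\<Phi> p) \<partial>vol) = (\<integral>x. dens x * u x \<partial>lborel)" if "continuous_on B u" for u
    unfolding integral_vol[OF meas[OF that]]
    by (rule Bochner_Integration.integral_cong) (auto simp: dens_def inv_chart_def)
  have fh: "f p = h (\<Phi> p)" for p
    using cinv_c[OF Phi_in[of p]] by (simp add: h_def)
  have "(\<integral>p. (tnorm M p (gradient M f p))\<^sup>2 \<partial>riemannian_volume M)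
      = (\<integral>x. dens x * ((P (x \<bullet> x))\<^sup>2 * (coord_grad h x \<bullet> coord_grad h x)) \<partial>lborel)"
    using f tnorm_gradient[of f, folded h_def]
    by (subst push[symmetric])
       (auto simp: test_functions_def riemannian_volume_M intro!: continuous_intros gc continuous_P_inner)
  moreover have "(\<integral>p. (f p)\<^sup>2 \<partial>riemannian_volume M) = (\<integral>x. dens x * (h x)\<^sup>2 \<partial>lborel)"
    unfolding fh riemannian_volume_M by (rule push) (intro continuous_intros hc)
  ultimately show "((real CARD('n) - 1) * b / 2)\<^sup>2 \<le>
     (\<integral>p. (tnorm M p (gradient M f p))\<^sup>2 \<partial>riemannian_volume M) / (\<integral>p. (f p)\<^sup>2 \<partial>riemannian_volume M)"
    using gap by (simp add: le_divide_eq)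
qed

end

section \<open>Lengths of curves and completeness\<close>

text \<open>Derivatives within the closed interval are one-sided at its end points, so a curve may have corners
  between two pieces.\<close>

definition C1_piece :: "real \<Rightarrow> real \<Rightarrow> (real \<Rightarrow> 'e::euclidean_space) \<Rightarrow> bool" where
  "C1_piece a b k \<longleftrightarrow> (\<exists>k'. (\<forall>t\<in>{a..b}. (k has_vector_derivative k' t) (at t within {a..b})) \<and> continuous_on {a..b} k')"

lemma C1_piece_cong:
  assumes "\<And>t. t \<in> {a..b} \<Longrightarrow> k t = l t" shows "C1_piece a b k \<longleftrightarrow> C1_piece a b l"
proof -
  have "(k has_vector_derivative v) (at t within {a..b}) \<longleftrightarrow> (l has_vector_derivative v) (at t within {a..b})"
    if "t \<in> {a..b}" for t v
    using has_vector_derivative_transform[OF that, of l k v] has_vector_derivative_transform[OF that, of k l v]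
      assms by metis
  then show ?thesis unfolding C1_piece_def by (metis (no_types, lifting))
qed

lemma C1_piece_affine:
  assumes "C1_piece a b k" and \<sigma>: "\<And>t. t \<in> {a'..b'} \<Longrightarrow> u * t + w \<in> {a..b}"
  shows "C1_piece a' b' (\<lambda>t. k (u * t + w))"
proof -
  obtain k' where k': "\<And>t. t \<in> {a..b} \<Longrightarrow> (k has_vector_derivative k' t) (at t within {a..b})" "continuous_on {a..b} k'"
    using assms(1) unfolding C1_piece_def by blast
  show ?thesis unfolding C1_piece_def
  proof (intro exI conjI ballI)
    fix t assume t: "t \<in> {a'..b'}"
    have "((\<lambda>t. u * t + w) has_vector_derivative u) (at t within {a'..b'})"
      by (auto intro!: derivative_eq_intros simp: has_vector_derivative_def)
    moreover have "(k has_vector_derivative k' (u * t + w)) (at (u * t + w) within (\<lambda>t. u * t + w) ` {a'..b'})"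
      by (rule has_vector_derivative_within_subset[OF k'(1)]) (use \<sigma> t in auto)
    ultimately have "(k \<circ> (\<lambda>t. u * t + w) has_vector_derivative u *\<^sub>R k' (u * t + w)) (at t within {a'..b'})"
      by (rule vector_diff_chain_within)
    then show "((\<lambda>t. k (u * t + w)) has_vector_derivative u *\<^sub>R k' (u * t + w)) (at t within {a'..b'})"
      by (simp add: o_def)
  next
    show "continuous_on {a'..b'} (\<lambda>t. u *\<^sub>R k' (u * t + w))"
      by (intro continuous_intros continuous_on_compose2[OF k'(2)]) (use \<sigma> in auto)
  qed
qed

definition is_partition :: "(real \<Rightarrow> 'e::euclidean_space) \<Rightarrow> nat \<Rightarrow> (nat \<Rightarrow> real) \<Rightarrow> bool" where
  "is_partition k m \<tau> \<longleftrightarrow> \<tau> 0 = 0 \<and> \<tau> m = 1 \<and> (\<forall>i<m. \<tau> i < \<tau> (Suc i) \<and> C1_piece (\<tau> i) (\<tau> (Suc i)) k)"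

lemma is_partition_mono:
  assumes "is_partition k m \<tau>" "i \<le> j" "j \<le> m" shows "\<tau> i \<le> \<tau> j"
  using assms(2,3)
proof (induction j rule: dec_induct)
  case (step j)
  then have "\<tau> j < \<tau> (Suc j)" using assms(1) by (auto simp: is_partition_def)
  then show ?case using step by simp
qed simp

lemma is_partition_bounds:
  assumes "is_partition k m \<tau>" "i \<le> m" shows "0 \<le> \<tau> i" "\<tau> i \<le> 1"
  using is_partition_mono[OF assms(1), of 0 i] is_partition_mono[OF assms(1), of i m] assms
  by (auto simp: is_partition_def)

lemma is_partition_reverse:
  assumes "is_partition k m \<tau>"
  shows "is_partition (\<lambda>t. k (1 - t)) m (\<lambda>i. 1 - \<tau> (m - i))"
proof -
  have "C1_piece (1 - \<tau> (m - i)) (1 - \<tau> (m - Suc i)) (\<lambda>t. k ((-1) * t + 1)) \<and> \<tau> (m - Suc i) < \<tau> (m - i)" if "i < m" for i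
  proof -
    have "Suc (m - Suc i) = m - i" "m - Suc i < m" using that by auto
    then have *: "\<tau> (m - Suc i) < \<tau> (m - i)" "C1_piece (\<tau> (m - Suc i)) (\<tau> (m - i)) k"
      using assms unfolding is_partition_def by metis+
    have "C1_piece (1 - \<tau> (m - i)) (1 - \<tau> (m - Suc i)) (\<lambda>t. k ((-1) * t + 1))"
      by (rule C1_piece_affine[OF *(2)]) auto
    then show ?thesis using * by blast
  qed
  then show ?thesis using assms by (simp add: is_partition_def)
qed

lemma is_partition_join:
  assumes k: "is_partition k m \<tau>" and l: "is_partition l n \<rho>" and eq: "k 1 = l 0"
  shows "is_partition (\<lambda>t. if t \<le> 1/2 then k (2 * t) else l (2 * t - 1)) (m + n)
    (\<lambda>i. if i \<le> m then \<tau> i / 2 else 1/2 + \<rho> (i - m) / 2)"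
    (is "is_partition ?j _ ?\<tau>")
  unfolding is_partition_def
proof (intro conjI allI impI)
  show "?\<tau> 0 = 0" using k by (simp add: is_partition_def)
  have n: "n > 0" using l by (cases n) (auto simp: is_partition_def)
  show "?\<tau> (m + n) = 1" using l n by (simp add: is_partition_def)
  fix i assume i: "i < m + n"
  have \<tau>m: "\<tau> m = 1" and \<rho>0: "\<rho> 0 = 0" using k l by (auto simp: is_partition_def)
  have "?\<tau> i < ?\<tau> (Suc i) \<and> C1_piece (?\<tau> i) (?\<tau> (Suc i)) ?j"
  proof (cases "i < m")
    case True
    then have p: "\<tau> i < \<tau> (Suc i)" "C1_piece (\<tau> i) (\<tau> (Suc i)) k" using k by (auto simp: is_partition_def)
    have "\<tau> (Suc i) \<le> 1" using is_partition_bounds[OF k, of "Suc i"] True by simp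
    then have "C1_piece (\<tau> i / 2) (\<tau> (Suc i) / 2) ?j \<longleftrightarrow> C1_piece (\<tau> i / 2) (\<tau> (Suc i) / 2) (\<lambda>t. k (2 * t + 0))"
      by (intro C1_piece_cong) auto
    moreover have "C1_piece (\<tau> i / 2) (\<tau> (Suc i) / 2) (\<lambda>t. k (2 * t + 0))"
      by (rule C1_piece_affine[OF p(2)]) auto
    ultimately show ?thesis using True p(1) by simp
  next
    case False
    define j where "j = i - m"
    have j: "i = m + j" "j < n" using False i by (auto simp: j_def)
    then have p: "\<rho> j < \<rho> (Suc j)" "C1_piece (\<rho> j) (\<rho> (Suc j)) l" using l by (auto simp: is_partition_def)
    have \<tau>: "?\<tau> i = 1/2 + \<rho> j / 2" "?\<tau> (Suc i) = 1/2 + \<rho> (Suc j) / 2"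
      using j \<tau>m \<rho>0 by auto
    have "0 \<le> \<rho> j" using is_partition_bounds[OF l, of j] j by simp
    have "k (2 * t) = l (2 * t - 1)" if "t \<le> 1/2" "1/2 + \<rho> j / 2 \<le> t" for t
    proof -
      have "2 * t = 1" using that \<open>0 \<le> \<rho> j\<close> by linarith
      then show ?thesis using eq by simp
    qed
    then have "C1_piece (1/2 + \<rho> j / 2) (1/2 + \<rho> (Suc j) / 2) ?j
       \<longleftrightarrow> C1_piece (1/2 + \<rho> j / 2) (1/2 + \<rho> (Suc j) / 2) (\<lambda>t. l (2 * t + (-1)))"
      by (intro C1_piece_cong) auto
    moreover have "C1_piece (1/2 + \<rho> j / 2) (1/2 + \<rho> (Suc j) / 2) (\<lambda>t. l (2 * t + (-1)))"
      by (rule C1_piece_affine[OF p(2)]) auto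
    ultimately show ?thesis unfolding \<tau> using p(1) by simp
  qed
  then show "?\<tau> i < ?\<tau> (Suc i)" "C1_piece (?\<tau> i) (?\<tau> (Suc i)) ?j" by blast+
qed

text \<open>Outside the finitely many corners the one-sided derivatives of the pieces are two-sided ones, in which
  the speed is expressed. Integrals of the speed ignore the corners.\<close>

lemma is_partition_differentiable:
  assumes "is_partition k m \<tau>" "t \<in> {0..1}" "t \<notin> \<tau> ` {..m}"
  shows "\<exists>v. (k has_vector_derivative v) (at t)"
proof -
  define i where "i = (LEAST i. t < \<tau> i)"
  have m: "\<tau> m = 1" "\<tau> 0 = 0" using assms(1) by (auto simp: is_partition_def)
  then have "t < \<tau> m" using assms(2,3) by (metis atLeastAtMost_iff atMost_iff image_eqI less_eq_real_def order_refl)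
  then have i: "t < \<tau> i" "i \<le> m" "\<And>j. j < i \<Longrightarrow> \<not> t < \<tau> j"
    unfolding i_def by (auto intro: LeastI Least_le dest: not_less_Least)
  have "i \<noteq> 0" using i(1) m assms(2) by (intro notI) auto
  then obtain j where j: "i = Suc j" by (cases i) auto
  have "\<tau> j \<noteq> t" using assms(3) i(2) j by auto
  then have t: "t \<in> {\<tau> j<..<\<tau> (Suc j)}" using i j by force
  obtain k' where "(k has_vector_derivative k' t) (at t within {\<tau> j..\<tau> (Suc j)})"
    using assms(1) i(2) j t unfolding is_partition_def C1_piece_def by (metis Suc_le_lessD greaterThanLessThan_subseteq_atLeastAtMost_iff order_refl subsetD)
  then show ?thesis using t by (auto simp: at_within_Icc_at)
qed

context ball_model
begin

definition speed :: "(real \<Rightarrow> real^'n) \<Rightarrow> real \<Rightarrow> real" where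
  "speed k t = norm (vector_derivative k (at t)) / P (k t \<bullet> k t)"

lemma curve_length_M: "curve_length M g = integral {0..1} (speed (\<Phi> \<circ> g))"
  unfolding curve_length_def speed_def by (simp add: tnorm_M velocity_def)

lemma C1_curve_on_M: "a < b \<Longrightarrow> C1_curve_on M a b g \<longleftrightarrow> C1_piece a b (\<Phi> \<circ> g)"
proof
  assume ab: "a < b" and C: "C1_curve_on M a b g"
  then have d: "(\<Phi> \<circ> g) differentiable (at t within {a..b})"
    and c: "continuous (at t within {a..b}) (\<lambda>u. vector_derivative (\<Phi> \<circ> g) (at u within {a..b}))"
    if "t \<in> {a..b}" for t
    using that by (auto simp: C1_curve_on_def)
  show "C1_piece a b (\<Phi> \<circ> g)" unfolding C1_piece_def
    using d c by (intro exI[of _ "\<lambda>u. vector_derivative (\<Phi> \<circ> g) (at u within {a..b})"])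
      (auto simp: continuous_on_eq_continuous_within vector_derivative_works[symmetric])
next
  assume ab: "a < b" and "C1_piece a b (\<Phi> \<circ> g)"
  then obtain k' where k': "\<And>t. t \<in> {a..b} \<Longrightarrow> (\<Phi> \<circ> g has_vector_derivative k' t) (at t within {a..b})" "continuous_on {a..b} k'"
    unfolding C1_piece_def by blast
  have vd: "vector_derivative (\<Phi> \<circ> g) (at t within {a..b}) = k' t" if "t \<in> {a..b}" for t
    using vector_derivative_within_closed_interval[OF ab that k'(1)[OF that]] .
  have "continuous_on {a..b} (\<lambda>u. vector_derivative (\<Phi> \<circ> g) (at u within {a..b}))"
    using k'(2) by (rule continuous_on_eq) (simp add: vd)
  then show "C1_curve_on M a b g"
    using differentiableI_vector[OF k'(1)]
    by (simp add: C1_curve_on_def continuous_on_eq_continuous_within)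
qed

lemma piecewise_C1_curve_M:
  "piecewise_C1_curve M g \<longleftrightarrow> continuous_on {0..1} g \<and> (\<exists>m \<tau>. is_partition (\<Phi> \<circ> g) m \<tau>)"
proof -
  have "(\<forall>i<m. \<tau> i < \<tau> (Suc i) \<and> C1_curve_on M (\<tau> i) (\<tau> (Suc i)) g) \<longleftrightarrow>
     (\<forall>i<m. \<tau> i < \<tau> (Suc i) \<and> C1_piece (\<tau> i) (\<tau> (Suc i)) (\<Phi> \<circ> g))" for m \<tau>
    using C1_curve_on_M by blast
  then show ?thesis unfolding piecewise_C1_curve_def is_partition_def by simp
qed

lemma speed_nonneg: "k t \<in> B \<Longrightarrow> 0 \<le> speed k t"
  using P_inner_pos[of "k t"] by (simp add: speed_def)

lemma speed_piece:
  assumes ab: "a < b" and "C1_piece a b k" and B: "\<And>t. t \<in> {a..b} \<Longrightarrow> k t \<in> B"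
  shows "speed k integrable_on {a..b}"
    and "\<And>h h'. (\<And>x. x \<in> B \<Longrightarrow> (h has_derivative h' x) (at x)) \<Longrightarrow>
       (\<And>x v. x \<in> B \<Longrightarrow> \<bar>h' x v\<bar> \<le> norm v / P (x \<bullet> x)) \<Longrightarrow>
       \<bar>h (k b) - h (k a)\<bar> \<le> integral {a..b} (speed k)"
proof -
  obtain k' where k': "\<And>t. t \<in> {a..b} \<Longrightarrow> (k has_vector_derivative k' t) (at t within {a..b})" "continuous_on {a..b} k'"
    using assms(2) unfolding C1_piece_def by blast
  define f where "f t = norm (k' t) / P (k t \<bullet> k t)" for t
  have kc: "continuous_on {a..b} k"
    using k'(1) by (meson continuous_on_eq_continuous_within has_vector_derivative_continuous)
  have "continuous_on {a..b} (\<lambda>t. P (k t \<bullet> k t))"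
  proof (rule continuous_on_compose2[of "{..<1}" P])
    show "continuous_on {..<1} P" by (rule continuous_P)
  qed (use B inner_less_1 in \<open>auto intro!: continuous_intros kc\<close>)
  then have "continuous_on {a..b} f" unfolding f_def
    using B P_inner_pos by (intro continuous_intros k'(2)) force+
  then have f: "f integrable_on {a..b}" by (rule integrable_continuous_real)
  have sf: "speed k t = f t" if "t \<in> {a..b} - {a, b}" for t
  proof -
    have "(k has_vector_derivative k' t) (at t)"
      using k'(1)[of t] that by (simp add: at_within_Icc_at)
    then show ?thesis by (simp add: speed_def f_def vector_derivative_at)
  qed
  show int: "speed k integrable_on {a..b}"
    by (rule integrable_spike_finite[OF _ _ f, of "{a, b}"]) (use sf in auto)
  have eq: "integral {a..b} (speed k) = integral {a..b} f"
    by (rule integral_spike[where S = "{a, b}"]) (use sf in auto)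
  fix h h' assume h: "\<And>x. x \<in> B \<Longrightarrow> (h has_derivative h' x) (at x)"
    and le: "\<And>x v. x \<in> B \<Longrightarrow> \<bar>h' x v\<bar> \<le> norm v / P (x \<bullet> x)"
  have "((\<lambda>t. h (k t)) has_vector_derivative h' (k t) (k' t)) (at t within {a..b})" if "t \<in> {a..b}" for t
    using vector_derivative_diff_chain_within[OF k'(1)[OF that] has_derivative_at_withinI[OF h[OF B[OF that]]]]
    by (simp add: o_def)
  then have I: "((\<lambda>t. h' (k t) (k' t)) has_integral h (k b) - h (k a)) {a..b}"
    using ab by (intro fundamental_theorem_of_calculus) auto
  have "norm (integral {a..b} (\<lambda>t. h' (k t) (k' t))) \<le> integral {a..b} f"
    by (rule integral_norm_bound_integral) (use I f le B in \<open>auto simp: f_def\<close>)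
  then show "\<bar>h (k b) - h (k a)\<bar> \<le> integral {a..b} (speed k)"
    using I eq by (simp add: integral_unique)
qed

text \<open>The second part bounds the variation of \<open>h\<close> along a curve by the length of the curve; the assumption
  says that the Riemannian gradient of \<open>h\<close> has norm at most \<open>1\<close>.\<close>

lemma speed_integrable:
  assumes "is_partition k m \<tau>" and B: "\<And>t. t \<in> {0..1} \<Longrightarrow> k t \<in> B"
  shows "speed k integrable_on {0..1}"
    and "\<And>h h'. (\<And>x. x \<in> B \<Longrightarrow> (h has_derivative h' x) (at x)) \<Longrightarrow>
       (\<And>x v. x \<in> B \<Longrightarrow> \<bar>h' x v\<bar> \<le> norm v / P (x \<bullet> x)) \<Longrightarrow>
       \<bar>h (k 1) - h (k 0)\<bar> \<le> integral {0..1} (speed k)"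
proof -
  note bd = is_partition_bounds[OF assms(1)]
  have \<tau>: "\<tau> 0 = 0" "\<tau> m = 1" using assms(1) by (auto simp: is_partition_def)
  have piece: "\<tau> i < \<tau> (Suc i)" "C1_piece (\<tau> i) (\<tau> (Suc i)) k" "\<And>t. t \<in> {\<tau> i..\<tau> (Suc i)} \<Longrightarrow> k t \<in> B" if "i < m" for i
  proof -
    show "\<tau> i < \<tau> (Suc i)" "C1_piece (\<tau> i) (\<tau> (Suc i)) k"
      using assms(1) that by (auto simp: is_partition_def)
    show "k t \<in> B" if "t \<in> {\<tau> i..\<tau> (Suc i)}" for t
      by (rule B) (use that \<open>i < m\<close> bd[of i] bd[of "Suc i"] in auto)
  qed
  have int: "speed k integrable_on {0..\<tau> i}" if "i \<le> m" for i
    using that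
  proof (induction i)
    case 0 then show ?case using integrable_on_refl[of "speed k" 0] by (simp add: \<tau>)
  next
    case (Suc i)
    then show ?case
      using Henstock_Kurzweil_Integration.integrable_combine[OF _ _ Suc.IH speed_piece(1)[OF piece[of i]]]
        bd[of i] piece(1)[of i] by simp
  qed
  show "speed k integrable_on {0..1}" using int[of m] \<tau> by simp
  fix h h' assume h: "\<And>x. x \<in> B \<Longrightarrow> (h has_derivative h' x) (at x)"
    and le: "\<And>x v. x \<in> B \<Longrightarrow> \<bar>h' x v\<bar> \<le> norm v / P (x \<bullet> x)"
  have "\<bar>h (k (\<tau> i)) - h (k 0)\<bar> \<le> integral {0..\<tau> i} (speed k)" if "i \<le> m" for i
    using that
  proof (induction i)
    case 0 then show ?case by (simp add: \<tau>)
  next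
    case (Suc i)
    then have i: "i < m" by simp
    have "integral {0..\<tau> i} (speed k) + integral {\<tau> i..\<tau> (Suc i)} (speed k) = integral {0..\<tau> (Suc i)} (speed k)"
      using bd[of i] piece(1)[OF i] i int[OF Suc.prems]
      by (intro Henstock_Kurzweil_Integration.integral_combine) auto
    moreover have "\<bar>h (k (\<tau> (Suc i))) - h (k (\<tau> i))\<bar> \<le> integral {\<tau> i..\<tau> (Suc i)} (speed k)"
      by (rule speed_piece(2)[OF piece[OF i] h le])
    ultimately show ?case using Suc.IH i by linarith
  qed
  from this[of m] show "\<bar>h (k 1) - h (k 0)\<bar> \<le> integral {0..1} (speed k)" by (simp add: \<tau>)
qed

lemma speed_affine:
  assumes part: "is_partition k m \<tau>" and B: "\<And>t. t \<in> {0..1} \<Longrightarrow> k t \<in> B"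
    and u: "u \<noteq> 0" and img: "(\<lambda>t. (1/u) *\<^sub>R t + - ((1/u) *\<^sub>R w)) ` {0..1} = {a..b}"
  shows "(speed (\<lambda>t. k (u * t + w)) has_integral integral {0..1} (speed k)) {a..b}"
proof -
  define I where "I = integral {0..1} (speed k)"
  have "(speed k has_integral I) (cbox 0 1)"
    using speed_integrable(1)[OF part B] by (simp add: I_def integrable_integral)
  from has_integral_affinity[OF this u, of w]
  have "((\<lambda>t. speed k (u * t + w)) has_integral (1 / \<bar>u\<bar>) *\<^sub>R I) {a..b}" using img by simp
  then have "((\<lambda>t. \<bar>u\<bar> * speed k (u * t + w)) has_integral \<bar>u\<bar> * ((1 / \<bar>u\<bar>) *\<^sub>R I)) {a..b}"
    by (rule has_integral_mult_right)
  then have I: "((\<lambda>t. \<bar>u\<bar> * speed k (u * t + w)) has_integral I) {a..b}" using u by simp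
  define S where "S = (\<lambda>s. (s - w) / u) ` (\<tau> ` {..m})"
  have "speed (\<lambda>t. k (u * t + w)) t = \<bar>u\<bar> * speed k (u * t + w)" if "t \<in> {a..b} - S" for t
  proof -
    have "t \<in> (\<lambda>t. (1/u) *\<^sub>R t + - ((1/u) *\<^sub>R w)) ` {0..1}" unfolding img using that by (rule DiffD1)
    then obtain s where s: "t = (1/u) *\<^sub>R s + - ((1/u) *\<^sub>R w)" "s \<in> {0..1}" by (rule imageE)
    then have us: "u * t + w = s" using u by (simp add: right_diff_distrib)
    then have "t = (s - w) / u" using u by (simp add: field_simps)
    then have "s \<notin> \<tau> ` {..m}" using that by (auto simp: S_def)
    then obtain v where v: "(k has_vector_derivative v) (at s)"
      using is_partition_differentiable[OF part s(2)] by blast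
    have "((\<lambda>t. u * t + w) has_vector_derivative u) (at t)"
      by (auto intro!: derivative_eq_intros simp: has_vector_derivative_def)
    from vector_diff_chain_at[OF this, of k v] v us
    have "((\<lambda>t. k (u * t + w)) has_vector_derivative u *\<^sub>R v) (at t)" by (simp add: o_def)
    then show ?thesis using v us by (simp add: speed_def vector_derivative_at)
  qed
  then show ?thesis unfolding I_def[symmetric]
    by (intro has_integral_spike_finite[OF _ _ I, of S]) (auto simp: S_def)
qed


definition curves :: "real^'n \<Rightarrow> real^'n \<Rightarrow> (real \<Rightarrow> real^'n) set" where
  "curves p q = {g. piecewise_C1_curve M g \<and> g 0 = p \<and> g 1 = q}"

lemma riemannian_dist_curves: "riemannian_dist M p q = (INF g\<in>curves p q. curve_length M g)"
  by (simp add: riemannian_dist_def curves_def)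

lemma curve_length_nonneg: "0 \<le> curve_length M g"
  unfolding curve_length_M
proof (cases "speed (\<Phi> \<circ> g) integrable_on {0..1}")
  case True
  then show "0 \<le> integral {0..1} (speed (\<Phi> \<circ> g))"
    by (rule integral_nonneg) (simp add: speed_nonneg)
qed (simp add: not_integrable_integral)

lemma reverse_curve:
  assumes "g \<in> curves p q" obtains g' where "g' \<in> curves q p" "curve_length M g' = curve_length M g"
proof
  obtain m \<tau> where part: "is_partition (\<Phi> \<circ> g) m \<tau>" and g: "continuous_on {0..1} g" "g 0 = p" "g 1 = q"
    using assms by (auto simp: curves_def piecewise_C1_curve_M)
  have eq: "\<Phi> \<circ> (\<lambda>t. g (1 - t)) = (\<lambda>t. (\<Phi> \<circ> g) (1 - t))" by auto
  have "continuous_on {0..1} (\<lambda>t. g (1 - t))"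
    by (rule continuous_on_compose2[OF g(1)]) (auto intro!: continuous_intros)
  moreover have "\<exists>m \<tau>. is_partition (\<Phi> \<circ> (\<lambda>t. g (1 - t))) m \<tau>"
    unfolding eq using is_partition_reverse[OF part] by blast
  ultimately show "(\<lambda>t. g (1 - t)) \<in> curves q p"
    using g by (simp add: curves_def piecewise_C1_curve_M)
  have "(\<lambda>t. (1/(-1)) *\<^sub>R t + - ((1/(-1)) *\<^sub>R 1)) ` {0..1} = {0..1::real}"
  proof -
    have "(\<lambda>t. (1/(-1)) *\<^sub>R t + - ((1/(-1)) *\<^sub>R 1)) = (\<lambda>t. 1 - t :: real)" by auto
    then show ?thesis by simp
  qed
  from speed_affine[OF part _ _ this]
  have "(speed (\<lambda>t. (\<Phi> \<circ> g) ((-1) * t + 1)) has_integral integral {0..1} (speed (\<Phi> \<circ> g))) {0..1}"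
    by simp
  then show "curve_length M (\<lambda>t. g (1 - t)) = curve_length M g"
    unfolding curve_length_M eq by (simp add: integral_unique)
qed

lemma join_curves:
  assumes "g \<in> curves p q" "l \<in> curves q r"
  obtains j where "j \<in> curves p r" "curve_length M j = curve_length M g + curve_length M l"
proof
  obtain m \<tau> where part: "is_partition (\<Phi> \<circ> g) m \<tau>" and g: "continuous_on {0..1} g" "g 0 = p" "g 1 = q"
    using assms by (auto simp: curves_def piecewise_C1_curve_M)
  obtain m' \<tau>' where part': "is_partition (\<Phi> \<circ> l) m' \<tau>'" and l: "continuous_on {0..1} l" "l 0 = q" "l 1 = r"
    using assms by (auto simp: curves_def piecewise_C1_curve_M)
  define j where "j t = (if t \<le> 1/2 then g (2 * t) else l (2 * t - 1))" for t
  have eq: "\<Phi> \<circ> j = (\<lambda>t. if t \<le> 1/2 then (\<Phi> \<circ> g) (2 * t) else (\<Phi> \<circ> l) (2 * t - 1))" by (auto simp: j_def)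
  have "j = g +++ l" by (auto simp: j_def joinpaths_def)
  moreover have "path (g +++ l)"
    using g l by (intro path_join_imp) (auto simp: path_def pathfinish_def pathstart_def)
  ultimately have "continuous_on {0..1} j" by (simp add: path_def)
  moreover have "\<exists>m \<tau>. is_partition (\<Phi> \<circ> j) m \<tau>"
    unfolding eq using is_partition_join[OF part part'] g l by auto
  ultimately show "j \<in> curves p r"
    using g l by (auto simp: curves_def piecewise_C1_curve_M j_def)
  have "(\<lambda>t. (1/2) *\<^sub>R t + - ((1/2) *\<^sub>R 0)) ` {0..1} = {0..1/2::real}" 
    using image_affinity_atLeastAtMost[of "1/2" 0 0 "1::real"] by simp
  from speed_affine[OF part _ _ this]
  have A: "(speed (\<lambda>t. (\<Phi> \<circ> g) (2 * t + 0)) has_integral curve_length M g) {0..1/2}"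
    by (simp add: curve_length_M)
  have "(\<lambda>t. (1/2) *\<^sub>R t + - ((1/2) *\<^sub>R (-1))) ` {0..1} = {1/2..1::real}" 
    using image_affinity_atLeastAtMost[of "1/2" "1/2" 0 "1::real"] by simp
  from speed_affine[OF part' _ _ this]
  have C: "(speed (\<lambda>t. (\<Phi> \<circ> l) (2 * t + (-1))) has_integral curve_length M l) {1/2..1}"
    by (simp add: curve_length_M)
  have loc: "speed k t = speed k' t" if "open S" "t \<in> S" "\<And>s. s \<in> S \<Longrightarrow> k s = k' s" for S k k' t
  proof -
    have "(k has_vector_derivative v) (at t) \<longleftrightarrow> (k' has_vector_derivative v) (at t)" for v
      using has_vector_derivative_transform_within_open[OF _ that(1,2), of k v k']
        has_vector_derivative_transform_within_open[OF _ that(1,2), of k' v k] that(3) by auto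
    then have "vector_derivative k (at t) = vector_derivative k' (at t)" by (simp add: vector_derivative_def)
    then show ?thesis using that by (simp add: speed_def)
  qed
  have "(speed (\<Phi> \<circ> j) has_integral curve_length M g) {0..1/2}"
  proof (rule has_integral_spike_finite[OF _ _ A, of "{1/2}"])
    fix t :: real assume "t \<in> {0..1/2} - {1/2}"
    then show "speed (\<Phi> \<circ> j) t = speed (\<lambda>t. (\<Phi> \<circ> g) (2 * t + 0)) t"
      by (intro loc[of "{..<1/2}"]) (auto simp: j_def)
  qed simp
  moreover have "(speed (\<Phi> \<circ> j) has_integral curve_length M l) {1/2..1}"
  proof (rule has_integral_spike_finite[OF _ _ C, of "{1/2}"])
    fix t :: real assume "t \<in> {1/2..1} - {1/2}"
    then show "speed (\<Phi> \<circ> j) t = speed (\<lambda>t. (\<Phi> \<circ> l) (2 * t + (-1))) t"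
      by (intro loc[of "{1/2<..}"]) (auto simp: j_def)
  qed simp
  ultimately have "(speed (\<Phi> \<circ> j) has_integral curve_length M g + curve_length M l) {0..1}"
    by (rule has_integral_combine[of 0 "1/2" 1, rotated 2]) auto
  then show "curve_length M j = curve_length M g + curve_length M l"
    by (simp add: curve_length_M integral_unique)
qed

lemma segment_curve:
  assumes K: "convex K" "K \<subseteq> B" "\<Phi> p \<in> K" "\<Phi> q \<in> K" and C: "\<And>x. x \<in> K \<Longrightarrow> inverse (P (x \<bullet> x)) \<le> C"
  obtains g where "g \<in> curves p q" "curve_length M g \<le> C * norm (\<Phi> q - \<Phi> p)"
proof
  define k where "k t = \<Phi> p + t *\<^sub>R (\<Phi> q - \<Phi> p)" for t :: real
  have kK: "k t \<in> K" if "t \<in> {0..1}" for t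
    using convexD_alt[OF K(1,3,4), of t] that by (simp add: k_def algebra_simps)
  then have kB: "k t \<in> B" if "t \<in> {0..1}" for t using K(2) that by blast
  define g where "g t = \<Psi> (k t)" for t
  have \<Phi>g: "(\<Phi> \<circ> g) t = k t" if "t \<in> {0..1}" for t using kB[OF that] by (simp add: g_def)
  have kc: "continuous_on S k" for S unfolding k_def by (intro continuous_intros)
  have kron: "(k has_vector_derivative (\<Phi> q - \<Phi> p)) (at t within S)" for t S
    unfolding k_def by (auto intro!: derivative_eq_intros simp: has_vector_derivative_def)
  have "C1_piece 0 1 k" unfolding C1_piece_def
    by (rule exI[of _ "\<lambda>_. \<Phi> q - \<Phi> p"]) (simp add: kron)
  then have "C1_piece 0 1 (\<Phi> \<circ> g)" using C1_piece_cong[of 0 1 "\<Phi> \<circ> g" k] \<Phi>g by blast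
  then have part: "is_partition (\<Phi> \<circ> g) 1 real" by (simp add: is_partition_def)
  moreover have "continuous_on {0..1} g"
    unfolding g_def by (rule continuous_on_compose2[OF cont_Psi kc]) (use kB in auto)
  ultimately show "g \<in> curves p q"
    by (auto simp: curves_def piecewise_C1_curve_M g_def k_def)
  define L where "L = norm (\<Phi> q - \<Phi> p)"
  have le: "speed (\<Phi> \<circ> g) t \<le> C * L" if "t \<in> {0..1} - {0, 1}" for t
  proof -
    have t: "t \<in> {0<..<1}" using that by auto
    have "(\<Phi> \<circ> g has_vector_derivative (\<Phi> q - \<Phi> p)) (at t)"
      by (rule has_vector_derivative_transform_within_open[OF kron open_greaterThanLessThan t])
         (use \<Phi>g in auto)
    then have "speed (\<Phi> \<circ> g) t = L * inverse (P (k t \<bullet> k t))"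
      using \<Phi>g[of t] t by (simp add: speed_def vector_derivative_at L_def divide_inverse)
    also have "\<dots> \<le> L * C" using C[OF kK] t by (intro mult_left_mono) (auto simp: L_def)
    finally show ?thesis by (simp add: mult.commute)
  qed
  have int: "speed (\<Phi> \<circ> g) integrable_on {0..1}" by (rule speed_integrable(1)[OF part]) simp
  \<comment> \<open>at the end points the two-sided velocity is arbitrary\<close>
  define s where "s t = (if t \<in> {0, 1} then C * L else speed (\<Phi> \<circ> g) t)" for t
  have "s integrable_on {0..1}"
    by (rule integrable_spike_finite[OF _ _ int, of "{0, 1}"]) (auto simp: s_def)
  then have "integral {0..1} s \<le> integral {0..1} (\<lambda>_::real. C * L)"
    by (intro integral_le) (use le in \<open>auto simp: s_def\<close>)
  moreover have "integral {0..1} (\<lambda>_::real. C * L) = C * L" by simp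
  moreover have "integral {0..1} (speed (\<Phi> \<circ> g)) = integral {0..1} s"
    by (rule integral_spike[of "{0, 1}"]) (auto simp: s_def)
  ultimately show "curve_length M g \<le> C * norm (\<Phi> q - \<Phi> p)"
    unfolding curve_length_M L_def by linarith
qed

text \<open>On a smaller concentric ball \<open>1 / P\<close> is bounded, which bounds the lengths of straight segments.\<close>

lemma dist_le_segment:
  assumes r: "0 \<le> r" "r < 1"
  obtains C where "0 < C" "\<And>p q. norm (\<Phi> p) \<le> r \<Longrightarrow> norm (\<Phi> q) \<le> r \<Longrightarrow>
    \<exists>g \<in> curves p q. curve_length M g \<le> C * norm (\<Phi> q - \<Phi> p)"
proof -
  have sub: "cball (0 :: real^'n) r \<subseteq> B" using r by auto
  have "continuous_on (cball (0 :: real^'n) r) (\<lambda>x. inverse (P (x \<bullet> x)))"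
  proof (intro continuous_intros)
    show "continuous_on (cball (0 :: real^'n) r) (\<lambda>x. P (x \<bullet> x))"
      by (rule continuous_on_subset[OF continuous_P_inner sub])
    show "\<forall>x\<in>cball (0 :: real^'n) r. P (x \<bullet> x) \<noteq> 0" using sub P_inner_pos by (metis less_irrefl subsetD)
  qed
  then have "bounded ((\<lambda>x. inverse (P (x \<bullet> x))) ` cball (0 :: real^'n) r)"
    by (intro compact_imp_bounded compact_continuous_image) auto
  then obtain C where C: "C > 0" "\<And>x. x \<in> cball (0 :: real^'n) r \<Longrightarrow> \<bar>inverse (P (x \<bullet> x))\<bar> \<le> C"
    unfolding bounded_pos by auto
  show ?thesis
  proof (rule that[OF C(1)])
    fix p q assume pq: "norm (\<Phi> p) \<le> r" "norm (\<Phi> q) \<le> r"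
    have "inverse (P (x \<bullet> x)) \<le> C" if "x \<in> cball 0 r" for x :: "real^'n" using C(2)[OF that] by linarith
    from segment_curve[OF convex_cball sub _ _ this, of p q] pq
    show "\<exists>g \<in> curves p q. curve_length M g \<le> C * norm (\<Phi> q - \<Phi> p)" by auto
  qed
qed

lemma curves_nonempty: "curves p q \<noteq> {}"
proof -
  define r where "r = max (norm (\<Phi> p)) (norm (\<Phi> q))"
  have "0 \<le> r" "r < 1" by (auto simp: r_def max_def)
  from dist_le_segment[OF this] show ?thesis unfolding r_def by (metis empty_iff max.cobounded1 max.cobounded2)
qed

lemma dist_le: "g \<in> curves p q \<Longrightarrow> riemannian_dist M p q \<le> curve_length M g"
  unfolding riemannian_dist_curves by (rule cINF_lower) (auto intro: bdd_belowI2 curve_length_nonneg)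

lemma dist_ge: "(\<And>g. g \<in> curves p q \<Longrightarrow> a \<le> curve_length M g) \<Longrightarrow> a \<le> riemannian_dist M p q"
  unfolding riemannian_dist_curves by (rule cINF_greatest[OF curves_nonempty])

text \<open>A function whose Riemannian gradient has norm at most \<open>1\<close> is \<open>1\<close>-Lipschitz for the distance.\<close>

lemma dist_lower:
  assumes "\<And>x. x \<in> B \<Longrightarrow> (h has_derivative h' x) (at x)"
    and "\<And>x v. x \<in> B \<Longrightarrow> \<bar>h' x v\<bar> \<le> norm v / P (x \<bullet> x)"
  shows "\<bar>h (\<Phi> q) - h (\<Phi> p)\<bar> \<le> riemannian_dist M p q"
proof (rule dist_ge)
  fix g assume "g \<in> curves p q"
  then obtain m \<tau> where part: "is_partition (\<Phi> \<circ> g) m \<tau>" and g: "g 0 = p" "g 1 = q"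
    by (auto simp: curves_def piecewise_C1_curve_M)
  have "\<bar>h ((\<Phi> \<circ> g) 1) - h ((\<Phi> \<circ> g) 0)\<bar> \<le> integral {0..1} (speed (\<Phi> \<circ> g))"
    by (rule speed_integrable(2)[OF part _ assms]) auto
  then show "\<bar>h (\<Phi> q) - h (\<Phi> p)\<bar> \<le> curve_length M g" by (simp add: curve_length_M g)
qed

end

locale ball_model_complete = ball_model P Q Q' \<Phi> \<Psi> for P Q Q' and \<Phi> \<Psi> :: "real^'n::finite \<Rightarrow> real^'n" +
  fixes a :: real
  assumes a_pos: "0 < a" and P_le: "\<And>q. 0 \<le> q \<Longrightarrow> q < 1 \<Longrightarrow> P q \<le> a * (1 - q)"
begin

lemma dist_ge_euclidean: "norm (\<Phi> q - \<Phi> p) \<le> a * riemannian_dist M p q"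
proof (cases "\<Phi> q = \<Phi> p")
  case True
  have "0 \<le> riemannian_dist M p q" by (rule dist_ge) (rule curve_length_nonneg)
  then show ?thesis using True a_pos by simp
next
  case False
  define N where "N = norm (\<Phi> q - \<Phi> p)"
  have N: "N > 0" using False by (simp add: N_def)
  define e where "e = (1 / (a * N)) *\<^sub>R (\<Phi> q - \<Phi> p)"
  have e: "norm e = 1 / a" using N a_pos by (simp add: e_def flip: N_def)
  have "\<bar>\<Phi> q \<bullet> e - \<Phi> p \<bullet> e\<bar> \<le> riemannian_dist M p q"
  proof (rule dist_lower)
    fix x :: "real^'n" assume x: "x \<in> B"
    show "((\<lambda>x. x \<bullet> e) has_derivative (\<lambda>v. v \<bullet> e)) (at x)"
      by (rule bounded_linear_imp_has_derivative[OF bounded_linear_inner_left])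
    fix v :: "real^'n"
    have "P (x \<bullet> x) \<le> a * (1 - x \<bullet> x)" using P_le[OF inner_ge_zero inner_less_1[OF x]] .
    also have "\<dots> \<le> a * 1" using a_pos by (intro mult_left_mono) auto
    finally have Pa: "P (x \<bullet> x) \<le> a" by simp
    have "\<bar>v \<bullet> e\<bar> \<le> norm v / a" using Cauchy_Schwarz_ineq2[of v e] e by simp
    also have "\<dots> \<le> norm v / P (x \<bullet> x)" using Pa P_inner_pos[OF x] by (intro divide_left_mono) auto
    finally show "\<bar>v \<bullet> e\<bar> \<le> norm v / P (x \<bullet> x)" .
  qed
  moreover have "\<Phi> q \<bullet> e - \<Phi> p \<bullet> e = N / a"
  proof -
    have "\<Phi> q \<bullet> e - \<Phi> p \<bullet> e = N\<^sup>2 / (a * N)"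
    proof -
      have "\<Phi> q \<bullet> e - \<Phi> p \<bullet> e = (\<Phi> q - \<Phi> p) \<bullet> e" by (rule inner_diff_left[symmetric])
      also have "\<dots> = N\<^sup>2 / (a * N)" unfolding e_def N_def inner_scaleR_right dot_square_norm by simp
      finally show ?thesis .
    qed
    then show ?thesis using N by (simp add: power2_eq_square)
  qed
  ultimately have "norm (\<Phi> q - \<Phi> p) / a \<le> riemannian_dist M p q" unfolding N_def by linarith
  then show ?thesis using a_pos by (simp add: divide_le_eq mult.commute)
qed

text \<open>This is where \<open>P(q) \<le> a (1 - q)\<close> puts the boundary at infinite distance.\<close>

lemma dist_ge_log:
  "\<bar>ln (1 - \<Phi> q \<bullet> \<Phi> q) - ln (1 - \<Phi> p \<bullet> \<Phi> p)\<bar> \<le> 2 * a * riemannian_dist M p q"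
proof -
  have "\<bar>ln (1 - \<Phi> q \<bullet> \<Phi> q) / (2 * a) - ln (1 - \<Phi> p \<bullet> \<Phi> p) / (2 * a)\<bar> \<le> riemannian_dist M p q"
  proof (rule dist_lower)
    fix x :: "real^'n" assume x: "x \<in> B"
    have q: "0 < 1 - x \<bullet> x" using inner_less_1[OF x] by simp
    have inner: "((\<lambda>x. x \<bullet> x) has_derivative (\<lambda>v. 2 * (x \<bullet> v))) (at x)"
      by (auto intro!: derivative_eq_intros simp: inner_commute)
    have "((\<lambda>q. ln (1 - q) / (2 * a)) has_real_derivative - (1 / (1 - x \<bullet> x)) / (2 * a)) (at (x \<bullet> x))"
      using q a_pos by (auto intro!: derivative_eq_intros)
    from DERIV_compose_FDERIV[OF this inner]
    show "((\<lambda>x. ln (1 - x \<bullet> x) / (2 * a)) has_derivative (\<lambda>v. 2 * (x \<bullet> v) * (- (1 / (1 - x \<bullet> x)) / (2 * a)))) (at x)" .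
    fix v :: "real^'n"
    have "\<bar>x \<bullet> v\<bar> \<le> norm x * norm v" by (rule Cauchy_Schwarz_ineq2)
    also have "\<dots> \<le> 1 * norm v" using x by (intro mult_right_mono) auto
    finally have xv: "\<bar>x \<bullet> v\<bar> \<le> norm v" by simp
    have "\<bar>2 * (x \<bullet> v) * (- (1 / (1 - x \<bullet> x)) / (2 * a))\<bar> = \<bar>x \<bullet> v\<bar> / (a * (1 - x \<bullet> x))"
      using q a_pos by (simp add: abs_mult abs_divide mult.commute)
    also have "\<dots> \<le> norm v / (a * (1 - x \<bullet> x))" using q a_pos xv by (intro divide_right_mono) auto
    also have "\<dots> \<le> norm v / P (x \<bullet> x)"
      using P_le[OF inner_ge_zero inner_less_1[OF x]] P_inner_pos[OF x] q a_pos
      by (intro divide_left_mono) auto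
    finally show "\<bar>2 * (x \<bullet> v) * (- (1 / (1 - x \<bullet> x)) / (2 * a))\<bar> \<le> norm v / P (x \<bullet> x)" .
  qed
  then have "\<bar>ln (1 - \<Phi> q \<bullet> \<Phi> q) - ln (1 - \<Phi> p \<bullet> \<Phi> p)\<bar> / (2 * a) \<le> riemannian_dist M p q"
    using a_pos by (simp add: abs_divide flip: diff_divide_distrib)
  then show ?thesis using a_pos by (simp add: divide_le_eq mult.commute)
qed

lemma Metric_space_M: "Metric_space UNIV (riemannian_dist M)"
proof
  fix p q r :: "real^'n"
  show nn: "0 \<le> riemannian_dist M p q" for p q by (rule dist_ge) (rule curve_length_nonneg)
  have le: "riemannian_dist M p q \<le> riemannian_dist M q p" for p q
    by (rule dist_ge) (metis reverse_curve dist_le)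
  show "riemannian_dist M p q = riemannian_dist M q p" by (intro antisym le)
  show "riemannian_dist M p q = 0 \<longleftrightarrow> p = q"
  proof
    assume "riemannian_dist M p q = 0"
    then have "\<Phi> q = \<Phi> p" using dist_ge_euclidean[of q p] by simp
    then show "p = q" by (metis Psi_Phi)
  next
    assume "p = q"
    moreover have "riemannian_dist M p p \<le> 0"
    proof -
      obtain C where "\<exists>g \<in> curves p p. curve_length M g \<le> C * norm (\<Phi> p - \<Phi> p)"
        using dist_le_segment[of "norm (\<Phi> p)"] by (metis norm_Phi norm_ge_zero order_refl)
      then show ?thesis using dist_le by fastforce
    qed
    ultimately show "riemannian_dist M p q = 0" using nn[of p p] by simp
  qed
  show "riemannian_dist M p r \<le> riemannian_dist M p q + riemannian_dist M q r"
  proof -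
    have *: "riemannian_dist M p r \<le> curve_length M g + curve_length M l" if "g \<in> curves p q" "l \<in> curves q r" for g l
      using join_curves[OF that] dist_le by metis
    have "riemannian_dist M p r - curve_length M g \<le> riemannian_dist M q r" if "g \<in> curves p q" for g
      by (rule dist_ge) (use *[OF that] in force)
    then have "riemannian_dist M p r - riemannian_dist M q r \<le> riemannian_dist M p q"
      by (intro dist_ge) force
    then show ?thesis by simp
  qed
qed

text \<open>Along a Cauchy sequence \<open>ln (1 - q)\<close> is bounded, so the sequence stays in a smaller concentric ball. It is
  Cauchy for the Euclidean distance as well, and on the smaller ball segments turn Euclidean convergence
  into convergence for the Riemannian distance.\<close>

lemma complete_M: "complete_riemannian_manifold M"
proof -
  interpret Metric_space UNIV "riemannian_dist M" by (rule Metric_space_M)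
  have "\<exists>x. limitin mtopology \<sigma> x sequentially" if \<sigma>: "MCauchy \<sigma>" for \<sigma>
  proof -
    have C: "\<exists>N. \<forall>n n'. N \<le> n \<longrightarrow> N \<le> n' \<longrightarrow> riemannian_dist M (\<sigma> n) (\<sigma> n') < \<epsilon>" if "\<epsilon> > 0" for \<epsilon>
      using \<sigma> that by (auto simp: MCauchy_def)
    define u where "u n = \<Phi> (\<sigma> n)" for n
    have "Cauchy u"
    proof (rule CauchyI)
      fix e :: real assume "e > 0"
      then obtain N where N: "\<And>n n'. N \<le> n \<Longrightarrow> N \<le> n' \<Longrightarrow> riemannian_dist M (\<sigma> n) (\<sigma> n') < e / a"
        using C[of "e / a"] a_pos by auto
      have "norm (u m - u n) < e" if "m \<ge> N" "n \<ge> N" for m n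
      proof -
        have "norm (u m - u n) \<le> a * riemannian_dist M (\<sigma> n) (\<sigma> m)"
          using dist_ge_euclidean[of "\<sigma> m" "\<sigma> n"] by (simp add: u_def)
        also have "\<dots> < a * (e / a)" using N[OF that(2,1)] a_pos by (intro mult_strict_left_mono)
        finally show ?thesis using a_pos by simp
      qed
      then show "\<exists>M. \<forall>m\<ge>M. \<forall>n\<ge>M. norm (u m - u n) < e" by blast
    qed
    then obtain x where x: "u \<longlonglongrightarrow> x" using Cauchy_convergent convergent_def by blast
    obtain N where N: "\<And>n n'. N \<le> n \<Longrightarrow> N \<le> n' \<Longrightarrow> riemannian_dist M (\<sigma> n) (\<sigma> n') < 1"
      using C[of 1] by auto
    \<comment> \<open>a lower bound for \<open>1 - q\<close> along the tail of the sequence\<close>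
    define \<delta> where "\<delta> = exp (ln (1 - u N \<bullet> u N) - 2 * a)"
    have \<delta>: "\<delta> \<le> 1 - u n \<bullet> u n" if "n \<ge> N" for n
    proof -
      have pos: "0 < 1 - u k \<bullet> u k" for k using inner_less_1[OF Phi_in] by (simp add: u_def)
      have "2 * a * riemannian_dist M (\<sigma> N) (\<sigma> n) \<le> 2 * a * 1"
        using N[OF order_refl that] a_pos by (intro mult_left_mono) auto
      then have "ln (1 - u N \<bullet> u N) - 2 * a \<le> ln (1 - u n \<bullet> u n)"
        using dist_ge_log[of "\<sigma> n" "\<sigma> N"] unfolding u_def by linarith
      then show ?thesis unfolding \<delta>_def using pos[of n] by (simp add: ln_ge_iff)
    qed
    have "\<delta> > 0" by (simp add: \<delta>_def)
    define r where "r = sqrt (1 - \<delta>)"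
    have "\<delta> \<le> 1" using \<delta>[of N] inner_ge_zero[of "u N"] by linarith
    then have r: "0 \<le> r" "r < 1" using \<open>\<delta> > 0\<close> by (auto simp: r_def)
    have ur: "norm (u n) \<le> r" if "n \<ge> N" for n
      using \<delta>[OF that] unfolding r_def by (intro real_le_rsqrt) (simp add: dot_square_norm)
    have xr: "norm x \<le> r"
      by (rule Lim_norm_ubound[OF _ x]) (use ur in \<open>auto simp: eventually_sequentially\<close>)
    then have xB: "x \<in> B" using r by simp
    obtain K where "0 < K" and K: "\<And>p q. norm (\<Phi> p) \<le> r \<Longrightarrow> norm (\<Phi> q) \<le> r \<Longrightarrow>
      \<exists>g \<in> curves p q. curve_length M g \<le> K * norm (\<Phi> q - \<Phi> p)"
      by (rule dist_le_segment[OF r]) (rule that)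
    have dK: "riemannian_dist M (\<sigma> n) (\<Psi> x) \<le> K * norm (x - u n)" if "n \<ge> N" for n
    proof -
      have "norm (\<Phi> (\<sigma> n)) \<le> r" "norm (\<Phi> (\<Psi> x)) \<le> r"
        using ur[OF that] xr Phi_Psi[OF xB] by (simp_all add: u_def)
      from K[OF this] obtain g where g: "g \<in> curves (\<sigma> n) (\<Psi> x)"
        "curve_length M g \<le> K * norm (\<Phi> (\<Psi> x) - \<Phi> (\<sigma> n))" by blast
      show ?thesis using dist_le[OF g(1)] g(2) by (simp only: Phi_Psi[OF xB] u_def)
    qed
    have K0: "(\<lambda>n. K * norm (x - u n)) \<longlonglongrightarrow> 0"
      using tendsto_mult_right_zero[OF tendsto_norm_zero[OF tendsto_diff[OF tendsto_const[of x] x, unfolded diff_self]], of K] .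
    have "\<forall>\<^sub>F n in sequentially. norm (riemannian_dist M (\<sigma> n) (\<Psi> x)) \<le> K * norm (x - u n)"
      using eventually_ge_at_top[of N] by eventually_elim (simp add: dK)
    from Lim_null_comparison[OF this K0]
    have "(\<lambda>n. riemannian_dist M (\<sigma> n) (\<Psi> x)) \<longlonglongrightarrow> 0" .
    then have "limitin mtopology \<sigma> (\<Psi> x) sequentially"
      unfolding limitin_metric_dist_null by simp
    then show ?thesis ..
  qed
  then have "mcomplete" unfolding mcomplete_def by blast
  then show ?thesis
    unfolding complete_riemannian_manifold_def mtop_M topspace_euclidean
    using riemannian_manifold_M by blast
qed

end

section \<open>The sawtooth profile\<close>

text \<open>This is \<open>S(t) - t\<close>, reduced modulo \<open>\<pi>\<close>, where \<open>S(t)\<close> is the argument of \<open>e cos t + i sin t\<close>. For small \<open>e\<close>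
  the function \<open>S\<close> is a staircase that climbs by \<open>\<pi>\<close> near each zero of \<open>sin\<close> and is nearly constant elsewhere.\<close>

definition saw :: "real \<Rightarrow> real \<Rightarrow> real" where
  "saw e t = arctan ((1 - e) * sin t * cos t / ((sin t)\<^sup>2 + e * (cos t)\<^sup>2))"

lemma sin_cos_denom_pos:
  fixes e t :: real
  assumes "0 < e" shows "0 < (sin t)\<^sup>2 + e * (cos t)\<^sup>2"
proof (cases "cos t = 0")
  case True
  then show ?thesis using sin_cos_squared_add[of t] by simp
next
  case False
  then show ?thesis using assms by (simp add: add_nonneg_pos)
qed

text \<open>The derivative of \<open>arctan\<close> collapses because
  \<open>(s\<^sup>2 + e c\<^sup>2)\<^sup>2 + ((1 - e) s c)\<^sup>2 = (s\<^sup>2 + c\<^sup>2) (s\<^sup>2 + e\<^sup>2 c\<^sup>2)\<close>. For constant \<open>e\<close> and \<open>t' = 1\<close> it is \<open>-1\<close> plus the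
  Poisson kernel \<open>e / (s\<^sup>2 + e\<^sup>2 c\<^sup>2)\<close>.\<close>

lemma has_real_derivative_saw:
  assumes e: "(e has_real_derivative e') (at q)" and t: "(t has_real_derivative t') (at q)" and pos: "0 < e q"
  shows "((\<lambda>q. saw (e q) (t q)) has_real_derivative
    - t' + (e q * t' - e' * sin (t q) * cos (t q)) / ((sin (t q))\<^sup>2 + (e q)\<^sup>2 * (cos (t q))\<^sup>2)) (at q)"
proof -
  define s c E where "s = sin (t q)" and "c = cos (t q)" and "E = e q"
  have sc: "s\<^sup>2 + c\<^sup>2 = 1" by (simp add: s_def c_def)
  define D where "D = s\<^sup>2 + E * c\<^sup>2"
  define D2 where "D2 = s\<^sup>2 + E\<^sup>2 * c\<^sup>2"
  have D: "D > 0" "D2 > 0" unfolding D_def D2_def s_def c_def E_def using pos by (auto intro!: sin_cos_denom_pos)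
  define num where "num = ((- e') * s * c + (1 - E) * (c\<^sup>2 - s\<^sup>2) * t') * D
      - (1 - E) * s * c * (2 * s * c * t' + e' * c\<^sup>2 - 2 * E * s * c * t')"
  have sin: "((\<lambda>q. sin (t q)) has_real_derivative c * t') (at q)"
    and cos: "((\<lambda>q. cos (t q)) has_real_derivative - s * t') (at q)"
    unfolding s_def c_def by (auto intro!: derivative_eq_intros t)
  have "((\<lambda>q. (1 - e q) * sin (t q) * cos (t q)) has_real_derivative
       (- e') * s * c + (1 - E) * (c\<^sup>2 - s\<^sup>2) * t') (at q)"
    by (rule DERIV_cong[OF DERIV_mult[OF DERIV_mult[OF DERIV_diff[OF DERIV_const e] sin] cos]])
       (simp add: E_def algebra_simps power2_eq_square flip: s_def c_def)
  moreover have "((\<lambda>q. (sin (t q))\<^sup>2 + e q * (cos (t q))\<^sup>2) has_real_derivative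
       2 * s * c * t' + e' * c\<^sup>2 - 2 * E * s * c * t') (at q)"
    by (rule DERIV_cong[OF DERIV_add[OF DERIV_power[OF sin] DERIV_mult[OF e DERIV_power[OF cos]]]])
       (simp add: E_def algebra_simps power2_eq_square flip: s_def c_def)
  ultimately have "((\<lambda>q. (1 - e q) * sin (t q) * cos (t q) / ((sin (t q))\<^sup>2 + e q * (cos (t q))\<^sup>2))
      has_real_derivative (((- e') * s * c + (1 - E) * (c\<^sup>2 - s\<^sup>2) * t') * ((sin (t q))\<^sup>2 + e q * (cos (t q))\<^sup>2)
        - (1 - e q) * sin (t q) * cos (t q) * (2 * s * c * t' + e' * c\<^sup>2 - 2 * E * s * c * t'))
      / (((sin (t q))\<^sup>2 + e q * (cos (t q))\<^sup>2) * ((sin (t q))\<^sup>2 + e q * (cos (t q))\<^sup>2))) (at q)"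
    by (rule DERIV_divide) (use sin_cos_denom_pos[OF pos, of "t q"] in linarith)
  then have "((\<lambda>q. (1 - e q) * sin (t q) * cos (t q) / ((sin (t q))\<^sup>2 + e q * (cos (t q))\<^sup>2))
      has_real_derivative num / (D * D)) (at q)"
    unfolding num_def D_def by (simp only: s_def c_def E_def)
  from DERIV_chain2[OF DERIV_arctan this]
  have "((\<lambda>q. saw (e q) (t q)) has_real_derivative
     inverse (1 + ((1 - E) * s * c / D)\<^sup>2) * (num / (D * D))) (at q)"
    unfolding saw_def D_def by (simp only: s_def c_def E_def)
  also have "inverse (1 + ((1 - E) * s * c / D)\<^sup>2) = D\<^sup>2 / (D\<^sup>2 + ((1 - E) * s * c)\<^sup>2)"
  proof -
    have "1 + (y / D)\<^sup>2 = (D\<^sup>2 + y\<^sup>2) / D\<^sup>2" for y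
      using D(1) by (simp add: power_divide add_divide_distrib)
    then show ?thesis by simp
  qed
  also have "D\<^sup>2 + ((1 - E) * s * c)\<^sup>2 = (s\<^sup>2 + c\<^sup>2) * D2"
    unfolding D_def D2_def by (simp add: power2_eq_square algebra_simps)
  also have "num = - (s\<^sup>2 + c\<^sup>2) * (e' * s * c) + t' * (E * (s\<^sup>2 + c\<^sup>2)\<^sup>2 - D2 * (s\<^sup>2 + c\<^sup>2))"
    unfolding num_def D_def D2_def by (simp add: power2_eq_square algebra_simps)
  also have "D\<^sup>2 / ((s\<^sup>2 + c\<^sup>2) * D2) * ((- (s\<^sup>2 + c\<^sup>2) * (e' * s * c) + t' * (E * (s\<^sup>2 + c\<^sup>2)\<^sup>2 - D2 * (s\<^sup>2 + c\<^sup>2))) / (D * D))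
     = - t' + (E * t' - e' * s * c) / D2"
    unfolding sc using D by (simp add: power2_eq_square[of D] diff_divide_distrib right_diff_distrib)
  finally show ?thesis by (simp only: D2_def s_def c_def E_def)
qed

lemma abs_saw_less: "\<bar>saw e t\<bar> < pi / 2"
  unfolding saw_def using arctan_bounded[of "(1 - e) * sin t * cos t / ((sin t)\<^sup>2 + e * (cos t)\<^sup>2)"] by linarith

locale saw_profile =
  fixes nu :: real and N :: nat
  assumes nu: "nu > 0"
begin

text \<open>Far out, the phase is comparable to the distance from the centre; \<open>width\<close> is the width of the
  jumps, which shrink towards the boundary, and \<open>spike\<close> the slope of the staircase, measured in the phase.\<close>

definition phase :: "real \<Rightarrow> real" where "phase q = - nu * ln (1 - q)"
definition width :: "real \<Rightarrow> real" where "width q = (1 - q) ^ N"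
definition Q :: "real \<Rightarrow> real" where "Q q = (3 + saw (width q) (phase q)) / 2"
definition P :: "real \<Rightarrow> real" where "P q = integral {q..1} Q"
definition spike :: "real \<Rightarrow> real" where
  "spike q = width q * (1 + real N / nu * sin (phase q) * cos (phase q)) / ((sin (phase q))\<^sup>2 + (width q)\<^sup>2 * (cos (phase q))\<^sup>2)"
definition Q' :: "real \<Rightarrow> real" where "Q' q = nu * (spike q - 1) / (2 * (1 - q))"

lemma Q_bounds: "(3 - pi / 2) / 2 \<le> Q q" "Q q \<le> 5 / 2"
  using abs_saw_less[of "width q" "phase q"] pi_less_4 unfolding Q_def by (auto simp: abs_less_iff field_simps)

lemma Q_has_derivative:
  assumes "q < 1" shows "(Q has_real_derivative Q' q) (at q)"
proof -
  have width: "width q > 0" using assms by (simp add: width_def)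
  have t: "(phase has_real_derivative nu / (1 - q)) (at q)"
    unfolding phase_def using assms by (auto intro!: derivative_eq_intros simp: field_simps)
  have e: "(width has_real_derivative - real N * width q / (1 - q)) (at q)"
  proof -
    have "(width has_real_derivative real N * (1 - q) ^ (N - 1) * (0 - 1)) (at q)"
      unfolding width_def
      by (rule DERIV_cong[OF DERIV_power[OF DERIV_diff[OF DERIV_const DERIV_ident]]]) simp
    also have "real N * (1 - q) ^ (N - 1) * (0 - 1) = - real N * width q / (1 - q)"
    proof (cases N)
      case (Suc m)
      have "width q / (1 - q) = (1 - q) ^ m"
        unfolding width_def using assms by (simp add: Suc)
      then have "- real N * width q / (1 - q) = - real N * (1 - q) ^ m" by (metis times_divide_eq_right)
      then show ?thesis by (simp add: Suc algebra_simps)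
    qed simp
    finally show ?thesis .
  qed
  define D where "D = (sin (phase q))\<^sup>2 + (width q)\<^sup>2 * (cos (phase q))\<^sup>2"
  have *: "width q * (nu / (1 - q)) - (- real N * width q / (1 - q)) * sin (phase q) * cos (phase q)
     = nu / (1 - q) * (width q * (1 + real N / nu * sin (phase q) * cos (phase q)))"
  proof -
    have "nu / (1 - q) * (width q * (1 + real N / nu * sin (phase q) * cos (phase q)))
      = nu / (1 - q) * width q + (nu * (real N / nu)) / (1 - q) * width q * sin (phase q) * cos (phase q)"
      by (simp only: divide_inverse ring_distribs mult_ac mult_1_right)
    also have "nu * (real N / nu) = real N" using nu by simp
    finally show ?thesis by (simp add: divide_inverse mult_ac)
  qed
  have "(Q has_real_derivative (0 + (- (nu / (1 - q)) +
      (width q * (nu / (1 - q)) - (- real N * width q / (1 - q)) * sin (phase q) * cos (phase q)) / D)) / 2) (at q)"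
    unfolding Q_def[abs_def] D_def
    by (rule DERIV_cdivide[OF DERIV_add[OF DERIV_const has_real_derivative_saw[OF e t width]]])
  also have "(0 + (- (nu / (1 - q)) +
      (width q * (nu / (1 - q)) - (- real N * width q / (1 - q)) * sin (phase q) * cos (phase q)) / D)) / 2
      = (nu / (1 - q)) * (spike q - 1) / 2"
    unfolding * spike_def D_def[symmetric] by (simp add: right_diff_distrib)
  also have "\<dots> = Q' q" by (simp add: Q'_def)
  finally show ?thesis .
qed

lemma Q_measurable: "Q \<in> borel_measurable borel"
proof -
  have [measurable]: "phase \<in> borel_measurable borel" "width \<in> borel_measurable borel"
    unfolding phase_def[abs_def] width_def[abs_def] by simp_all
  have [measurable]: "(sin :: real \<Rightarrow> real) \<in> borel_measurable borel" "(cos :: real \<Rightarrow> real) \<in> borel_measurable borel"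
    "arctan \<in> borel_measurable borel"
    by (auto intro!: borel_measurable_continuous_onI continuous_intros)
  show ?thesis unfolding Q_def[abs_def] saw_def by measurable
qed

text \<open>\<open>Q\<close> oscillates without a limit at \<open>1\<close>, so continuity does not help on intervals that reach \<open>1\<close>; boundedness
  and measurability do.\<close>

lemma Q_integrable: "Q integrable_on {a..b}"
proof -
  have "set_integrable lborel {a..b} Q"
    unfolding set_integrable_def
  proof (rule integrableI_bounded_set[where A = "{a..b}" and B = "5/2"])
    show "AE x in lborel. x \<in> {a..b} \<longrightarrow> norm (indicat_real {a..b} x *\<^sub>R Q x) \<le> 5/2"
    proof (intro AE_I2 impI)
      fix x assume "x \<in> {a..b}"
      have "0 \<le> Q x" using Q_bounds(1)[of x] pi_less_4 by simp
      then show "norm (indicat_real {a..b} x *\<^sub>R Q x) \<le> 5/2"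
        using Q_bounds(2)[of x] by (simp add: indicator_def)
    qed
    show "(\<lambda>x. indicat_real {a..b} x *\<^sub>R Q x) \<in> borel_measurable lborel"
      using Q_measurable by simp
    show "emeasure lborel {a..b} < \<infinity>" by (simp add: emeasure_lborel_Icc_eq)
  qed simp_all
  then show ?thesis by (rule set_borel_integral_eq_integral)
qed

lemma P_bounds:
  assumes "q \<le> 1"
  shows "(3 - pi / 2) / 2 * (1 - q) \<le> P q" "P q \<le> 5 / 2 * (1 - q)"
proof -
  have "integral {q..1} (\<lambda>_. (3 - pi / 2) / 2) \<le> P q"
    unfolding P_def by (rule integral_le) (auto intro!: Q_integrable Q_bounds simp del: le_divide_eq_numeral1 divide_le_eq_numeral1)
  then show "(3 - pi / 2) / 2 * (1 - q) \<le> P q" using assms by (simp add: mult.commute)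
  have "P q \<le> integral {q..1} (\<lambda>_. 5 / 2)"
    unfolding P_def by (rule integral_le) (auto intro!: Q_integrable Q_bounds simp del: le_divide_eq_numeral1 divide_le_eq_numeral1)
  then show "P q \<le> 5 / 2 * (1 - q)" using assms by (simp add: mult.commute)
qed

lemma P_has_derivative:
  assumes "q < 1" shows "(P has_real_derivative - Q q) (at q)"
proof -
  define a b where "a = q - 1" and "b = (q + 1) / 2"
  have ab: "a < q" "q < b" "b < 1" using assms by (auto simp: a_def b_def)
  have "continuous_on {a..b} Q"
    using ab by (intro continuous_at_imp_continuous_on ballI DERIV_isCont[OF Q_has_derivative]) auto
  then have "((\<lambda>u. integral {a..u} Q) has_real_derivative Q q) (at q within {a..b})"
    by (rule integral_has_real_derivative) (use ab in auto)
  then have "((\<lambda>u. integral {a..u} Q) has_real_derivative Q q) (at q)"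
    using ab by (simp add: at_within_Icc_at)
  then have "((\<lambda>u. integral {a..1} Q - integral {a..u} Q) has_real_derivative - Q q) (at q)"
    by (auto intro!: derivative_eq_intros)
  then show ?thesis
  proof (rule has_field_derivative_transform_within_open[where S = "{a<..<b}"])
    fix u assume "u \<in> {a<..<b}"
    then show "integral {a..1} Q - integral {a..u} Q = P u"
      using Henstock_Kurzweil_Integration.integral_combine[OF _ _ Q_integrable, of a u 1] ab by (simp add: P_def)
  qed (use ab in auto)
qed

lemma smooth_one_minus: "smooth_on {..<1} (\<lambda>q. 1 - q :: real)"
  using smooth_on_add[OF _ smooth_on_const smooth_on_linear[OF _ bounded_linear_minus[OF bounded_linear_ident]], of "{..<1::real}" 1]
  by simp

lemma smooth_phase: "smooth_on {..<1} phase"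
proof -
  have "smooth_on {..<1} (\<lambda>q. ln (1 - q) :: real)"
    by (rule smooth_on_compose[OF _ _ _ smooth_on_ln smooth_one_minus]) auto
  from smooth_on_mult[OF _ smooth_on_const this, of "- nu"] show ?thesis
    unfolding phase_def[abs_def] by simp
qed

lemma smooth_Q: "smooth_on {..<1} Q"
proof -
  have width: "smooth_on {..<1} width"
    using smooth_on_power[OF _ smooth_one_minus, of N] unfolding width_def[abs_def] by simp
  have eps': "smooth_on {..<1} (\<lambda>q. 1 + (-1) * width q)"
    by (rule smooth_on_add[OF _ smooth_on_const smooth_on_mult[OF _ smooth_on_const width]]) auto
  have sin: "smooth_on {..<1} (\<lambda>q. sin (phase q))"
    by (rule smooth_on_compose[OF _ _ _ smooth_on_sin_cos(1)[OF open_UNIV] smooth_phase]) auto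
  have cos: "smooth_on {..<1} (\<lambda>q. cos (phase q))"
    by (rule smooth_on_compose[OF _ _ _ smooth_on_sin_cos(2)[OF open_UNIV] smooth_phase]) auto
  have num: "smooth_on {..<1} (\<lambda>q. (1 + (-1) * width q) * sin (phase q) * cos (phase q))"
    by (rule smooth_on_mult[OF _ smooth_on_mult[OF _ eps' sin] cos]) simp_all
  have den: "smooth_on {..<1} (\<lambda>q. (sin (phase q))\<^sup>2 + width q * (cos (phase q))\<^sup>2)"
    by (rule smooth_on_add[OF _ smooth_on_power[OF _ sin] smooth_on_mult[OF _ width smooth_on_power[OF _ cos]]]) simp_all
  have "(sin (phase q))\<^sup>2 + width q * (cos (phase q))\<^sup>2 \<noteq> 0" if "q < 1" for q
    using sin_cos_denom_pos[of "width q" "phase q"] that by (simp add: width_def)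
  then have quot: "smooth_on {..<1} (\<lambda>q. ((1 + (-1) * width q) * sin (phase q) * cos (phase q)) *
       inverse ((sin (phase q))\<^sup>2 + width q * (cos (phase q))\<^sup>2))"
    by (intro smooth_on_mult[OF _ num] smooth_on_inverse[OF _ den]) simp_all
  have "smooth_on {..<1} (\<lambda>q. arctan (((1 + (-1) * width q) * sin (phase q) * cos (phase q)) *
       inverse ((sin (phase q))\<^sup>2 + width q * (cos (phase q))\<^sup>2)))"
    by (rule smooth_on_compose[OF _ _ _ smooth_on_arctan quot]) auto
  then have saw: "smooth_on {..<1} (\<lambda>q. saw (width q) (phase q))"
    unfolding saw_def divide_inverse by simp
  have "smooth_on {..<1} (\<lambda>q. (3 + saw (width q) (phase q)) * inverse 2)"
    by (rule smooth_on_mult[OF _ smooth_on_add[OF _ smooth_on_const saw] smooth_on_const]) auto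
  then show ?thesis unfolding Q_def[abs_def] divide_inverse .
qed

lemma smooth_P: "smooth_on {..<1} P"
proof (rule smooth_on_real_deriv)
  show "smooth_on {..<1} (\<lambda>q. - Q q)"
    using smooth_on_mult[OF _ smooth_on_const smooth_Q, of "-1"] by simp
qed (simp_all add: P_has_derivative)

end

section \<open>Integrals of negative powers of the sine over the ball\<close>

text \<open>The value \<open>top\<close> at the zeros of \<open>sin\<close> makes upper bounds by this weight valid everywhere and not only almost
  everywhere.\<close>

definition sin_weight :: "real \<Rightarrow> real \<Rightarrow> ennreal" where
  "sin_weight s t = (if sin t = 0 then top else ennreal (\<bar>sin t\<bar> powr (- 2 * s)))"

lemma sin_weight_measurable [measurable]: "sin_weight s \<in> borel_measurable borel"
proof -
  have [measurable]: "(sin :: real \<Rightarrow> real) \<in> borel_measurable borel"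
    by (auto intro!: borel_measurable_continuous_onI continuous_intros)
  show ?thesis unfolding sin_weight_def[abs_def] by measurable
qed

lemma sin_weight_periodic: "sin_weight s (t + real k * pi) = sin_weight s t"
proof -
  have "sin (t + real k * pi) = sin t * cos (real k * pi)"
    using sin_npi[of k] by (simp add: sin_add)
  moreover have "\<bar>cos (real k * pi)\<bar> = 1" using cos_npi[of k] by simp
  ultimately have "\<bar>sin (t + real k * pi)\<bar> = \<bar>sin t\<bar>" by (simp add: abs_mult)
  then show ?thesis unfolding sin_weight_def by (metis abs_eq_0)
qed

lemma sin_weight_even: "sin_weight s (- t) = sin_weight s t"
  by (simp add: sin_weight_def)

text \<open>The mean value theorem gives \<open>sin (t/2) \<ge> (t/2) cos (t/2)\<close>, hence \<open>sin t \<ge> t cos\<^sup>2 (t/2) = t (1 + cos t) / 2\<close>.\<close>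

lemma sin_ge_half:
  assumes "0 \<le> t" "t \<le> pi / 2" shows "t / 2 \<le> sin t"
proof (cases "t = 0")
  case False
  then have t: "0 < t / 2" using assms by simp
  then obtain z where z: "0 < z" "z < t / 2" "sin (t / 2) - sin 0 = (t / 2 - 0) * cos z"
    using MVT2[of 0 "t / 2" sin cos] DERIV_sin by blast
  define C where "C = cos (t / 2)"
  have C: "0 \<le> C" using assms by (auto simp: C_def intro!: cos_ge_zero)
  have "C \<le> cos z" unfolding C_def using z assms by (intro cos_monotone_0_pi_le) auto
  then have "t / 2 * C \<le> sin (t / 2)" using z(3) t by simp
  then have "t * C * C \<le> 2 * sin (t / 2) * C"
    using mult_right_mono[of "t / 2 * C" "sin (t / 2)" "2 * C"] C by (simp add: mult_ac)
  also have "\<dots> = sin t" using sin_double[of "t / 2"] by (simp add: C_def)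
  finally have "t * C\<^sup>2 \<le> sin t" by (simp add: power2_eq_square mult_ac)
  moreover have "1 / 2 \<le> C\<^sup>2"
  proof -
    have "0 \<le> cos t" using assms by (intro cos_ge_zero) auto
    then show ?thesis using cos_double_cos[of "t / 2"] by (simp add: C_def)
  qed
  then have "t * (1 / 2) \<le> t * C\<^sup>2" using assms(1) by (rule mult_left_mono)
  ultimately show ?thesis by simp
qed simp

text \<open>The weight is at most \<open>|t/2|\<^sup>-\<^sup>2\<^sup>s\<close> near \<open>0\<close>, which is integrable exactly because \<open>s < 1/2\<close>.\<close>

lemma nn_integral_sin_weight_period:
  assumes "s < 1/2" "0 \<le> s"
  shows "(\<integral>\<^sup>+ t. indicator {- (pi/2)..pi/2} t * sin_weight s t \<partial>lborel) < \<infinity>"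
proof -
  define f :: "real \<Rightarrow> real" where "f t = (if t \<in> {0..pi/2} then (1/2) powr (- 2 * s) * t powr (- 2 * s) else 0)" for t
  have "((\<lambda>t. t powr (- 2 * s)) has_integral ((pi/2) powr (- 2 * s + 1) / (- 2 * s + 1))) {0..pi/2}"
    by (rule has_integral_powr_from_0) (use assms in auto)
  then have "((\<lambda>t. (1/2) powr (- 2 * s) * t powr (- 2 * s)) has_integral
      (1/2) powr (- 2 * s) * ((pi/2) powr (- 2 * s + 1) / (- 2 * s + 1))) {0..pi/2}"
    by (rule has_integral_mult_right)
  then have "(f has_integral (1/2) powr (- 2 * s) * ((pi/2) powr (- 2 * s + 1) / (- 2 * s + 1))) UNIV"
    unfolding f_def has_integral_restrict_UNIV .
  moreover have [measurable]: "f \<in> borel_measurable borel" unfolding f_def by measurable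
  ultimately have I: "(\<integral>\<^sup>+ t. ennreal (f t) \<partial>lborel) < \<infinity>"
    by (subst nn_integral_has_integral_lborel) (auto simp: f_def)
  have bound: "sin_weight s t \<le> ennreal (f t)" if "0 < t" "t \<le> pi / 2" for t
  proof -
    have le: "t / 2 \<le> sin t" using sin_ge_half that by simp
    then have pos: "sin t > 0" using that by simp
    have "\<bar>sin t\<bar> powr (- 2 * s) \<le> (t / 2) powr (- 2 * s)"
      using le pos that assms by (intro powr_mono2') auto
    also have "\<dots> = f t" using that by (simp add: f_def powr_mult[symmetric])
    finally show ?thesis using pos by (simp add: sin_weight_def ennreal_leI)
  qed
  have "(\<integral>\<^sup>+ t. indicator {- (pi/2)..pi/2} t * sin_weight s t \<partial>lborel)
     \<le> (\<integral>\<^sup>+ t. ennreal (f t) + ennreal (f (- t)) \<partial>lborel)"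
  proof (rule nn_integral_mono_AE)
    have "AE t in lborel. t \<noteq> (0::real)" by (rule AE_lborel_singleton)
    then show "AE t in lborel. indicator {- (pi/2)..pi/2} t * sin_weight s t \<le> ennreal (f t) + ennreal (f (- t))"
    proof eventually_elim
      case (elim t)
      consider "t > 0" "t \<le> pi / 2" | "t < 0" "- t \<le> pi / 2" | "t \<notin> {- (pi/2)..pi/2}" using elim by force
      then show ?case
      proof cases
        case 1
        then show ?thesis using bound[of t] by (simp add: add_increasing2)
      next
        case 2
        then show ?thesis using bound[of "- t"] by (simp add: sin_weight_even add_increasing)
      qed auto
    qed
  qed
  also have "\<dots> = (\<integral>\<^sup>+ t. ennreal (f t) \<partial>lborel) + (\<integral>\<^sup>+ t. ennreal (f (- t)) \<partial>lborel)"
    by (rule nn_integral_add) auto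
  also have "(\<integral>\<^sup>+ t. ennreal (f (- t)) \<partial>lborel) = (\<integral>\<^sup>+ t. ennreal (f t) \<partial>lborel)"
    using nn_integral_real_affine[of "\<lambda>t. ennreal (f t)" "-1" 0] by simp
  also have "(\<integral>\<^sup>+ t. ennreal (f t) \<partial>lborel) + (\<integral>\<^sup>+ t. ennreal (f t) \<partial>lborel) < \<infinity>"
    using I by (simp add: ennreal_add_less_top)
  finally show ?thesis .
qed

text \<open>The half-line is covered by the intervals of length \<open>\<pi>\<close> around the multiples \<open>k \<pi>\<close>; their contributions are
  bounded by a geometric series.\<close>

lemma nn_integral_exp_sin_weight:
  assumes s: "0 \<le> s" "s < 1/2" and nu: "0 < nu"
  shows "(\<integral>\<^sup>+ t. indicator {0..} t * (ennreal (exp (- t / nu)) * sin_weight s t) \<partial>lborel) < \<infinity>"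
proof -
  define I where "I = {- (pi/2)..pi/2}"
  define J where "J = (\<integral>\<^sup>+ t. indicator I t * sin_weight s t \<partial>lborel)"
  define r where "r = exp (- pi / nu)"
  define C where "C = exp (pi / (2 * nu))"
  have J: "J < \<infinity>" unfolding J_def I_def by (rule nn_integral_sin_weight_period[OF s(2,1)])
  have r: "0 < r" "r < 1" using nu by (simp_all add: r_def)
  have piece: "(\<integral>\<^sup>+ t. indicator I (t - real k * pi) * (ennreal (exp (- t / nu)) * sin_weight s t) \<partial>lborel)
     \<le> ennreal (C * r ^ k) * J" for k
  proof -
    have "(\<integral>\<^sup>+ t. indicator I (t - real k * pi) * (ennreal (exp (- t / nu)) * sin_weight s t) \<partial>lborel)
        = (\<integral>\<^sup>+ t. indicator I t * (ennreal (exp (- (t + real k * pi) / nu)) * sin_weight s t) \<partial>lborel)"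
      using nn_integral_real_affine[of "\<lambda>t. indicator I (t - real k * pi) * (ennreal (exp (- t / nu)) * sin_weight s t)" 1 "real k * pi"]
      by (simp add: I_def sin_weight_periodic add.commute[of "real k * pi"])
    also have "\<dots> \<le> (\<integral>\<^sup>+ t. ennreal (C * r ^ k) * (indicator I t * sin_weight s t) \<partial>lborel)"
    proof (rule nn_integral_mono)
      fix t
      have "exp (- (t + real k * pi) / nu) \<le> C * r ^ k" if "t \<in> I"
      proof -
        have "- (t + real k * pi) / nu \<le> pi / (2 * nu) + real k * (- pi / nu)"
          using that nu by (simp add: I_def field_simps)
        then have "exp (- (t + real k * pi) / nu) \<le> exp (pi / (2 * nu) + real k * (- pi / nu))" by simp
        also have "\<dots> = C * r ^ k" unfolding C_def r_def exp_add exp_of_nat_mult ..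
        finally show ?thesis .
      qed
      then show "indicator I t * (ennreal (exp (- (t + real k * pi) / nu)) * sin_weight s t)
          \<le> ennreal (C * r ^ k) * (indicator I t * sin_weight s t)"
        by (cases "t \<in> I") (auto intro!: mult_right_mono ennreal_leI)
    qed
    also have "\<dots> = ennreal (C * r ^ k) * J"
      unfolding J_def by (rule nn_integral_cmult) (simp add: I_def)
    finally show ?thesis .
  qed
  have cover: "indicator {0..} t \<le> (\<Sum>k. indicator I (t - real k * pi) :: ennreal)" for t :: real
  proof (cases "t \<ge> 0")
    case True
    define k where "k = nat \<lfloor>t / pi + 1/2\<rfloor>"
    have "0 \<le> \<lfloor>t / pi + 1/2\<rfloor>" using True by simp
    then have k: "real k \<le> t / pi + 1/2" "t / pi + 1/2 < real k + 1"
      unfolding k_def by (auto simp: of_nat_nat)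
    have "real k * pi \<le> t + pi/2" "t + pi/2 < (real k + 1) * pi"
      using k by (simp_all add: field_simps)
    then have "t - real k * pi \<in> I" by (simp add: I_def algebra_simps)
    then have "1 \<le> (\<Sum>i\<in>{k}. indicator I (t - real i * pi) :: ennreal)" by simp
    also have "\<dots> \<le> (\<Sum>k. indicator I (t - real k * pi) :: ennreal)"
      by (rule sum_le_suminf) auto
    finally show ?thesis using True by simp
  qed simp
  have "(\<integral>\<^sup>+ t. indicator {0..} t * (ennreal (exp (- t / nu)) * sin_weight s t) \<partial>lborel)
      \<le> (\<integral>\<^sup>+ t. (\<Sum>k. indicator I (t - real k * pi) * (ennreal (exp (- t / nu)) * sin_weight s t)) \<partial>lborel)"
    by (intro nn_integral_mono) (auto simp: ennreal_suminf_multc intro!: mult_right_mono cover)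
  also have "\<dots> = (\<Sum>k. \<integral>\<^sup>+ t. indicator I (t - real k * pi) * (ennreal (exp (- t / nu)) * sin_weight s t) \<partial>lborel)"
    by (rule nn_integral_suminf) (simp add: I_def)
  also have "\<dots> \<le> (\<Sum>k. ennreal (C * r ^ k) * J)"
    by (intro suminf_le piece) auto
  also have "\<dots> = (\<Sum>k. ennreal (C * r ^ k)) * J" by simp
  also have "(\<Sum>k. ennreal (C * r ^ k)) = ennreal (\<Sum>k. C * r ^ k)"
    by (rule suminf_ennreal2) (use r in \<open>auto simp: C_def intro!: summable_mult summable_geometric\<close>)
  finally show ?thesis using J by (simp add: ennreal_mult_less_top less_le_trans le_less_trans)
qed


text \<open>The image under the phase of Lebesgue measure on the shell \<open>1/2 \<le> |x|\<^sup>2 < 1\<close>. Phase greater than \<open>a\<close>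
  means radius greater than \<open>\<rho>(a) = sqrt (1 - exp (- a / nu))\<close>, a set of volume \<open>V (1 - \<rho>(a)\<^sup>n)\<close>, and the
  density is the derivative of \<open>V \<rho>\<^sup>n\<close>.\<close>

lemma distr_log_radius:
  fixes nu :: real
  assumes nu: "0 < nu" and dim: "2 \<le> CARD('n::finite)"
  defines "S \<equiv> {x :: real^'n. norm x < 1 \<and> 1/2 \<le> x \<bullet> x}"
    and "V \<equiv> unit_ball_vol (real CARD('n))"
  shows "distr (density lborel (indicator S)) borel (\<lambda>x. - nu * ln (1 - x \<bullet> x))
    = density lborel (\<lambda>t. ennreal (V * (real CARD('n) / (2 * nu)) * sqrt (1 - exp (- t / nu)) ^ (CARD('n) - 2) * exp (- t / nu))
        * indicator {nu * ln 2..} t)"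
    (is "distr _ _ ?T = density lborel (\<lambda>t. ennreal (?f t) * _)")
proof -
  define n where "n = CARD('n)"
  have n: "2 \<le> n" using dim by (simp add: n_def)
  have V: "0 \<le> V" by (simp add: V_def)
  define t0 where "t0 = nu * ln 2"
  have t0: "0 < t0" using nu by (simp add: t0_def)
  have S_eq: "S = ball 0 1 - ball 0 (sqrt (1/2))"
  proof -
    have "1/2 \<le> x \<bullet> x \<longleftrightarrow> sqrt (1/2) \<le> norm x" for x :: "real^'n"
      by (simp only: norm_eq_sqrt_inner real_sqrt_le_iff)
    then show ?thesis by (simp add: S_def set_eq_iff not_less)
  qed
  have [measurable]: "S \<in> sets borel" unfolding S_eq by simp
  have [measurable]: "?T \<in> borel_measurable borel" by measurable
  define \<rho> where "\<rho> t = sqrt (1 - exp (- t / nu))" for t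
  have \<rho>_range: "0 \<le> \<rho> t" "\<rho> t < 1" if "t > 0" for t using that nu by (auto simp: \<rho>_def)
  have shell: "emeasure lborel (ball (0 :: real^'n) 1 - cball 0 r) = ennreal (V - V * r ^ n)"
    "emeasure lborel (ball (0 :: real^'n) 1 - ball 0 r) = ennreal (V - V * r ^ n)" if "0 \<le> r" "r < 1" for r
  proof -
    have sub: "cball 0 r \<subseteq> ball (0 :: real^'n) 1" "ball 0 r \<subseteq> ball (0 :: real^'n) 1" using that by auto
    have fin: "emeasure lborel (cball (0 :: real^'n) r) \<noteq> \<infinity>" "emeasure lborel (ball (0 :: real^'n) r) \<noteq> \<infinity>"
      using that by (simp_all add: emeasure_cball emeasure_ball)
    show "emeasure lborel (ball (0 :: real^'n) 1 - cball 0 r) = ennreal (V - V * r ^ n)"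
      using that V by (subst emeasure_Diff[OF fin(1) _ _ sub(1)])
        (auto simp: emeasure_cball emeasure_ball V_def n_def ennreal_minus)
    show "emeasure lborel (ball (0 :: real^'n) 1 - ball 0 r) = ennreal (V - V * r ^ n)"
      using that V by (subst emeasure_Diff[OF fin(2) _ _ sub(2)])
        (auto simp: emeasure_ball V_def n_def ennreal_minus)
  qed
  define F where "F t = V * \<rho> t ^ n" for t
  have L: "emeasure (distr (density lborel (indicator S)) borel ?T) {a<..} = ennreal (V - F (max a t0))" for a
  proof -
    have "emeasure (distr (density lborel (indicator S)) borel ?T) {a<..} = emeasure lborel (S \<inter> ?T -` {a<..})"
    proof -
      have A: "?T -` {a<..} \<in> sets borel"
        using measurable_sets[OF \<open>?T \<in> borel_measurable borel\<close>, of "{a<..}"] by simp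
      have "emeasure (distr (density lborel (indicator S)) borel ?T) {a<..}
          = emeasure (density lborel (indicator S)) (?T -` {a<..} \<inter> space (density lborel (indicator S)))"
        by (rule emeasure_distr) simp_all
      also have "\<dots> = (\<integral>\<^sup>+ x. indicator S x * indicator (?T -` {a<..}) x \<partial>lborel)"
        using A by (subst emeasure_density) simp_all
      also have "\<dots> = (\<integral>\<^sup>+ x. indicator (S \<inter> ?T -` {a<..}) x \<partial>lborel)"
        by (simp only: indicator_inter_arith)
      also have "\<dots> = emeasure lborel (S \<inter> ?T -` {a<..})"
        by (rule nn_integral_indicator) (use A in simp)
      finally show ?thesis .
    qed
    also have "\<dots> = ennreal (V - F (max a t0))"
    proof (cases "t0 \<le> a")
      case True
      then have a: "a > 0" using t0 by simp
      have "S \<inter> ?T -` {a<..} = ball 0 1 - cball 0 (\<rho> a)"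
      proof -
        have "x \<in> S \<and> a < ?T x \<longleftrightarrow> \<rho> a < norm x" if "norm x < 1" for x :: "real^'n"
        proof -
          have q: "0 < 1 - x \<bullet> x" using that by (simp add: dot_square_norm power_less_one_iff)
          have 1: "a < ?T x \<longleftrightarrow> 1 - x \<bullet> x < exp (- a / nu)"
          proof -
            have "a < ?T x \<longleftrightarrow> ln (1 - x \<bullet> x) < - a / nu"
            proof -
              have "ln (1 - x \<bullet> x) < - a / nu \<longleftrightarrow> ln (1 - x \<bullet> x) * nu < - a"
                by (rule pos_less_divide_eq[OF nu])
              moreover have "?T x = - (ln (1 - x \<bullet> x) * nu)" by simp
              ultimately show ?thesis by linarith
            qed
            also have "\<dots> \<longleftrightarrow> 1 - x \<bullet> x < exp (- a / nu)"
              using exp_less_cancel_iff[of "ln (1 - x \<bullet> x)" "- a / nu"] q by simp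
            finally show ?thesis .
          qed
          have 2: "1 - x \<bullet> x < exp (- a / nu) \<longleftrightarrow> \<rho> a < norm x"
          proof -
            have "1 - x \<bullet> x < exp (- a / nu) \<longleftrightarrow> 1 - exp (- a / nu) < x \<bullet> x" by linarith
            then show ?thesis unfolding \<rho>_def norm_eq_sqrt_inner real_sqrt_less_iff .
          qed
          have "exp (- a / nu) \<le> exp (- ln 2)" using True nu by (simp add: t0_def field_simps)
          also have "exp (- ln 2) = (1/2 :: real)" by (simp add: exp_minus)
          finally have "1/2 < x \<bullet> x" if "1 - x \<bullet> x < exp (- a / nu)" using that by linarith
          then have "x \<in> S" if "\<rho> a < norm x" using that 2 \<open>norm x < 1\<close> by (simp add: S_def)
          then show ?thesis unfolding 1 2 by blast
        qed
        moreover have "norm x < 1" if "x \<in> S" for x using that by (simp add: S_def)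
        ultimately show ?thesis by (simp add: set_eq_iff not_le) blast
      qed
      then show ?thesis using shell(1)[OF \<rho>_range[OF a]] True by (simp add: F_def max_def)
    next
      case False
      have "a < ?T x" if "x \<in> S" for x
      proof -
        have q: "0 < 1 - x \<bullet> x" "1 - x \<bullet> x \<le> 1/2" using that by (auto simp: S_def dot_square_norm power_less_one_iff)
        then have "ln (1 - x \<bullet> x) \<le> ln (1/2)" by simp
        then have "ln (1 - x \<bullet> x) \<le> - ln 2" by (simp add: ln_div)
        then have "nu * ln 2 \<le> nu * (- ln (1 - x \<bullet> x))" using nu by (intro mult_left_mono) auto
        then show ?thesis using False by (simp add: t0_def)
      qed
      then have "S \<inter> ?T -` {a<..} = S" by auto
      moreover have "\<rho> t0 = sqrt (1/2)" using nu by (simp add: \<rho>_def t0_def exp_minus)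
      ultimately show ?thesis using shell(2)[of "sqrt (1/2)"] False
        by (simp add: F_def S_eq max_def)
    qed
    finally show ?thesis .
  qed
  have meas_f: "?f \<in> borel_measurable borel" by measurable
  have R: "emeasure (density lborel (\<lambda>t. ennreal (?f t) * indicator {t0..} t)) {a<..} = ennreal (V - F (max a t0))" for a
  proof -
    have "emeasure (density lborel (\<lambda>t. ennreal (?f t) * indicator {t0..} t)) {a<..}
        = (\<integral>\<^sup>+ t. ennreal (?f t) * indicator {t0..} t * indicator {a<..} t \<partial>lborel)"
      by (rule emeasure_density) (use meas_f in auto)
    also have "\<dots> = (\<integral>\<^sup>+ t. ennreal (?f t) * indicator {max a t0..} t \<partial>lborel)"
    proof (rule nn_integral_cong_AE)
      have "AE t in lborel. t \<noteq> a" by (rule AE_lborel_singleton)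
      then show "AE t in lborel. ennreal (?f t) * indicator {t0..} t * indicator {a<..} t = ennreal (?f t) * indicator {max a t0..} t"
        by eventually_elim (auto simp: indicator_def)
    qed
    also have "\<dots> = ennreal (V - F (max a t0))"
    proof (rule nn_integral_FTC_atLeast)
      show "?f \<in> borel_measurable borel" by (rule meas_f)
      fix t assume "max a t0 \<le> t"
      then have t: "t > 0" using t0 by simp
      have pos: "0 < 1 - exp (- t / nu)" using t nu by simp
      then have \<rho>: "\<rho> t > 0" by (simp add: \<rho>_def)
      show "0 \<le> ?f t" using V pos nu by (intro mult_nonneg_nonneg) auto
      have ex: "((\<lambda>t. 1 - exp (- t / nu)) has_real_derivative exp (- t / nu) / nu) (at t)"
        using nu by (auto intro!: derivative_eq_intros)
      have "(\<rho> has_real_derivative inverse (\<rho> t) / 2 * (exp (- t / nu) / nu)) (at t)"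
        unfolding \<rho>_def by (rule DERIV_chain2[OF DERIV_real_sqrt[OF pos] ex])
      from DERIV_cmult[OF DERIV_power[OF this, of n], of V]
      have D: "(F has_real_derivative V * (real n * (inverse (\<rho> t) / 2 * (exp (- t / nu) / nu) * \<rho> t ^ (n - Suc 0)))) (at t)"
        unfolding F_def .
      have "n - Suc 0 = Suc (n - 2)" using n by simp
      then have pow: "inverse (\<rho> t) * \<rho> t ^ (n - Suc 0) = \<rho> t ^ (n - 2)" using \<rho> by simp
      have "V * (real n * (inverse (\<rho> t) / 2 * (exp (- t / nu) / nu) * \<rho> t ^ (n - Suc 0)))
          = V * (real n / (2 * nu)) * (inverse (\<rho> t) * \<rho> t ^ (n - Suc 0)) * exp (- t / nu)"
        by simp
      then have "V * (real n * (inverse (\<rho> t) / 2 * (exp (- t / nu) / nu) * \<rho> t ^ (n - Suc 0)))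
          = V * (real n / (2 * nu)) * \<rho> t ^ (n - 2) * exp (- t / nu)" unfolding pow .
      from DERIV_cong[OF D this] show "(F has_real_derivative ?f t) (at t)"
        unfolding \<rho>_def n_def .
    next
      have "filterlim (\<lambda>t. 1 / nu * (- t)) at_bot at_top"
        by (rule filterlim_tendsto_pos_mult_at_bot[OF tendsto_const _ filterlim_uminus_at_bot_at_top]) (use nu in simp)
      from filterlim_compose[OF exp_at_bot this]
      have e0: "((\<lambda>t. exp (- t / nu)) \<longlongrightarrow> 0) at_top" by simp
      have "(\<rho> \<longlongrightarrow> sqrt (1 - 0)) at_top"
        unfolding \<rho>_def by (rule tendsto_real_sqrt[OF tendsto_diff[OF tendsto_const e0]])
      from tendsto_mult[OF tendsto_const[of V] tendsto_power[OF this, of n]]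
      have "(F \<longlongrightarrow> V * sqrt (1 - 0) ^ n) at_top" unfolding F_def .
      then show "(F \<longlongrightarrow> V) at_top" by simp
    qed
    finally show ?thesis .
  qed
  show ?thesis
  proof (rule measure_eqI_lessThan)
    fix a
    show "emeasure (distr (density lborel (indicator S)) borel ?T) {a<..} < \<infinity>"
      unfolding L by simp
    show "emeasure (distr (density lborel (indicator S)) borel ?T) {a<..}
      = emeasure (density lborel (\<lambda>t. ennreal (?f t) * indicator {nu * ln 2..} t)) {a<..}"
      by (rule trans[OF L[unfolded t0_def] R[unfolded t0_def, symmetric]])
  qed simp_all
qed


lemma nn_integral_shell_sin_weight:
  fixes nu :: real
  assumes nu: "0 < nu" and dim: "2 \<le> CARD('n::finite)" and s: "0 \<le> s" "s < 1/2"
  shows "(\<integral>\<^sup>+ x. indicator {x :: real^'n. norm x < 1 \<and> 1/2 \<le> x \<bullet> x} x * sin_weight s (- nu * ln (1 - x \<bullet> x)) \<partial>lborel) < \<infinity>"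
proof -
  define S where "S = {x :: real^'n. norm x < 1 \<and> 1/2 \<le> x \<bullet> x}"
  define T where "T x = - nu * ln (1 - x \<bullet> x)" for x :: "real^'n"
  define C where "C = unit_ball_vol (real CARD('n)) * (real CARD('n) / (2 * nu))"
  define f where "f t = C * sqrt (1 - exp (- t / nu)) ^ (CARD('n) - 2) * exp (- t / nu)" for t
  have C: "0 \<le> C" using nu by (simp add: C_def)
  have [measurable]: "S \<in> sets borel" unfolding S_def by measurable
  have [measurable]: "T \<in> borel_measurable borel" unfolding T_def by measurable
  have [measurable]: "f \<in> borel_measurable borel" unfolding f_def by measurable
  have distr: "distr (density lborel (indicator S)) borel T = density lborel (\<lambda>t. ennreal (f t) * indicator {nu * ln 2..} t)"
    unfolding S_def T_def f_def C_def by (rule distr_log_radius[OF nu dim])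
  have "(\<integral>\<^sup>+ x. indicator S x * sin_weight s (T x) \<partial>lborel)
     = (\<integral>\<^sup>+ t. sin_weight s t \<partial>distr (density lborel (indicator S)) borel T)"
    by (simp add: nn_integral_distr nn_integral_density)
  also have "\<dots> = (\<integral>\<^sup>+ t. ennreal (f t) * indicator {nu * ln 2..} t * sin_weight s t \<partial>lborel)"
    unfolding distr by (simp add: nn_integral_density)
  also have "\<dots> \<le> (\<integral>\<^sup>+ t. ennreal C * (indicator {0..} t * (ennreal (exp (- t / nu)) * sin_weight s t)) \<partial>lborel)"
  proof (rule nn_integral_mono)
    fix t
    show "ennreal (f t) * indicator {nu * ln 2..} t * sin_weight s t
      \<le> ennreal C * (indicator {0..} t * (ennreal (exp (- t / nu)) * sin_weight s t))"
    proof (cases "nu * ln 2 \<le> t")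
      case True
      moreover have "0 \<le> nu * ln 2" using nu by simp
      ultimately have t: "0 \<le> t" by linarith
      have "sqrt (1 - exp (- t / nu)) ^ (CARD('n) - 2) \<le> 1"
        using t nu by (intro power_le_one) auto
      then have "f t \<le> C * 1 * exp (- t / nu)"
        unfolding f_def using C by (intro mult_right_mono mult_left_mono) auto
      then have "ennreal (f t) \<le> ennreal C * ennreal (exp (- t / nu))"
        using C by (simp add: ennreal_mult[symmetric] ennreal_leI)
      then show ?thesis using True t by (simp add: mult_right_mono mult.assoc[symmetric])
    qed simp
  qed
  also have "\<dots> = ennreal C * (\<integral>\<^sup>+ t. indicator {0..} t * (ennreal (exp (- t / nu)) * sin_weight s t) \<partial>lborel)"
    by (rule nn_integral_cmult) measurable
  also have "\<dots> < \<infinity>"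
    using nn_integral_exp_sin_weight[OF s nu] by (simp add: ennreal_mult_less_top)
  finally show ?thesis unfolding S_def T_def .
qed

section \<open>Curvature defect of the sawtooth metric\<close>

context saw_profile
begin

definition spike_bound :: "real \<Rightarrow> real" where
  "spike_bound q = (1 + real N / nu) * width q / ((sin (phase q))\<^sup>2 + (width q)\<^sup>2 * (cos (phase q))\<^sup>2)"

lemma spike_denom_pos: "q < 1 \<Longrightarrow> 0 < (sin (phase q))\<^sup>2 + (width q)\<^sup>2 * (cos (phase q))\<^sup>2"
  by (rule sin_cos_denom_pos) (simp add: width_def)

lemma spike_bound_nonneg: "q < 1 \<Longrightarrow> 0 \<le> spike_bound q"
  using spike_denom_pos[of q] nu by (simp add: spike_bound_def width_def)

lemma spike_le: "q < 1 \<Longrightarrow> spike q \<le> spike_bound q"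
proof -
  assume q: "q < 1"
  have "\<bar>sin (phase q) * cos (phase q)\<bar> \<le> 1"
    using abs_sin_le_one[of "phase q"] abs_cos_le_one[of "phase q"] by (simp add: abs_mult mult_le_one)
  then have "real N / nu * (sin (phase q) * cos (phase q)) \<le> real N / nu * 1"
    using nu by (intro mult_left_mono) auto
  then have "width q * (1 + real N / nu * sin (phase q) * cos (phase q)) \<le> width q * (1 + real N / nu)"
    using q by (intro mult_left_mono) (auto simp: width_def mult.assoc)
  then show ?thesis
    unfolding spike_def spike_bound_def using spike_denom_pos[OF q]
    by (simp add: divide_right_mono mult.commute)
qed

text \<open>Since \<open>width \<le> 1\<close>, the denominator is at least \<open>width\<^sup>2\<close>, and \<open>width \<ge> 2\<^sup>-\<^sup>N\<close> for \<open>q \<le> 1/2\<close>.\<close>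

lemma spike_bound_le_const:
  assumes "0 \<le> q" "q \<le> 1/2" shows "spike_bound q \<le> (1 + real N / nu) * 2 ^ N"
proof -
  define e S where "e = width q" and "S = (sin (phase q))\<^sup>2 + e\<^sup>2 * (cos (phase q))\<^sup>2"
  have e: "0 < e" "e \<le> 1" using assms by (auto simp: e_def width_def power_le_one)
  have "(1/2) ^ N \<le> e" using assms by (auto simp: e_def width_def intro!: power_mono)
  then have e2: "1 \<le> e * 2 ^ N" by (simp add: power_one_over field_simps)
  have "e\<^sup>2 \<le> 1" using e by (simp add: power_le_one)
  then have "e\<^sup>2 * (sin (phase q))\<^sup>2 \<le> 1 * (sin (phase q))\<^sup>2" by (intro mult_right_mono) auto
  moreover have "e\<^sup>2 * (sin (phase q))\<^sup>2 + e\<^sup>2 * (cos (phase q))\<^sup>2 = e\<^sup>2"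
    by (simp add: sin_cos_squared_add flip: distrib_left)
  ultimately have S: "e\<^sup>2 \<le> S" by (simp add: S_def)
  have Spos: "S > 0" using S e by (meson less_le_trans zero_less_power)
  have "e * 1 \<le> e * (e * 2 ^ N)" using e e2 by (intro mult_left_mono) auto
  also have "\<dots> = e\<^sup>2 * 2 ^ N" by (simp add: power2_eq_square)
  also have "\<dots> \<le> S * 2 ^ N" using S by (intro mult_right_mono) auto
  finally have "e / S \<le> 2 ^ N" using Spos by (simp add: divide_le_eq mult.commute)
  then have "(1 + real N / nu) * (e / S) \<le> (1 + real N / nu) * 2 ^ N"
    using nu by (intro mult_left_mono) auto
  then show ?thesis by (simp add: spike_bound_def e_def S_def)
qed

lemma spike_bound_le_sin:
  assumes "q < 1" "sin (phase q) \<noteq> 0"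
  shows "spike_bound q \<le> (1 + real N / nu) * width q / (sin (phase q))\<^sup>2"
  unfolding spike_bound_def
  using assms nu by (intro divide_left_mono) (auto simp: width_def intro!: mult_pos_pos add_pos_nonneg)

text \<open>With \<open>m = 4 q P / (1 - q)\<close> one has \<open>4 q P Q' = m (nu / 2) (spike - 1)\<close>. Here \<open>m\<close> lies between \<open>0\<close> and \<open>10\<close>,
  and \<open>m \<ge> 1\<close> for \<open>q \<ge> 1/2\<close>.\<close>

lemma profile_curvature:
  assumes q: "0 \<le> q" "q < 1"
  shows "4 * (Q q * P q + q * (Q q)\<^sup>2) - 1 \<le> 24"
    and "4 * q * P q * Q' q \<le> 5 * nu * spike_bound q"
    and "1/2 \<le> q \<Longrightarrow> 4 * q * P q * Q' q \<le> 5 * nu * spike_bound q - nu / 2"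
proof -
  define b where "b = 3 - pi / 2"
  have b: "b \<ge> 1" using pi_less_4 by (simp add: b_def)
  have Q: "b / 2 \<le> Q q" "Q q \<le> 5/2" unfolding b_def by (rule Q_bounds)+
  have P: "b / 2 * (1 - q) \<le> P q" "P q \<le> 5/2 * (1 - q)" using P_bounds[of q] q unfolding b_def by auto
  have Q0: "0 \<le> Q q" using Q b by linarith
  have "0 \<le> b / 2 * (1 - q)" using b q by simp
  then have P0: "0 \<le> P q" using P(1) by linarith
  have "Q q * P q \<le> 5/2 * (5/2 * (1 - q))" using Q P Q0 P0 by (intro mult_mono) auto
  moreover have "q * (Q q)\<^sup>2 \<le> q * (5/2)\<^sup>2" using Q Q0 q by (intro mult_left_mono power_mono) auto
  ultimately show "4 * (Q q * P q + q * (Q q)\<^sup>2) - 1 \<le> 24" by (simp add: power2_eq_square)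
  define m where "m = 4 * q * (P q / (1 - q))"
  have PL: "P q / (1 - q) \<le> 5/2" "1/2 \<le> P q / (1 - q)"
  proof -
    show "P q / (1 - q) \<le> 5/2" using P(2) q by (simp add: divide_le_eq)
    have "1/2 * (1 - q) \<le> b / 2 * (1 - q)" using b q by (intro mult_right_mono) auto
    then show "1/2 \<le> P q / (1 - q)" using P(1) q by (simp add: le_divide_eq)
  qed
  have "q * (P q / (1 - q)) \<le> 1 * (5/2)" using PL q by (intro mult_mono) auto
  then have m: "m \<le> 10" by (simp add: m_def)
  have "0 \<le> q * (P q / (1 - q))" using PL q by (intro mult_nonneg_nonneg) auto
  then have m0: "0 \<le> m" by (simp add: m_def)
  have Z: "4 * q * P q * Q' q = m * (nu / 2) * spike q - m * (nu / 2)"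
  proof -
    have "4 * q * p * (nu * (S - 1) / (2 * L)) = 4 * q * (p / L) * (nu / 2) * S - 4 * q * (p / L) * (nu / 2)" for p S L :: real
      by (simp add: right_diff_distrib diff_divide_distrib mult_ac)
    then show ?thesis unfolding m_def Q'_def .
  qed
  have "m * (nu / 2) * spike q \<le> m * (nu / 2) * spike_bound q"
    using spike_le[OF q(2)] m0 nu by (intro mult_left_mono) auto
  also have "\<dots> \<le> 10 * (nu / 2) * spike_bound q"
    using spike_bound_nonneg[OF q(2)] m nu by (intro mult_right_mono) auto
  finally have up: "m * (nu / 2) * spike q \<le> 5 * nu * spike_bound q" by simp
  have "0 \<le> m * (nu / 2)" using m0 nu by simp
  then show "4 * q * P q * Q' q \<le> 5 * nu * spike_bound q" unfolding Z using up by linarith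
  assume "1/2 \<le> q"
  then have "1/2 * (1/2) \<le> q * (P q / (1 - q))" using PL q by (intro mult_mono) auto
  moreover have "m = 4 * (q * (P q / (1 - q)))" by (simp add: m_def)
  ultimately have "1 \<le> m" by linarith
  then have "1 * (nu / 2) \<le> m * (nu / 2)" using nu by (intro mult_right_mono) auto
  then show "4 * q * P q * Q' q \<le> 5 * nu * spike_bound q - nu / 2" unfolding Z using up by linarith
qed

end

context ball_model
begin

text \<open>By \<open>ricci_M\<close>, \<open>Ric + (n - 1)\<close> is the negative of \<open>Z + (n - 1) E + (n - 2) Z cos\<^sup>2 \<theta>\<close>, where \<open>Z = 4 q P Q'\<close>
  and \<open>\<theta>\<close> is the angle to the radial direction. The first two terms together are at most \<open>e\<close>, the last one is at most
  \<open>(n - 2) e\<close>.\<close>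

lemma ricci_defect_le:
  fixes p e
  defines "q \<equiv> \<Phi> p \<bullet> \<Phi> p"
  assumes dim: "2 \<le> CARD('n)" and e: "0 \<le> e" "4 * q * P q * Q' q \<le> e"
    "4 * q * P q * Q' q + (real CARD('n) - 1) * (4 * (Q q * P q + q * (Q q)\<^sup>2) - 1) \<le> e"
  shows "ricci_defect M p \<le> (real CARD('n) - 1) * e"
proof -
  define n where "n = real CARD('n)"
  have n: "2 \<le> n" using dim by (simp add: n_def)
  have P: "0 < P q" by (simp add: q_def)
  have q0: "0 \<le> q" by (simp add: q_def)
  define U where "U = {v \<in> tangent_space M p. tnorm M p v = 1}"
  have "- ((n - 1) * e) \<le> (INF v\<in>U. ricci M p v v + (n - 1))"
  proof (rule cINF_greatest)
    have "tvec_of (P q *\<^sub>R axis undefined 1) \<in> U" using P by (simp add: U_def tnorm_M flip: q_def)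
    then show "U \<noteq> {}" by blast
    fix v assume "v \<in> U"
    then obtain w where v: "v = tvec_of w" and "norm w / P q = 1"
    proof -
      have "v = tvec_of (v c)" "norm (v c) / P q = 1"
        using \<open>v \<in> U\<close> tangent_space_tvec_of[of v p] by (auto simp: U_def tnorm_M q_def)
      then show ?thesis by (rule that)
    qed
    then have w: "w \<bullet> w = (P q)\<^sup>2" using P by (simp add: dot_square_norm)
    define y where "y = (\<Phi> p \<bullet> w)\<^sup>2"
    have y: "0 \<le> y" "y \<le> q * (P q)\<^sup>2"
      using Cauchy_Schwarz_ineq[of "\<Phi> p" w] w by (auto simp: y_def q_def)
    have k: "4 * Q' q / P q * y \<le> e"
    proof (cases "0 \<le> Q' q")
      case True
      then have "4 * Q' q / P q * y \<le> 4 * Q' q / P q * (q * (P q)\<^sup>2)"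
        using y P by (intro mult_left_mono) auto
      also have "\<dots> = 4 * q * P q * Q' q" using P by (simp add: power2_eq_square)
      finally show ?thesis using e by simp
    next
      case False
      then have "4 * Q' q / P q \<le> 0" using P by (intro divide_nonpos_pos) auto
      then have "4 * Q' q / P q * y \<le> 0" using y(1) by (rule mult_nonpos_nonneg)
      then show ?thesis using e by simp
    qed
    define X Y where "X = 4 * Q' q / P q * y" and "Y = Q q * P q + q * (Q q)\<^sup>2"
    have "ricci M p v v = - (n - 2) * X - (4 * q * P q * Q' q + 4 * (n - 1) * Y)"
    proof -
      have "(w \<bullet> w) / (P q)\<^sup>2 = 1" using w P by simp
      then have "ricci M p (tvec_of w) (tvec_of w) = - (n - 2) * (4 * Q' q / P q) * y
          - (4 * q * P q * Q' q + 4 * (n - 1) * Y)"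
        using ricci_M[of p w, folded q_def n_def y_def] unfolding Y_def by (simp only: mult_1_right)
      then show ?thesis by (simp add: v X_def)
    qed
    moreover have "(n - 2) * X \<le> (n - 2) * e"
      unfolding X_def using k n by (intro mult_left_mono) auto
    moreover have "4 * q * P q * Q' q + (n - 1) * (4 * Y - 1) \<le> e"
      using e(3) by (simp add: n_def Y_def)
    moreover have "(n - 1) * (4 * Y - 1) = 4 * (n - 1) * Y - (n - 1)" "(n - 1) * e = (n - 2) * e + e"
      "- (n - 2) * X = - ((n - 2) * X)"
      by (simp_all add: algebra_simps)
    ultimately show "- ((n - 1) * e) \<le> ricci M p v v + (n - 1)" by linarith
  qed
  moreover have "0 \<le> (n - 1) * e" using n e by simp
  ultimately show ?thesis
    unfolding ricci_defect_def neg_part_def U_def n_def by simp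
qed

lemma ricci_defect_nonneg: "0 \<le> ricci_defect M p"
  by (simp add: ricci_defect_def neg_part_def)

end

section \<open>A metric with integrable defect and large spectrum\<close>

text \<open>The choice of \<open>nu\<close> makes the gain \<open>nu / 2 = 24 n\<close> exceed \<open>(n - 1) E\<close>, as \<open>E \<le> 24\<close>. The choice of \<open>N\<close>
  makes \<open>width\<^sup>s = (1 - q)\<^sup>N\<^sup>s\<close> absorb the volume density, which grows like \<open>(1 - q)\<^sup>-\<^sup>n\<close>.\<close>

locale saw_ball = saw_profile nu N for nu N +
  fixes \<Phi> \<Psi> :: "real^'n::finite \<Rightarrow> real^'n" and s :: real
  assumes homeomorphism: "homeomorphism UNIV (ball 0 1) \<Phi> \<Psi>"
    and dim: "2 \<le> CARD('n)" and nu_eq: "nu = 48 * real CARD('n)"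
    and s: "0 < s" "s < 1/2" and N: "real CARD('n) \<le> real N * s"
begin

sublocale ball_model_gap P Q Q' \<Phi> \<Psi> "3 - pi / 2"
proof
  fix q :: real
  have b: "0 < 3 - pi / 2" using pi_less_4 by simp
  show "0 < P q" if "q < 1"
    using P_bounds(1)[of q] that b by (smt (verit) divide_pos_pos mult_pos_pos)
qed (use homeomorphism smooth_P P_has_derivative Q_has_derivative pi_less_4 P_bounds Q_bounds in auto)

sublocale ball_model_complete P Q Q' \<Phi> \<Psi> "5 / 2"
  by unfold_locales (use P_bounds in auto)

definition defect_bound :: "real \<Rightarrow> real" where
  "defect_bound q = (real CARD('n) - 1) *
     (if q < 1/2 then 5 * nu * ((1 + real N / nu) * 2 ^ N) + 24 * real CARD('n) else 5 * nu * spike_bound q)"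

lemma ricci_defect_le_defect_bound: "ricci_defect M p \<le> defect_bound (\<Phi> p \<bullet> \<Phi> p)"
proof -
  define n q where "n = real CARD('n)" and "q = \<Phi> p \<bullet> \<Phi> p"
  have q: "0 \<le> q" "q < 1" using inner_less_1[OF Phi_in] by (simp_all add: q_def)
  have n: "2 \<le> n" using dim by (simp add: n_def)
  note K = profile_curvature[OF q]
  define X where "X = (n - 1) * (4 * (Q q * P q + q * (Q q)\<^sup>2) - 1)"
  have "X \<le> (n - 1) * 24"
    unfolding X_def using K(1) n by (intro mult_left_mono) auto
  then have E: "X \<le> 24 * n" by (simp add: left_diff_distrib)
  note le = ricci_defect_le[OF dim, of _ p, folded q_def n_def, folded X_def]
  have sb: "0 \<le> 5 * nu * spike_bound q" using spike_bound_nonneg[OF q(2)] nu by simp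
  show ?thesis
  proof (cases "q < 1/2")
    case True
    have c: "5 * nu * spike_bound q \<le> 5 * nu * ((1 + real N / nu) * 2 ^ N)"
      using spike_bound_le_const[of q] True q nu by (intro mult_left_mono) auto
    have "ricci_defect M p \<le> (n - 1) * (5 * nu * ((1 + real N / nu) * 2 ^ N) + 24 * n)"
      by (rule le) (use K(2) E c sb n in linarith)+
    then show ?thesis using True by (simp add: defect_bound_def n_def flip: q_def)
  next
    case False
    then have Z: "4 * q * P q * Q' q \<le> 5 * nu * spike_bound q - 24 * n"
      using K(3) nu_eq by (simp add: n_def)
    have "ricci_defect M p \<le> (n - 1) * (5 * nu * spike_bound q)"
      by (rule le) (use sb K(2) Z E in linarith)+
    then show ?thesis using False by (simp add: defect_bound_def n_def flip: q_def)
  qed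
qed

lemma defect_bound_measurable [measurable]: "defect_bound \<in> borel_measurable borel"
proof -
  have [measurable]: "phase \<in> borel_measurable borel" "width \<in> borel_measurable borel"
    unfolding phase_def[abs_def] width_def[abs_def] by simp_all
  have [measurable]: "(sin :: real \<Rightarrow> real) \<in> borel_measurable borel" "(cos :: real \<Rightarrow> real) \<in> borel_measurable borel"
    by (auto intro!: borel_measurable_continuous_onI continuous_intros)
  show ?thesis unfolding defect_bound_def[abs_def] spike_bound_def by measurable
qed

definition inner_const :: real where
  "inner_const = 4 ^ CARD('n) * defect_bound 0 powr s"
definition outer_const :: real where
  "outer_const = 2 ^ CARD('n) * ((real CARD('n) - 1) * (5 * nu * (1 + real N / nu))) powr s"

lemma P_half: "q \<le> 1 \<Longrightarrow> (1 - q) / 2 \<le> P q"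
proof -
  assume q: "q \<le> 1"
  have "1 / 2 * (1 - q) \<le> (3 - pi / 2) / 2 * (1 - q)"
    using pi_less_4 q by (intro mult_right_mono) auto
  then show ?thesis using P_bounds(1)[OF q] by simp
qed

lemma dens_le: "x \<in> B \<Longrightarrow> dens x \<le> (2 / (1 - x \<bullet> x)) ^ CARD('n)"
proof -
  assume x: "x \<in> B"
  then have q: "x \<bullet> x < 1" by (rule inner_less_1)
  have "inverse (P (x \<bullet> x)) \<le> inverse ((1 - x \<bullet> x) / 2)"
    using P_half[of "x \<bullet> x"] q by (intro le_imp_inverse_le) auto
  then have "inverse (P (x \<bullet> x)) \<le> 2 / (1 - x \<bullet> x)" by simp
  then show ?thesis using x P_inner_pos[OF x] by (auto simp: dens_def intro!: power_mono)
qed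

text \<open>The density is at most \<open>2\<^sup>n (1 - q)\<^sup>-\<^sup>n\<close>, and the defect contributes
  \<open>width\<^sup>s = (1 - q)\<^sup>N\<^sup>s \<le> (1 - q)\<^sup>n\<close> besides the weight.\<close>

lemma defect_density_outer:
  assumes x: "x \<in> B" and half: "1/2 \<le> x \<bullet> x" and sin: "sin (phase (x \<bullet> x)) \<noteq> 0"
  shows "dens x * defect_bound (x \<bullet> x) powr s \<le> outer_const * \<bar>sin (phase (x \<bullet> x))\<bar> powr (- 2 * s)"
proof -
  define q n l where "q = x \<bullet> x" and "n = CARD('n)" and "l = 1 - q"
  define \<sigma> where "\<sigma> = \<bar>sin (phase q)\<bar>"
  define A where "A = (real n - 1) * (5 * nu * (1 + real N / nu))"
  have l: "0 < l" "l \<le> 1" using inner_less_1[OF x] half by (simp_all add: q_def l_def)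
  have \<sigma>: "0 < \<sigma>" using sin by (simp add: \<sigma>_def q_def)
  have n2: "2 \<le> n" using dim by (simp add: n_def)
  then have A: "0 \<le> A" using nu by (simp add: A_def)
  have "spike_bound q \<le> (1 + real N / nu) * width q / (sin (phase q))\<^sup>2"
    using spike_bound_le_sin[of q] sin l by (simp add: q_def l_def)
  then have "(real n - 1) * (5 * nu * spike_bound q) \<le> (real n - 1) * (5 * nu * ((1 + real N / nu) * width q / (sin (phase q))\<^sup>2))"
    using n2 nu by (intro mult_left_mono) auto
  also have "\<dots> = A * (l ^ N * \<sigma> powr (- 2))"
    using \<sigma> by (simp add: A_def width_def l_def \<sigma>_def powr_minus divide_inverse)
  finally have W: "defect_bound q \<le> A * (l ^ N * \<sigma> powr (- 2))"
    using half by (simp add: defect_bound_def q_def n_def)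
  have W0: "0 \<le> defect_bound q"
    using half n2 nu spike_bound_nonneg[of q] l by (simp add: defect_bound_def q_def n_def l_def)
  have "defect_bound q powr s \<le> (A * (l ^ N * \<sigma> powr (- 2))) powr s"
    using W W0 s by (intro powr_mono2) auto
  also have "\<dots> = A powr s * (l powr (real N * s) * \<sigma> powr (- 2 * s))"
    using A l \<sigma> by (simp add: powr_mult powr_powr powr_realpow[symmetric])
  also have "\<dots> \<le> A powr s * (l ^ n * \<sigma> powr (- 2 * s))"
  proof -
    have "l powr (real N * s) \<le> l powr real n" using N l by (intro powr_mono') (auto simp: n_def)
    then have "l powr (real N * s) \<le> l ^ n" using l by (simp add: powr_realpow)
    then show ?thesis by (intro mult_left_mono mult_right_mono) auto
  qed
  finally have 1: "defect_bound q powr s \<le> A powr s * (l ^ n * \<sigma> powr (- 2 * s))" .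
  have "dens x * defect_bound q powr s \<le> (2 / l) ^ n * (A powr s * (l ^ n * \<sigma> powr (- 2 * s)))"
    using 1 dens_le[OF x] dens_nonneg[of x] l by (intro mult_mono) (auto simp: q_def l_def n_def)
  also have "\<dots> = 2 ^ n * A powr s * \<sigma> powr (- 2 * s)" using l by (simp add: power_divide)
  finally show ?thesis by (simp add: outer_const_def A_def n_def q_def \<sigma>_def)
qed

lemma defect_density_inner:
  assumes x: "x \<in> B" and half: "x \<bullet> x < 1/2"
  shows "dens x * defect_bound (x \<bullet> x) powr s \<le> inner_const"
proof -
  have "2 / (1 - x \<bullet> x) \<le> 4" using half by (simp add: divide_le_eq)
  then have "(2 / (1 - x \<bullet> x)) ^ CARD('n) \<le> 4 ^ CARD('n)"
    using half by (intro power_mono) auto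
  then have "dens x \<le> 4 ^ CARD('n)" using dens_le[OF x] by linarith
  moreover have "defect_bound (x \<bullet> x) = defect_bound 0" using half by (simp add: defect_bound_def)
  ultimately show ?thesis by (simp add: inner_const_def mult_right_mono)
qed

lemma integrable_defect:
  "(\<integral>\<^sup>+ p. ennreal (ricci_defect M p powr s) \<partial>riemannian_volume M) < \<infinity>"
proof -
  define S where "S = {x :: real^'n. norm x < 1 \<and> 1/2 \<le> x \<bullet> x}"
  have [measurable]: "S \<in> sets borel" unfolding S_def by measurable
  have [measurable]: "\<Phi> \<in> borel_measurable borel" by (rule borel_measurable_continuous_onI[OF cont_Phi])
  have [measurable]: "(\<lambda>x::real^'n. phase (x \<bullet> x)) \<in> borel_measurable borel" unfolding phase_def by measurable
  have outer_pos: "0 < outer_const"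
  proof -
    have "0 < (real CARD('n) - 1) * (5 * nu * (1 + real N / nu))"
      using dim nu by (intro mult_pos_pos add_pos_nonneg) auto
    then show ?thesis unfolding outer_const_def by (intro mult_pos_pos) auto
  qed
  have "(\<integral>\<^sup>+ p. ennreal (ricci_defect M p powr s) \<partial>riemannian_volume M)
      \<le> (\<integral>\<^sup>+ p. ennreal (defect_bound (\<Phi> p \<bullet> \<Phi> p) powr s) \<partial>vol)"
    unfolding riemannian_volume_M
    using ricci_defect_le_defect_bound ricci_defect_nonneg s
    by (intro nn_integral_mono ennreal_leI powr_mono2) auto
  also have "\<dots> = (\<integral>\<^sup>+ x. ennreal (dens x) * ennreal (defect_bound (\<Phi> (inv_chart x) \<bullet> \<Phi> (inv_chart x)) powr s) \<partial>lborel)"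
    by (rule nn_integral_vol) measurable
  also have "\<dots> \<le> (\<integral>\<^sup>+ x. ennreal inner_const * indicator B x
      + ennreal outer_const * (indicator S x * sin_weight s (phase (x \<bullet> x))) \<partial>lborel)"
  proof (rule nn_integral_mono)
    fix x :: "real^'n"
    show "ennreal (dens x) * ennreal (defect_bound (\<Phi> (inv_chart x) \<bullet> \<Phi> (inv_chart x)) powr s)
      \<le> ennreal inner_const * indicator B x + ennreal outer_const * (indicator S x * sin_weight s (phase (x \<bullet> x)))"
    proof (cases "x \<in> B")
      case False
      then show ?thesis by (simp add: dens_def)
    next
      case True
      have eq: "ennreal (dens x) * ennreal (defect_bound (\<Phi> (inv_chart x) \<bullet> \<Phi> (inv_chart x)) powr s)
        = ennreal (dens x * defect_bound (x \<bullet> x) powr s)"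
        using True Phi_Psi[OF True] dens_nonneg by (simp add: inv_chart_def ennreal_mult)
      consider "x \<bullet> x < 1/2" | "x \<in> S" "sin (phase (x \<bullet> x)) = 0" | "x \<in> S" "sin (phase (x \<bullet> x)) \<noteq> 0"
      proof -
        have "x \<bullet> x < 1/2 \<or> x \<in> S" using True by (auto simp: S_def)
        then show thesis using that by blast
      qed
      then show ?thesis
      proof cases
        case 1
        then show ?thesis unfolding eq using defect_density_inner[OF True] True
          by (simp add: ennreal_leI add_increasing2)
      next
        case 2
        then show ?thesis using outer_pos by (simp add: sin_weight_def ennreal_mult_top)
      next
        case 3
        then have "dens x * defect_bound (x \<bullet> x) powr s \<le> outer_const * \<bar>sin (phase (x \<bullet> x))\<bar> powr (- 2 * s)"
          using defect_density_outer[OF True] by (simp add: S_def)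
        then have "ennreal (dens x * defect_bound (x \<bullet> x) powr s) \<le> ennreal outer_const * sin_weight s (phase (x \<bullet> x))"
          using 3 outer_pos by (simp add: sin_weight_def ennreal_mult[symmetric] ennreal_leI)
        then show ?thesis unfolding eq using 3 by (simp add: add_increasing)
      qed
    qed
  qed
  also have "\<dots> = ennreal inner_const * emeasure lborel B
      + ennreal outer_const * (\<integral>\<^sup>+ x. indicator S x * sin_weight s (phase (x \<bullet> x)) \<partial>lborel)"
  proof -
    have B: "(\<lambda>x. ennreal inner_const * indicator B x) \<in> borel_measurable lborel"
      by (intro borel_measurable_times_ennreal measurable_const borel_measurable_indicator) simp_all
    have W: "(\<lambda>x. indicator S x * sin_weight s (phase (x \<bullet> x))) \<in> borel_measurable lborel" by measurable
    have "(\<lambda>x. ennreal outer_const * (indicator S x * sin_weight s (phase (x \<bullet> x)))) \<in> borel_measurable lborel"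
      by measurable
    then show ?thesis
      using nn_integral_add[OF B] nn_integral_cmult[OF W, of "ennreal outer_const"]
        nn_integral_cmult_indicator[of B lborel "ennreal inner_const"] by simp
  qed
  also have "\<dots> < \<infinity>"
  proof -
    have "(\<integral>\<^sup>+ x. indicator S x * sin_weight s (phase (x \<bullet> x)) \<partial>lborel) < \<infinity>"
      unfolding S_def phase_def by (rule nn_integral_shell_sin_weight[OF nu dim]) (use s in auto)
    moreover have "emeasure lborel B < \<infinity>" by (simp add: emeasure_ball)
    ultimately show ?thesis by (simp add: ennreal_mult_less_top ennreal_add_less_top)
  qed
  finally show ?thesis .
qed

lemma spectrum_bottom_greater: "spectrum_bottom M > (real CARD('n) - 1)\<^sup>2 / 4"
proof -
  define n b where "n = real CARD('n) - 1" and "b = 3 - pi / 2"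
  have n: "0 < n" using dim by (simp add: n_def)
  have "1 < b" using pi_less_4 by (simp add: b_def)
  then have "n < n * b" using n by simp
  then have "(n / 2)\<^sup>2 < (n * b / 2)\<^sup>2" using n by (intro power_strict_mono) auto
  also have "\<dots> \<le> spectrum_bottom M" using spectrum_bottom_ge by (simp add: n_def b_def)
  finally show ?thesis by (simp add: n_def power_divide)
qed

end

theorem theorem3p1:
  fixes s :: real
  assumes "CARD('n::finite) \<ge> 2"
    and "0 < s" and "s < 1/2"
  shows "\<exists>M :: (real^'n, 'n) riemannian.
           complete_riemannian_manifold M \<and>
           (\<integral>\<^sup>+ x. ennreal (ricci_defect M x powr s) \<partial>riemannian_volume M) < \<infinity> \<and>
           spectrum_bottom M > (real CARD('n) - 1)\<^sup>2 / 4"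
proof -
  obtain \<Phi> \<Psi> :: "real^'n \<Rightarrow> real^'n" where hom: "homeomorphism UNIV (ball 0 1) \<Phi> \<Psi>"
    using homeomorphic_ball01_UNIV homeomorphic_sym unfolding homeomorphic_def by blast
  obtain N :: nat where "real CARD('n) / s < real N" using reals_Archimedean2 by blast
  then have N: "real CARD('n) \<le> real N * s" using assms(2) by (simp add: divide_less_eq)
  interpret saw_ball "48 * real CARD('n)" N \<Phi> \<Psi> s
    by unfold_locales (use assms hom N in auto)
  show ?thesis
    using complete_M integrable_defect spectrum_bottom_greater by blast
qed

end
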